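(* The number $S$ of strings of resonances satisfies $$S\le N-K+J\le N-1 .$$ The $K-J-1$ delta functions located strictly between the dominant pair cannot contribute strings: for integers $1=j_1<\dots<j_n=N$ with $j_I=J$, $j_{I+1}=K$ for some $I$ and $\Gamma=\{\gamma_{JK}\}\cup\{\tilde\gamma_{j_ij_{i+1}}:1\le i\le n-1,\ i\ne I\}$, no $j_i$ satisfies $J<j_i<K$. The inequality $S\le N-K+J$ is sharp: for every $N\ge2$ and all $1\le J<K\le N$ there are parameters with dominant pair $(J,K)$ for which equality holds. Moreover, equality $S=N-K+J$ always holds for $N=2$ and $N=3$, and for $N=4$ whenever $(J,K)\notin\{(1,2),(3,4)\}$.
   Context: Setting. Fix an integer $N\ge 2$ and real parameters $x_1<\dots<x_N$, $C_j\neq 0$, $\beta_j>0$ ($1\le j\le N$). For $h>0$ put $V(x)=\sum_{j=1}^N C_jh^{1+\beta_j}\delta(x-x_j)$ on $\mathbb{R}$. Resonances. A resonance (for a given $h>0$) is a $z\in\mathbb{C}\setminus\{0\}$ for which $(-h^2\partial_x^2+V-z^2)u=0$ has a nonzero outgoing solution. Explicitly (with $x_0=-\infty$, $x_{N+1}=+\infty$): there are coefficients $v_j^\pm$, not all zero, with $v_0^+=v_N^-=0$, such that $u(x)=v_j^+e^{izx/h}+v_j^-e^{-izx/h}$ on $(x_j,x_{j+1})$ for $0\le j\le N$ satisfies $u(x_j^-)=u(x_j^+)$ and $h^2\big(u'(x_j^-)-u'(x_j^+)\big)+C_jh^{1+\beta_j}u(x_j)=0$ for $1\le j\le N$. Strings.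 A string of resonances is a sequence of resonances $z(h_j)$, $h_j\to0^+$, with $\operatorname{Re} z\in U$ for some $U\Subset(0,\infty)$ and $\operatorname{Im} z=-\gamma h\log(1/h)+O(h)$; strings are identified by their value of $\gamma$, so the number $S$ of strings is the number of real $\gamma$ for which such a sequence exists. Newton polygon. Let $P=\{(2(x_k-x_j),\,\beta_j+\beta_k):1\le j<k\le N\}\cup\{(0,0)\}\subset\mathbb{R}^2$, with points written $(\lambda,\nu)$. The Newton polygon is the convex hull of the epigraph $\{(\lambda,t):(\lambda,\nu)\in P,\ t\ge\nu\}$. $\Gamma$ is the (finite) set of slopes of the non-vertical edges of its boundary. Standing assumption (on all parameters considered). The non-infinite slopes of the Newton polygon are unique, in the sense that among any three distinct collinear points of $P$ at least one lies in the interior of the Newton polygon. Notation. For $1\le j<k\le N$ put $\gamma_{jk}=\dfrac{\beta_k+\beta_j}{2(x_k-x_j)}$ and $\tilde\gamma_{jk}=\dfrac{|\beta_k-\beta_j|}{2(x_k-x_j)}$. The dominant pair $(J,K)$, $J<K$, is the pair minimizing $\gamma_{jk}$ among all pairs $j<k$; the standing assumption guarantees that it is unique. *)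

theory Defs
  imports "HOL-Analysis.Analysis" "HOL-Library.Landau_Symbols"
begin

text \<open>
  The parameters \<open>x\<close>, \<open>C\<close>, \<open>\<beta>\<close> are functions on \<open>nat\<close> of which only the values on \<open>{1..N}\<close> matter.
\<close>

definition delta_params :: "nat \<Rightarrow> (nat \<Rightarrow> real) \<Rightarrow> (nat \<Rightarrow> real) \<Rightarrow> (nat \<Rightarrow> real) \<Rightarrow> bool" where
  "delta_params N x C \<beta> \<longleftrightarrow>
     2 \<le> N \<and> strict_mono_on {1..N} x \<and> (\<forall>j\<in>{1..N}. C j \<noteq> 0) \<and> (\<forall>j\<in>{1..N}. \<beta> j > 0)"

definition wave :: "real \<Rightarrow> complex \<Rightarrow> complex \<Rightarrow> complex \<Rightarrow> real \<Rightarrow> complex" where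
  "wave h z a b y =
     a * exp (\<i> * z * of_real y / of_real h) + b * exp (- (\<i> * z * of_real y / of_real h))"

text \<open>
  The outgoing solution equals \<open>wave h z (vp j) (vm j)\<close> between \<open>x j\<close> and \<open>x (j + 1)\<close>, where
  \<open>x 0\<close> and \<open>x (N + 1)\<close> are read as minus and plus infinity. Each piece is smooth on the
  whole line, so the one-sided values and derivatives of the solution at \<open>x j\<close> are the
  values and derivatives there of the pieces with index \<open>j - 1\<close> and \<open>j\<close>.
\<close>

definition resonance ::
  "nat \<Rightarrow> (nat \<Rightarrow> real) \<Rightarrow> (nat \<Rightarrow> real) \<Rightarrow> (nat \<Rightarrow> real) \<Rightarrow> real \<Rightarrow> complex \<Rightarrow> bool" where
  "resonance N x C \<beta> h z \<longleftrightarrow>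
     z \<noteq> 0 \<and>
     (\<exists>vp vm :: nat \<Rightarrow> complex.
        (\<exists>j\<le>N. vp j \<noteq> 0 \<or> vm j \<noteq> 0) \<and> vp 0 = 0 \<and> vm N = 0 \<and>
        (\<forall>j\<in>{1..N}.
           let ul = wave h z (vp (j - 1)) (vm (j - 1)); ur = wave h z (vp j) (vm j) in
             ul (x j) = ur (x j) \<and>
             of_real (h\<^sup>2) *
               (vector_derivative ul (at (x j)) - vector_derivative ur (at (x j)))
               + of_real (C j * h powr (1 + \<beta> j)) * ul (x j) = 0))"

definition string_exponents ::
  "nat \<Rightarrow> (nat \<Rightarrow> real) \<Rightarrow> (nat \<Rightarrow> real) \<Rightarrow> (nat \<Rightarrow> real) \<Rightarrow> real set" where
  "string_exponents N x C \<beta> =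
     {\<gamma>. \<exists>(h :: nat \<Rightarrow> real) (z :: nat \<Rightarrow> complex) (U :: real set).
        (\<forall>n. h n > 0) \<and> h \<longlonglongrightarrow> 0 \<and>
        (\<forall>n. resonance N x C \<beta> (h n) (z n)) \<and>
        compact (closure U) \<and> closure U \<subseteq> {0<..} \<and> (\<forall>n. Re (z n) \<in> U) \<and>
        (\<lambda>n. Im (z n) - (- \<gamma> * h n * ln (1 / h n))) \<in> O(h)}"

text \<open>Being a cardinality, this is meaningful only together with finiteness of the set.\<close>

definition num_strings ::
  "nat \<Rightarrow> (nat \<Rightarrow> real) \<Rightarrow> (nat \<Rightarrow> real) \<Rightarrow> (nat \<Rightarrow> real) \<Rightarrow> nat" where
  "num_strings N x C \<beta> = card (string_exponents N x C \<beta>)"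

definition newton_points :: "nat \<Rightarrow> (nat \<Rightarrow> real) \<Rightarrow> (nat \<Rightarrow> real) \<Rightarrow> (real \<times> real) set" where
  "newton_points N x \<beta> =
     {(2 * (x k - x j), \<beta> j + \<beta> k) | j k. 1 \<le> j \<and> j < k \<and> k \<le> N} \<union> {(0, 0)}"

definition newton_polygon :: "nat \<Rightarrow> (nat \<Rightarrow> real) \<Rightarrow> (nat \<Rightarrow> real) \<Rightarrow> (real \<times> real) set" where
  "newton_polygon N x \<beta> =
     convex hull {(l, t) | l \<nu> t. (l, \<nu>) \<in> newton_points N x \<beta> \<and> t \<ge> \<nu>}"

text \<open>
  \<open>edge_of\<close> refers to the one-dimensional faces; here these include the two vertical rays,
  which are left out by asking for two points with different first coordinates.
\<close>

definition newton_slopes :: "nat \<Rightarrow> (nat \<Rightarrow> real) \<Rightarrow> (nat \<Rightarrow> real) \<Rightarrow> real set" where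
  "newton_slopes N x \<beta> =
     {s. \<exists>e. e edge_of newton_polygon N x \<beta> \<and>
           (\<exists>p\<in>e. \<exists>q\<in>e. fst p \<noteq> fst q \<and> s = (snd q - snd p) / (fst q - fst p))}"

definition slopes_unique :: "nat \<Rightarrow> (nat \<Rightarrow> real) \<Rightarrow> (nat \<Rightarrow> real) \<Rightarrow> bool" where
  "slopes_unique N x \<beta> \<longleftrightarrow>
     (\<forall>a\<in>newton_points N x \<beta>. \<forall>b\<in>newton_points N x \<beta>. \<forall>c\<in>newton_points N x \<beta>.
        a \<noteq> b \<and> a \<noteq> c \<and> b \<noteq> c \<and> collinear {a, b, c} \<longrightarrow>
        {a, b, c} \<inter> interior (newton_polygon N x \<beta>) \<noteq> {})"

definition pair_slope :: "(nat \<Rightarrow> real) \<Rightarrow> (nat \<Rightarrow> real) \<Rightarrow> nat \<Rightarrow> nat \<Rightarrow> real" where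
  "pair_slope x \<beta> j k = (\<beta> k + \<beta> j) / (2 * (x k - x j))"

definition pair_slope_tilde :: "(nat \<Rightarrow> real) \<Rightarrow> (nat \<Rightarrow> real) \<Rightarrow> nat \<Rightarrow> nat \<Rightarrow> real" where
  "pair_slope_tilde x \<beta> j k = \<bar>\<beta> k - \<beta> j\<bar> / (2 * (x k - x j))"

definition dominant_pair ::
  "nat \<Rightarrow> (nat \<Rightarrow> real) \<Rightarrow> (nat \<Rightarrow> real) \<Rightarrow> nat \<Rightarrow> nat \<Rightarrow> bool" where
  "dominant_pair N x \<beta> J K \<longleftrightarrow>
     1 \<le> J \<and> J < K \<and> K \<le> N \<and>
     (\<forall>j k. 1 \<le> j \<and> j < k \<and> k \<le> N \<longrightarrow> pair_slope x \<beta> J K \<le> pair_slope x \<beta> j k)"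

text \<open>
  The list \<open>js\<close> holds integers \<open>1 = js ! 0 < \<dots> < js ! (length js - 1) = N\<close>; consecutive
  entries \<open>J, K\<close> contribute their \<open>pair_slope\<close> to the Newton slopes, the remaining consecutive
  entries their \<open>pair_slope_tilde\<close>.
\<close>

definition slope_chain ::
  "nat \<Rightarrow> (nat \<Rightarrow> real) \<Rightarrow> (nat \<Rightarrow> real) \<Rightarrow> nat \<Rightarrow> nat \<Rightarrow> nat list \<Rightarrow> bool" where
  "slope_chain N x \<beta> J K js \<longleftrightarrow>
     js \<noteq> [] \<and> sorted_wrt (<) js \<and> hd js = 1 \<and> last js = N \<and>
     (\<exists>I. Suc I < length js \<and> js ! I = J \<and> js ! Suc I = K \<and>
        newton_slopes N x \<beta> =
          {pair_slope x \<beta> J K} \<union>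
          {pair_slope_tilde x \<beta> (js ! i) (js ! Suc i) | i. Suc i < length js \<and> i \<noteq> I})"

end

theory Submission
  imports Defs "HOL-Complex_Analysis.Complex_Analysis"
begin

text \<open>
Tracing the coefficients of a solution through the points from left to right shows that a nonzero
outgoing solution exists if and only if a finite exponential sum, the secular function, vanishes.
Its terms are, apart from the constant \<open>1\<close>,
indexed by chains \<open>j\<^sub>1 < \<dots> < j\<^sub>r\<close> of scatterers. Where \<open>Im z\<close> is close to
\<open>- \<gamma> h ln (1/h)\<close> the term of a pair \<open>j < k\<close> has size \<open>h\<close> to the power
\<open>\<beta>\<^sub>j + \<beta>\<^sub>k - 2 \<gamma> (x\<^sub>k - x\<^sub>j)\<close>, and the longer chains only perturb the pair formed by
their end points (\<open>secular_leading\<close>). A root needs two terms of the largest size, which says that \<open>\<gamma>\<close>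
is the slope of a non-vertical edge of the Newton polygon. Conversely, if exactly two terms are
largest, then along a sequence \<open>h \<rightarrow> 0\<close> on which their phases agree the rescaled secular function
converges to a sum of two exponentials. This limit has roots, and by Hurwitz' theorem they persist.
Under the uniqueness assumption the strings are therefore exactly the Newton slopes
(\<open>string_exponents_eq\<close>).

It remains to count slopes. The exponent of a pair splits as
\<open>(\<beta>\<^sub>j + 2 \<gamma> x\<^sub>j) + (\<beta>\<^sub>k - 2 \<gamma> x\<^sub>k)\<close>, and for \<open>j \<ge> k\<close> this sum is positive. Once the minimum over
pairs is at most \<open>0\<close>, the constraint \<open>j < k\<close> is thus automatic and the two summands are minimized
independently (\<open>support_points_iff\<close>): the left end point runs through the lower envelope of
one family of lines, the right end point through that of another. At the dominant slope the
minimizing pair is \<open>(J, K)\<close>. As \<open>\<gamma>\<close> grows, the left minimizer descends from \<open>J\<close> to \<open>1\<close>, the right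
one ascends from \<open>K\<close> to \<open>N\<close>, and each change of one of them is a slope, of the form \<open>|\<beta>\<^sub>k - \<beta>\<^sub>j|\<close> over
\<open>2 (x\<^sub>k - x\<^sub>j)\<close>. Uniqueness makes the changes happen one at a time, so the number of slopes is one less
than the number of indices that are ever visible (\<open>card_newton_slopes\<close>). These lie in
\<open>{1..J} \<union> {K..N}\<close>, which gives the bound \<open>N - K + J\<close>. It is attained when all of them are visible:
trivially if \<open>J \<le> 2\<close> and \<open>K \<ge> N - 1\<close>, and in general for equally spaced points with quadratically
growing \<open>\<beta>\<close> on both sides of the dominant pair.
\<close>

section \<open>Slopes of the hull of an epigraph\<close>

definition epi_hull :: "(real \<times> real) set \<Rightarrow> (real \<times> real) set" where
  "epi_hull P = convex hull {(l, t) | l \<nu> t. (l, \<nu>) \<in> P \<and> t \<ge> \<nu>}"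

abbreviation height :: "real \<Rightarrow> real \<times> real \<Rightarrow> real" where
  "height s p \<equiv> snd p - s * fst p"

definition support_points :: "(real \<times> real) set \<Rightarrow> real \<Rightarrow> (real \<times> real) set" where
  "support_points P s = {p \<in> P. \<forall>r\<in>P. height s p \<le> height s r}"

lemma height_eq_inner: "height s p = (- s, 1) \<bullet> p"
  by (cases p) (simp add: inner_Pair)

lemma points_in_epi_hull: "p \<in> P \<Longrightarrow> fst q = fst p \<Longrightarrow> snd p \<le> snd q \<Longrightarrow> q \<in> epi_hull P"
  unfolding epi_hull_def by (rule hull_inc) (cases p; cases q; auto)

lemma epi_hull_minimal:
  assumes "convex T" "\<And>p q. p \<in> P \<Longrightarrow> fst q = fst p \<Longrightarrow> snd p \<le> snd q \<Longrightarrow> q \<in> T"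
  shows "epi_hull P \<subseteq> T"
  unfolding epi_hull_def
proof (rule hull_minimal)
  show "{(l, t) |l \<nu> t. (l, \<nu>) \<in> P \<and> \<nu> \<le> t} \<subseteq> T"
  proof clarsimp
    fix a b \<nu> assume "(a, \<nu>) \<in> P" "\<nu> \<le> b"
    then show "(a, b) \<in> T" using assms(2)[of "(a, \<nu>)" "(a, b)"] by simp
  qed
qed (use assms in auto)

lemma convex_epi_hull: "convex (epi_hull P)"
  by (simp add: epi_hull_def)

lemma epi_hull_upward:
  assumes "p \<in> epi_hull P" "fst q = fst p" "snd p \<le> snd q"
  shows "q \<in> epi_hull P"
proof -
  define c where "c = snd q - snd p"
  have "epi_hull P \<subseteq> {r. r + (0, c) \<in> epi_hull P}"
  proof (rule epi_hull_minimal)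
    show "convex {r. r + (0, c) \<in> epi_hull P}"
    proof -
      have "{r. r + (0, c) \<in> epi_hull P} = (\<lambda>r. - (0, c) + r) ` epi_hull P"
      proof (intro equalityI subsetI)
        fix r assume "r \<in> {r. r + (0, c) \<in> epi_hull P}"
        then show "r \<in> (\<lambda>r. - (0, c) + r) ` epi_hull P"
          by (intro image_eqI[where x = "r + (0, c)"]) (auto simp: prod_eq_iff)
      qed auto
      then show ?thesis by (metis convex_epi_hull convex_translation)
    qed
  next
    fix r r' assume *: "r \<in> P" "fst r' = fst r" "snd r \<le> snd r'"
    have "0 \<le> c" using assms by (simp add: c_def)
    with * show "r' \<in> {r. r + (0, c) \<in> epi_hull P}"
      using points_in_epi_hull[of r P "r' + (0, c)"] by simp
  qed
  then have "p + (0, c) \<in> epi_hull P" using assms(1) by auto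
  moreover have "p + (0, c) = q" using assms by (simp add: c_def prod_eq_iff)
  ultimately show ?thesis by simp
qed

lemma epi_hull_height_ge:
  assumes "\<And>p. p \<in> P \<Longrightarrow> c \<le> height s p" "q \<in> epi_hull P"
  shows "c \<le> height s q"
proof -
  have "epi_hull P \<subseteq> {q. (- s, 1) \<bullet> q \<ge> c}"
  proof (rule epi_hull_minimal[OF convex_halfspace_ge])
    fix p q assume "p \<in> P" "fst q = fst p" "snd p \<le> snd q"
    then show "q \<in> {q. (- s, 1) \<bullet> q \<ge> c}"
      using assms(1)[of p] unfolding mem_Collect_eq height_eq_inner[symmetric] by simp
  qed
  then show ?thesis using assms(2) height_eq_inner by auto
qed

text \<open>
Adding one boundary point to an open half plane keeps it convex, so a supporting line that
meets \<open>P\<close> only once meets the hull only there.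
\<close>

lemma epi_hull_height_strict:
  assumes "\<And>p. p \<in> P \<Longrightarrow> p \<noteq> p0 \<Longrightarrow> height s p0 < height s p" "q \<in> epi_hull P" "q \<noteq> p0"
  shows "height s p0 < height s q"
proof -
  let ?T = "insert p0 {q. (- s, 1) \<bullet> q > height s p0}"
  have "convex ?T"
  proof (rule convexI)
    fix x y and u v :: real
    assume xy: "x \<in> ?T" "y \<in> ?T" and uv: "0 \<le> u" "0 \<le> v" "u + v = 1"
    show "u *\<^sub>R x + v *\<^sub>R y \<in> ?T"
    proof (cases "u = 0 \<or> v = 0 \<or> (x = p0 \<and> y = p0)")
      case True
      then show ?thesis using xy uv by (auto simp: scaleR_left_distrib[symmetric])
    next
      case False
      define X where "X = (- s, 1) \<bullet> x"
      define Y where "Y = (- s, 1) \<bullet> y"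
      define H where "H = height s p0"
      have H': "(-s, 1) \<bullet> p0 = H" by (simp add: H_def height_eq_inner)
      have ge: "X \<ge> H" "Y \<ge> H" and gt: "X > H \<or> Y > H"
        using xy False H' unfolding X_def Y_def H_def by auto
      have "u > 0" "v > 0" using False uv by auto
      then have "u * X + v * Y > u * H + v * H"
        using ge gt by (metis add_le_less_mono add_less_le_mono mult_left_mono mult_strict_left_mono uv(1,2))
      also have "u * H + v * H = H" using uv by (metis distrib_right mult_1)
      finally show ?thesis unfolding X_def Y_def H_def
        by (simp add: inner_add_right)
    qed
  qed
  moreover have "q \<in> ?T" if "p \<in> P" "fst q = fst p" "snd p \<le> snd q" for p q
  proof (cases "p = p0 \<and> q = p0")
    case False
    have "height s p0 < height s q"
    proof (cases "p = p0")
      case True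
      then have "snd q \<noteq> snd p" using False that by (auto simp: prod_eq_iff)
      then show ?thesis using True that by simp
    next
      case False
      then show ?thesis using assms(1)[OF that(1)] that by simp
    qed
    then show ?thesis by (simp add: height_eq_inner)
  qed auto
  ultimately have "epi_hull P \<subseteq> ?T" by (rule epi_hull_minimal)
  then show ?thesis using assms(2,3) by (auto simp: height_eq_inner)
qed

lemma support_points_nonempty:
  assumes "finite P" "P \<noteq> {}"
  shows "support_points P s \<noteq> {}"
proof -
  have "arg_min_on (height s) P \<in> support_points P s"
    using arg_min_if_finite[OF assms, of "height s"] by (auto simp: support_points_def not_less)
  then show ?thesis by auto
qed

text \<open>
A point of the hull below the line through \<open>p\<close> and \<open>q\<close> could be reflected through their midpoint
to a point above the chord, hence again in the hull. The midpoint would then be interior to a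
segment leaving the line, and the face would not be one-dimensional.
\<close>

lemma support_line_of_edge:
  assumes e: "e edge_of epi_hull P" and p: "p \<in> e" and q: "q \<in> e" and pq: "fst p \<noteq> fst q"
    and s: "s = (snd q - snd p) / (fst q - fst p)" and r: "r \<in> epi_hull P"
  shows "height s p \<le> height s r"
proof (rule ccontr)
  assume neg: "\<not> ?thesis"
  have sq: "snd q - snd p = s * (fst q - fst p)" using pq s by simp
  have hq: "height s q = height s p" using sq by (simp add: algebra_simps)
  define m where "m = (1/2) *\<^sub>R (p + q)"
  have fm: "fst m = (fst p + fst q) / 2" and sm: "snd m = (snd p + snd q) / 2"
    by (auto simp: m_def)
  have hm: "height s m = height s p" using hq unfolding fm sm by (simp add: field_simps)
  have eP: "e face_of epi_hull P" and dim: "aff_dim e = 1" using e by (auto simp: edge_of_def)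
  have "convex e" using eP face_of_imp_convex by auto
  have me: "m \<in> e"
    using convexD[OF \<open>convex e\<close> p q, of "1/2" "1/2"] by (simp add: m_def scaleR_right_distrib)
  have peP: "p \<in> epi_hull P" and qeP: "q \<in> epi_hull P"
    using eP p q face_of_imp_subset by blast+
  define d where "d = \<bar>fst q - fst p\<bar> / 2"
  have "d > 0" using pq by (simp add: d_def)
  define \<epsilon> where "\<epsilon> = d / (1 + \<bar>fst m - fst r\<bar>)"
  have \<epsilon>: "\<epsilon> > 0" "\<epsilon> * \<bar>fst m - fst r\<bar> \<le> d"
    using \<open>d > 0\<close> by (auto simp: \<epsilon>_def field_simps)
  \<comment> \<open>the reflection of \<open>r\<close> through \<open>m\<close>, scaled by \<open>\<epsilon>\<close> so that it stays above the chord from \<open>p\<close> to \<open>q\<close>\<close>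
  define r' where "r' = m + \<epsilon> *\<^sub>R (m - r)"
  define t where "t = (fst r' - fst p) / (fst q - fst p)"
  \<comment> \<open>the point of the chord below \<open>r'\<close>\<close>
  define w where "w = (1 - t) *\<^sub>R p + t *\<^sub>R q"
  have "\<bar>fst r' - fst m\<bar> \<le> d" using \<epsilon> by (simp add: r'_def abs_mult)
  then have t: "0 \<le> t" "t \<le> 1"
    using pq unfolding t_def d_def fm by (auto simp: field_simps abs_if split: if_splits)
  have weP: "w \<in> epi_hull P"
    unfolding w_def using convexD[OF convex_epi_hull peP qeP] t by auto
  have "fst w = fst p + t * (fst q - fst p)" by (simp add: w_def algebra_simps)
  then have fw: "fst w = fst r'" using pq by (simp add: t_def)
  have "height s w = (1 - t) * height s p + t * height s q"
    by (simp add: w_def algebra_simps)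
  then have hw: "height s w = height s p" using hq by (simp add: algebra_simps)
  have hr': "height s r' = height s m + \<epsilon> * (height s m - height s r)"
    by (simp add: r'_def algebra_simps)
  have "height s r' > height s p"
    using neg \<epsilon>(1) hm unfolding hr' by simp
  then have "snd w \<le> snd r'" using hw fw by simp
  then have r'eP: "r' \<in> epi_hull P" using epi_hull_upward[OF weP] fw by simp
  have "(1 + \<epsilon>) *\<^sub>R m = r' + \<epsilon> *\<^sub>R r" by (simp add: r'_def algebra_simps)
  then have "m = inverse (1 + \<epsilon>) *\<^sub>R (r' + \<epsilon> *\<^sub>R r)"
    using \<epsilon>(1) by (metis add_pos_pos left_inverse less_irrefl scaleR_one scaleR_scaleR zero_less_one)
  moreover have "inverse (1 + \<epsilon>) = 1 - \<epsilon> / (1 + \<epsilon>)" using \<epsilon>(1) by (simp add: field_simps)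
  ultimately have "m = (1 - \<epsilon> / (1 + \<epsilon>)) *\<^sub>R r' + (\<epsilon> / (1 + \<epsilon>)) *\<^sub>R r"
    by (metis divide_inverse mult.commute scaleR_right_distrib scaleR_scaleR)
  moreover have "0 < \<epsilon> / (1 + \<epsilon>)" "\<epsilon> / (1 + \<epsilon>) < 1" using \<epsilon>(1) by auto
  moreover have "r' \<noteq> r" using \<open>height s r' > height s p\<close> neg by auto
  ultimately have "m \<in> open_segment r' r"
    unfolding in_segment by blast
  then have re: "r \<in> e" using eP me r r'eP unfolding face_of_def by blast
  have "\<not> affine_dependent {p, q, r} \<Longrightarrow> aff_dim {p, q, r} = 2"
  proof -
    assume "\<not> affine_dependent {p, q, r}"
    moreover have "p \<noteq> q" "q \<noteq> r" "p \<noteq> r" using neg hq pq by auto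
    then have "card {p, q, r} = 3" by simp
    ultimately show "aff_dim {p, q, r} = 2" using aff_dim_affine_independent[of "{p, q, r}"] by simp
  qed
  moreover have "aff_dim {p, q, r} \<le> 1"
    using aff_dim_subset[of "{p,q,r}" e] p q re dim by simp
  ultimately have "affine_dependent {p, q, r}" by auto
  then have "collinear {p, q, r}" using pq neg hq
    by (auto simp: affine_dependent_imp_collinear_3)
  moreover have "p \<noteq> q" using pq by auto
  ultimately obtain u where ru: "r = u *\<^sub>R p + (1 - u) *\<^sub>R q"
    unfolding collinear_3_expand by (metis collinear_3_expand insert_commute)
  have "height s r = u * height s p + (1 - u) * height s q"
    unfolding ru by (simp add: algebra_simps)
  then have "height s r = height s p" using hq by (simp add: algebra_simps)
  then show False using neg by simp
qed

lemma epi_hull_slopes: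
  assumes "finite P" "P \<noteq> {}"
  shows "(\<exists>e. e edge_of epi_hull P \<and>
           (\<exists>p\<in>e. \<exists>q\<in>e. fst p \<noteq> fst q \<and> s = (snd q - snd p) / (fst q - fst p))) \<longleftrightarrow>
         (\<exists>p\<in>support_points P s. \<exists>q\<in>support_points P s. p \<noteq> q)" (is "?L \<longleftrightarrow> ?R")
proof
  assume ?L
  then obtain e p q where e: "e edge_of epi_hull P" "p \<in> e" "q \<in> e" "fst p \<noteq> fst q"
    and s: "s = (snd q - snd p) / (fst q - fst p)" by blast
  have eP: "e \<subseteq> epi_hull P" using e(1) edge_of_imp_subset by auto
  have sup: "height s p \<le> height s r" if "r \<in> epi_hull P" for r
    using support_line_of_edge[OF e s that] .
  have "snd q - snd p = s * (fst q - fst p)" using e s by simp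
  then have hq: "height s q = height s p" by (simp add: algebra_simps)
  obtain p0 where p0: "p0 \<in> support_points P s" using support_points_nonempty[OF assms] by blast
  then have p0P: "p0 \<in> P" by (auto simp: support_points_def)
  have "p0 \<in> epi_hull P" using points_in_epi_hull[OF p0P] by auto
  show ?R
  proof (rule ccontr)
    assume "\<not> ?R"
    then have uniq: "r = p0" if "r \<in> support_points P s" for r using p0 that by blast
    have "height s p0 < height s r" if "r \<in> P" "r \<noteq> p0" for r
    proof -
      have "height s p0 \<le> height s r" using p0 that by (auto simp: support_points_def)
      moreover have "height s p0 \<noteq> height s r"
      proof
        assume "height s p0 = height s r"
        then have "r \<in> support_points P s" using p0 that by (auto simp: support_points_def)
        then show False using uniq that by auto
      qed
      ultimately show ?thesis by simp
    qed
    then have str: "height s p0 < height s r" if "r \<in> epi_hull P" "r \<noteq> p0" for r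
      using epi_hull_height_strict that by blast
    have "p \<noteq> p0 \<or> q \<noteq> p0" using e(4) by auto
    then show False using str[of p] str[of q] sup[OF \<open>p0 \<in> epi_hull P\<close>] hq e(2,3) eP by force
  qed
next
  assume ?R
  then obtain p q where pq: "p \<in> support_points P s" "q \<in> support_points P s" "p \<noteq> q" by blast
  define c where "c = height s p"
  have cq: "height s q = c" using pq by (auto simp: support_points_def c_def intro: antisym)
  have ge: "c \<le> (- s, 1) \<bullet> r" if "r \<in> epi_hull P" for r
    using epi_hull_height_ge[OF _ that, of c s] pq(1) unfolding height_eq_inner[symmetric] c_def
    by (auto simp: support_points_def)
  define e where "e = epi_hull P \<inter> {r. (- s, 1) \<bullet> r = c}"
  have face: "e face_of epi_hull P"
    unfolding e_def using ge by (intro face_of_Int_supporting_hyperplane_ge convex_epi_hull) auto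
  have pe: "p \<in> e" and qe: "q \<in> e"
    using pq cq points_in_epi_hull[of p P p] points_in_epi_hull[of q P q] unfolding e_def c_def height_eq_inner[symmetric]
    by (auto simp: support_points_def)
  have "aff_dim e \<le> aff_dim {r. (- s, 1::real) \<bullet> r = c}" unfolding e_def by (rule aff_dim_subset) auto
  also have "\<dots> = 1" by (subst aff_dim_hyperplane) (auto simp: prod_eq_iff)
  finally have le: "aff_dim e \<le> 1" .
  have "aff_dim {p, q} \<le> aff_dim e" by (rule aff_dim_subset) (use pe qe in auto)
  with le have "aff_dim e = 1" using pq(3) by simp
  with face have edge: "e edge_of epi_hull P" by (simp add: edge_of_def)
  have hh: "height s p = height s q" using cq c_def by simp
  have ne: "fst p \<noteq> fst q" using hh pq(3) by (auto simp: prod_eq_iff)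
  then have "s = (snd q - snd p) / (fst q - fst p)" using hh by (simp add: field_simps)
  with edge pe qe ne show ?L by blast
qed

lemma support_points_not_interior:
  assumes "p \<in> support_points P s"
  shows "p \<notin> interior (epi_hull P)"
proof
  assume "p \<in> interior (epi_hull P)"
  also have "\<dots> \<subseteq> interior {r. (- s, 1) \<bullet> r \<ge> height s p}"
    using assms epi_hull_height_ge[of P "height s p" s] unfolding height_eq_inner[symmetric]
    by (intro interior_mono) (auto simp: support_points_def)
  also have "\<dots> = {r. (- s, 1) \<bullet> r > height s p}"
    by (rule interior_halfspace_ge) (simp add: prod_eq_iff)
  finally show False by (simp add: height_eq_inner)
qed

lemma support_points_collinear: "collinear (support_points P s)"
  unfolding collinear_def
proof (rule exI[of _ "(1, s)"], intro ballI)
  fix p q assume "p \<in> support_points P s" "q \<in> support_points P s"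
  then have "height s p = height s q" by (auto simp: support_points_def intro: antisym)
  then have "p - q = (fst p - fst q) *\<^sub>R (1, s)" by (simp add: prod_eq_iff algebra_simps)
  then show "\<exists>c. p - q = c *\<^sub>R (1, s)" by blast
qed

text \<open>
A point of \<open>P\<close> outside the interior of the hull lies on a supporting line. If the point is strictly
between two other points of \<open>P\<close>, the line contains all three. It could be vertical only if all of
\<open>P\<close> were on one side of it, which the last hypothesis excludes.
\<close>

lemma between_not_interior_support:
  assumes "b \<in> P" "a \<in> P" "c \<in> P" and bt: "between (a, c) b" "b \<noteq> a" "b \<noteq> c"
    and not_int: "b \<notin> interior (epi_hull P)"
    and vert: "fst a = fst c \<Longrightarrow> \<exists>l\<in>P. \<exists>r\<in>P. fst l < fst a \<and> fst a < fst r"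
  shows "\<exists>s. {a, b, c} \<subseteq> support_points P s"
proof -
  obtain u where u: "0 \<le> u" "u \<le> 1" "b = (1 - u) *\<^sub>R a + u *\<^sub>R c"
    using bt(1) unfolding between_mem_segment in_segment by blast
  have u': "0 < u" "u < 1" using u bt by (cases "u = 0"; cases "u = 1"; auto)+
  have beP: "b \<in> epi_hull P" using points_in_epi_hull[OF assms(1)] by auto
  have "\<exists>n :: real \<times> real. n \<noteq> 0 \<and> (\<forall>y \<in> epi_hull P. n \<bullet> b \<le> n \<bullet> y)"
  proof (cases "b \<in> rel_interior (epi_hull P)")
    case False
    then show ?thesis using supporting_hyperplane_rel_boundary[OF convex_epi_hull beP False] by metis
  next
    case True
    then have "interior (epi_hull P) \<noteq> rel_interior (epi_hull P)" using not_int by auto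
    then have "affine hull (epi_hull P) \<noteq> UNIV"
      using rel_interior_interior by fastforce
    then have "aff_dim (epi_hull P) < int (DIM(real \<times> real))"
      by (metis aff_dim_eq_full aff_dim_le_DIM order_le_less)
    then obtain m :: "real \<times> real" and k where m: "m \<noteq> 0" "epi_hull P \<subseteq> {x. m \<bullet> x = k}"
      using aff_lowdim_subset_hyperplane by metis
    then have "m \<bullet> y = k" if "y \<in> epi_hull P" for y using that by auto
    then have "m \<bullet> b \<le> m \<bullet> y" if "y \<in> epi_hull P" for y using that beP by simp
    then show ?thesis using m(1) by blast
  qed
  then obtain n :: "real \<times> real" where n: "n \<noteq> 0" "\<And>y. y \<in> epi_hull P \<Longrightarrow> n \<bullet> b \<le> n \<bullet> y" by blast
  obtain \<alpha> \<tau> where n_eq: "n = (\<alpha>, \<tau>)" by (cases n) auto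
  have ge: "\<alpha> * fst b + \<tau> * snd b \<le> \<alpha> * fst y + \<tau> * snd y" if "y \<in> epi_hull P" for y
    using n(2)[OF that] by (cases b; cases y) (simp add: n_eq inner_Pair)
  have geP: "\<alpha> * fst b + \<tau> * snd b \<le> \<alpha> * fst y + \<tau> * snd y" if "y \<in> P" for y
    using ge points_in_epi_hull[OF that] by auto
  have "\<tau> \<ge> 0"
    using ge[of "b + (0, 1)"] points_in_epi_hull[OF assms(1), of "b + (0,1)"] by (simp add: algebra_simps)
  define L where "L y = \<alpha> * fst y + \<tau> * snd y" for y
  have Lb: "L b = (1 - u) * L a + u * L c" unfolding u(3) L_def by (simp add: algebra_simps)
  have "L b \<le> L a" "L b \<le> L c" using geP assms unfolding L_def by auto
  moreover have "(1 - u) * (L a - L b) + u * (L c - L b) = 0" using Lb by (simp add: algebra_simps)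
  ultimately have "(1 - u) * (L a - L b) = 0" "u * (L c - L b) = 0"
    using u' by (smt (verit) mult_nonneg_nonneg)+
  then have Lac: "L a = L b" "L c = L b" using u' by auto
  have "\<tau> \<noteq> 0"
  proof
    assume "\<tau> = 0"
    then have "\<alpha> \<noteq> 0" using n n_eq by (auto simp: zero_prod_def)
    then have "fst a = fst b" "fst c = fst b" using Lac \<open>\<tau> = 0\<close> by (auto simp: L_def)
    then obtain l r where "l \<in> P" "r \<in> P" "fst l < fst b" "fst b < fst r" using vert by auto
    then show False using geP[of l] geP[of r] \<open>\<tau> = 0\<close> \<open>\<alpha> \<noteq> 0\<close>
      by (cases "\<alpha> > 0") (auto simp: mult_le_cancel_left)
  qed
  then have "\<tau> > 0" using \<open>\<tau> \<ge> 0\<close> by simp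
  define s where "s = - \<alpha> / \<tau>"
  have hL: "height s y = L y / \<tau>" for y using \<open>\<tau> > 0\<close> by (simp add: s_def L_def field_simps)
  have "x \<in> support_points P s" if "x \<in> {a, b, c}" for x
    using that Lac geP assms(1-3) \<open>\<tau> > 0\<close> unfolding support_points_def hL
    by (auto simp: L_def[symmetric] divide_right_mono)
  then show ?thesis by blast
qed

section \<open>Lower envelopes of lines\<close>

definition envelope :: "nat set \<Rightarrow> (nat \<Rightarrow> real) \<Rightarrow> (nat \<Rightarrow> real) \<Rightarrow> real \<Rightarrow> nat set" where
  "envelope I \<beta> \<xi> \<gamma> = {j \<in> I. \<forall>i\<in>I. \<beta> j + \<gamma> * \<xi> j \<le> \<beta> i + \<gamma> * \<xi> i}"

lemma envelope_nonempty:
  assumes "finite I" "I \<noteq> {}"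
  shows "envelope I \<beta> \<xi> \<gamma> \<noteq> {}"
proof -
  let ?f = "\<lambda>j. \<beta> j + \<gamma> * \<xi> j"
  have "arg_min_on ?f I \<in> envelope I \<beta> \<xi> \<gamma>"
    using arg_min_if_finite[OF assms, of ?f] by (auto simp: envelope_def not_less)
  then show ?thesis by blast
qed

text \<open>
Lines with larger slope lose against lines with smaller slope as the parameter grows.
\<close>

lemma envelope_antimono:
  assumes "i \<in> envelope I \<beta> \<xi> \<gamma>" "j \<in> envelope I \<beta> \<xi> \<gamma>'" "\<gamma> < \<gamma>'"
  shows "\<xi> j \<le> \<xi> i"
proof -
  have "\<beta> i + \<gamma> * \<xi> i \<le> \<beta> j + \<gamma> * \<xi> j" "\<beta> j + \<gamma>' * \<xi> j \<le> \<beta> i + \<gamma>' * \<xi> i"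
    using assms by (auto simp: envelope_def)
  then have "(\<gamma>' - \<gamma>) * (\<xi> i - \<xi> j) \<ge> 0" by (simp add: algebra_simps)
  then show ?thesis using assms(3) by (simp add: zero_le_mult_iff)
qed

lemma envelope_between:
  assumes "i \<in> envelope I \<beta> \<xi> \<gamma>" "j \<in> envelope I \<beta> \<xi> \<gamma>" "l \<in> envelope I \<beta> \<xi> \<gamma>'"
    "\<xi> i < \<xi> l" "\<xi> l < \<xi> j"
  shows "l \<in> envelope I \<beta> \<xi> \<gamma>"
proof -
  have "\<not> \<gamma>' < \<gamma>" "\<not> \<gamma> < \<gamma>'"
    using envelope_antimono[OF assms(3) assms(2)] envelope_antimono[OF assms(1) assms(3)] assms(4,5)
    by auto
  then show ?thesis using assms(3) by (metis linorder_less_linear)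
qed

text \<open>
At the parameter where the two lines cross, the lowest line must be one of the two,
since otherwise a third line would be visible between them.
\<close>

lemma envelope_consecutive:
  assumes fin: "finite I" and inj: "inj_on \<xi> I"
    and i: "i \<in> envelope I \<beta> \<xi> \<gamma>1" "g \<le> \<gamma>1" and j: "j \<in> envelope I \<beta> \<xi> \<gamma>0" "g \<le> \<gamma>0"
    and less: "\<xi> i < \<xi> j"
    and none: "\<And>l \<gamma>. l \<in> envelope I \<beta> \<xi> \<gamma> \<Longrightarrow> g \<le> \<gamma> \<Longrightarrow> \<not> (\<xi> i < \<xi> l \<and> \<xi> l < \<xi> j)"
  shows "\<exists>\<gamma>\<ge>g. i \<in> envelope I \<beta> \<xi> \<gamma> \<and> j \<in> envelope I \<beta> \<xi> \<gamma>"
proof -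
  \<comment> \<open>the parameter at which the lines of \<open>i\<close> and \<open>j\<close> cross\<close>
  define c where "c = (\<beta> i - \<beta> j) / (\<xi> j - \<xi> i)"
  have iI: "i \<in> I" and jI: "j \<in> I" using i j by (auto simp: envelope_def)
  have c: "\<beta> i + c * \<xi> i = \<beta> j + c * \<xi> j"
    using less by (simp add: c_def field_simps)
  have c0: "\<gamma>0 \<le> c" and c1: "c \<le> \<gamma>1"
  proof -
    have "\<beta> j + \<gamma>0 * \<xi> j \<le> \<beta> i + \<gamma>0 * \<xi> i" "\<beta> i + \<gamma>1 * \<xi> i \<le> \<beta> j + \<gamma>1 * \<xi> j"
      using i j iI jI by (auto simp: envelope_def)
    then show "\<gamma>0 \<le> c" "c \<le> \<gamma>1"
      using less unfolding c_def by (simp_all add: field_simps)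
  qed
  have both: "i \<in> envelope I \<beta> \<xi> c \<and> j \<in> envelope I \<beta> \<xi> c"
    if "l \<in> {i, j}" "l \<in> envelope I \<beta> \<xi> c" for l
    using that c iI jI unfolding envelope_def by auto
  obtain l where l: "l \<in> envelope I \<beta> \<xi> c" using envelope_nonempty[OF fin] iI by blast
  have lI: "l \<in> I" using l by (auto simp: envelope_def)
  have "\<exists>l\<in>{i, j}. l \<in> envelope I \<beta> \<xi> c"
  proof (cases "c = \<gamma>0 \<or> c = \<gamma>1")
    case True
    then show ?thesis using i j by auto
  next
    case False
    then have "\<xi> l \<le> \<xi> j" "\<xi> i \<le> \<xi> l"
      using envelope_antimono[OF j(1) l] envelope_antimono[OF l i(1)] c0 c1 by auto
    then have "\<xi> l = \<xi> i \<or> \<xi> l = \<xi> j" using none[OF l] c0 j(2) by fastforce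
    then show ?thesis using l inj lI iI jI by (auto dest: inj_onD)
  qed
  then have "i \<in> envelope I \<beta> \<xi> c \<and> j \<in> envelope I \<beta> \<xi> c" using both by blast
  then show ?thesis using c0 j(2) by (intro exI[of _ c]) auto
qed

lemma envelope_eventually:
  assumes fin: "finite I" and i: "i \<in> I" and least: "\<And>j. j \<in> I \<Longrightarrow> j \<noteq> i \<Longrightarrow> \<xi> i < \<xi> j"
  shows "\<exists>\<gamma>\<ge>g. i \<in> envelope I \<beta> \<xi> \<gamma>"
proof -
  have "\<forall>\<^sub>F \<gamma> in at_top. \<beta> i + \<gamma> * \<xi> i \<le> \<beta> j + \<gamma> * \<xi> j" if "j \<in> I" for j
  proof (cases "j = i")
    case False
    then have "\<xi> i < \<xi> j" using least that by auto
    have "\<forall>\<^sub>F \<gamma> in at_top. (\<beta> i - \<beta> j) / (\<xi> j - \<xi> i) \<le> \<gamma>" by (rule eventually_ge_at_top)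
    then show ?thesis by eventually_elim (use \<open>\<xi> i < \<xi> j\<close> in \<open>simp add: field_simps\<close>)
  qed simp
  then have "\<forall>\<^sub>F \<gamma> in at_top. \<forall>j\<in>I. \<beta> i + \<gamma> * \<xi> i \<le> \<beta> j + \<gamma> * \<xi> j"
    using fin by (intro eventually_ball_finite) auto
  moreover have "\<forall>\<^sub>F \<gamma> in at_top. g \<le> \<gamma>" by (rule eventually_ge_at_top)
  ultimately have "\<forall>\<^sub>F \<gamma> in at_top. g \<le> \<gamma> \<and> (\<forall>j\<in>I. \<beta> i + \<gamma> * \<xi> i \<le> \<beta> j + \<gamma> * \<xi> j)"
    by eventually_elim auto
  then obtain \<gamma> :: real where "g \<le> \<gamma> \<and> (\<forall>j\<in>I. \<beta> i + \<gamma> * \<xi> i \<le> \<beta> j + \<gamma> * \<xi> j)"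
    using eventually_happens'[OF trivial_limit_at_top_linorder] by blast
  then show ?thesis using i by (auto simp: envelope_def)
qed

section \<open>The Newton polygon as a sum of two envelopes\<close>

locale delta_chain =
  fixes N :: nat and x C \<beta> :: "nat \<Rightarrow> real"
  assumes params: "delta_params N x C \<beta>"
begin

abbreviation "pt j k \<equiv> (2 * (x k - x j), \<beta> j + \<beta> k)"
abbreviation "P \<equiv> newton_points N x \<beta>"

definition "left_min \<gamma> = envelope {1..N} \<beta> (\<lambda>j. 2 * x j) \<gamma>"
definition "right_min \<gamma> = envelope {1..N} \<beta> (\<lambda>k. - 2 * x k) \<gamma>"

definition "level \<gamma> j k = (\<beta> j + \<gamma> * (2 * x j)) + (\<beta> k + \<gamma> * (- 2 * x k))"

text \<open>
The minimum ranges over all pairs of indices and ignores the order \<open>j < k\<close>. This is harmless whenever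
the minimum is at most \<open>0\<close>, see \<open>min_pair_less\<close>, and makes the minimization a product problem.
\<close>

definition "low \<gamma> = (INF p\<in>{1..N} \<times> {1..N}. level \<gamma> (fst p) (snd p))"

lemma N_ge: "2 \<le> N" and beta_pos: "j \<in> {1..N} \<Longrightarrow> 0 < \<beta> j" and C_nz: "j \<in> {1..N} \<Longrightarrow> C j \<noteq> 0"
  and x_less: "i \<in> {1..N} \<Longrightarrow> j \<in> {1..N} \<Longrightarrow> i < j \<Longrightarrow> x i < x j"
  using params by (auto simp: delta_params_def strict_mono_on_def)

lemma x_less_iff: "i \<in> {1..N} \<Longrightarrow> j \<in> {1..N} \<Longrightarrow> x i < x j \<longleftrightarrow> i < j"
  using x_less[of i j] x_less[of j i] by (cases i j rule: linorder_cases) auto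

lemma x_eq_iff: "i \<in> {1..N} \<Longrightarrow> j \<in> {1..N} \<Longrightarrow> x i = x j \<longleftrightarrow> i = j"
  using x_less[of i j] x_less[of j i] by (cases i j rule: linorder_cases) auto

lemma height_pt: "height \<gamma> (pt j k) = level \<gamma> j k"
  by (simp add: level_def algebra_simps)

lemma newton_points_eq: "P = insert (0, 0) ((\<lambda>(j, k). pt j k) ` {(j, k). 1 \<le> j \<and> j < k \<and> k \<le> N})"
  by (auto simp: newton_points_def image_iff)

lemma finite_newton_points: "finite P"
proof -
  have "{(j, k). 1 \<le> j \<and> j < k \<and> k \<le> N} \<subseteq> {1..N} \<times> {1..N}" by auto
  then have "finite {(j, k). 1 \<le> j \<and> j < k \<and> k \<le> N}" by (rule finite_subset) simp
  then show ?thesis by (simp add: newton_points_eq)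
qed

lemma level_pos:
  assumes "j \<in> {1..N}" "k \<in> {1..N}" "\<gamma> \<ge> 0" "k \<le> j"
  shows "level \<gamma> j k > 0"
proof -
  have "x k \<le> x j" using assms x_less[of k j] by (cases "k = j") auto
  then have "\<gamma> * (2 * (x j - x k)) \<ge> 0" using assms by simp
  then show ?thesis using beta_pos[OF assms(1)] beta_pos[OF assms(2)]
    by (simp add: level_def algebra_simps)
qed

lemma low_le: "j \<in> {1..N} \<Longrightarrow> k \<in> {1..N} \<Longrightarrow> low \<gamma> \<le> level \<gamma> j k"
  unfolding low_def
  by (rule cINF_lower2[of _ _ "(j, k)"]) (auto intro: bdd_below_finite)

lemma left_min_nonempty: "\<exists>j. j \<in> left_min \<gamma>" and right_min_nonempty: "\<exists>j. j \<in> right_min \<gamma>"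
  unfolding left_min_def right_min_def ex_in_conv
  by (rule envelope_nonempty; use N_ge in simp)+

lemma left_min_range: "j \<in> left_min \<gamma> \<Longrightarrow> j \<in> {1..N}"
  and right_min_range: "j \<in> right_min \<gamma> \<Longrightarrow> j \<in> {1..N}"
  by (auto simp: left_min_def right_min_def envelope_def)

lemma level_min:
  assumes "j \<in> left_min \<gamma>" "k \<in> right_min \<gamma>" "i \<in> {1..N}" "l \<in> {1..N}"
  shows "level \<gamma> j k \<le> level \<gamma> i l"
proof -
  have "\<beta> j + \<gamma> * (2 * x j) \<le> \<beta> i + \<gamma> * (2 * x i)"
    using assms by (simp add: left_min_def envelope_def)
  moreover have "\<beta> k + \<gamma> * (- 2 * x k) \<le> \<beta> l + \<gamma> * (- 2 * x l)"
    using assms by (simp add: right_min_def envelope_def)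
  ultimately show ?thesis unfolding level_def by (rule add_mono)
qed

lemma low_eq:
  assumes "j \<in> left_min \<gamma>" "k \<in> right_min \<gamma>"
  shows "level \<gamma> j k = low \<gamma>"
proof (rule antisym)
  show "level \<gamma> j k \<le> low \<gamma>"
    unfolding low_def using N_ge level_min[OF assms] by (intro cINF_greatest) auto
qed (use low_le left_min_range right_min_range assms in blast)

lemma low_eq_iff:
  assumes "j \<in> {1..N}" "k \<in> {1..N}"
  shows "level \<gamma> j k = low \<gamma> \<longleftrightarrow> j \<in> left_min \<gamma> \<and> k \<in> right_min \<gamma>"
proof
  assume eq: "level \<gamma> j k = low \<gamma>"
  then have "level \<gamma> j k \<le> level \<gamma> i k" "level \<gamma> j k \<le> level \<gamma> j i" if "i \<in> {1..N}" for i
    using low_le that assms by auto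
  then show "j \<in> left_min \<gamma> \<and> k \<in> right_min \<gamma>"
    using assms unfolding left_min_def right_min_def envelope_def level_def by auto
qed (use low_eq in auto)

lemma min_pair_less:
  assumes "j \<in> left_min \<gamma>" "k \<in> right_min \<gamma>" "\<gamma> \<ge> 0" "low \<gamma> \<le> 0"
  shows "j < k"
  using level_pos[OF left_min_range[OF assms(1)] right_min_range[OF assms(2)] assms(3)]
    low_eq[OF assms(1,2)] assms(4) by linarith

lemma pt_in: "j \<in> {1..N} \<Longrightarrow> k \<in> {1..N} \<Longrightarrow> j < k \<Longrightarrow> pt j k \<in> P"
  by (auto simp: newton_points_def)

text \<open>
The height of the point of a pair is its \<open>level\<close>, and the origin has height \<open>0\<close>. Since \<open>low\<close> is the
unconstrained minimum, the sign of \<open>low \<gamma>\<close> decides which of the two kinds of points support.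
\<close>

lemma support_points_iff:
  assumes "\<gamma> > 0"
  shows "p \<in> support_points P \<gamma> \<longleftrightarrow>
    (p = (0, 0) \<and> 0 \<le> low \<gamma>) \<or> (low \<gamma> \<le> 0 \<and> (\<exists>j\<in>left_min \<gamma>. \<exists>k\<in>right_min \<gamma>. p = pt j k))"
proof -
  obtain J K where JK: "J \<in> left_min \<gamma>" "K \<in> right_min \<gamma>"
    using left_min_nonempty right_min_nonempty by blast
  have JKr: "J \<in> {1..N}" "K \<in> {1..N}" using JK left_min_range right_min_range by auto
  have hJK: "height \<gamma> (pt J K) = low \<gamma>" unfolding height_pt using low_eq[OF JK] .
  have ge: "min 0 (low \<gamma>) \<le> height \<gamma> r" if "r \<in> P" for r
  proof -
    from that consider "r = (0, 0)" | j k where "1 \<le> j" "j < k" "k \<le> N" "r = pt j k"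
      by (auto simp: newton_points_def)
    then show ?thesis
    proof cases
      case 2
      then show ?thesis using low_le[where j = j and k = k and \<gamma> = \<gamma>] height_pt[where j = j and k = k and \<gamma> = \<gamma>]
        by (auto intro: min.coboundedI2)
    qed simp
  qed
  have att: "\<exists>r\<in>P. height \<gamma> r = min 0 (low \<gamma>)"
  proof (cases "low \<gamma> \<le> 0")
    case True
    then have "pt J K \<in> P" using pt_in JKr min_pair_less[OF JK] assms by simp
    moreover have "height \<gamma> (pt J K) = min 0 (low \<gamma>)" using hJK True by simp
    ultimately show ?thesis by blast
  qed (auto simp: newton_points_def)
  have "p \<in> support_points P \<gamma> \<longleftrightarrow> p \<in> P \<and> height \<gamma> p = min 0 (low \<gamma>)"
    using ge att unfolding support_points_def by (smt (verit) mem_Collect_eq)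
  also have "\<dots> \<longleftrightarrow> (p = (0, 0) \<and> 0 \<le> low \<gamma>) \<or> (low \<gamma> \<le> 0 \<and> (\<exists>j\<in>left_min \<gamma>. \<exists>k\<in>right_min \<gamma>. p = pt j k))"
  proof
    assume *: "p \<in> P \<and> height \<gamma> p = min 0 (low \<gamma>)"
    then consider "p = (0, 0)" | j k where "1 \<le> j" "j < k" "k \<le> N" "p = pt j k"
      by (auto simp: newton_points_def)
    then show "(p = (0, 0) \<and> 0 \<le> low \<gamma>) \<or> (low \<gamma> \<le> 0 \<and> (\<exists>j\<in>left_min \<gamma>. \<exists>k\<in>right_min \<gamma>. p = pt j k))"
    proof cases
      case 2
      then have lev: "level \<gamma> j k = min 0 (low \<gamma>)" using * height_pt[where j = j and k = k and \<gamma> = \<gamma>] by auto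
      then have "level \<gamma> j k = low \<gamma>" using low_le[where j = j and k = k and \<gamma> = \<gamma>] 2 by auto
      then show ?thesis using lev low_eq_iff[where j = j and k = k and \<gamma> = \<gamma>] 2 by auto
    qed (use * in auto)
  next
    assume "(p = (0, 0) \<and> 0 \<le> low \<gamma>) \<or> (low \<gamma> \<le> 0 \<and> (\<exists>j\<in>left_min \<gamma>. \<exists>k\<in>right_min \<gamma>. p = pt j k))"
    then show "p \<in> P \<and> height \<gamma> p = min 0 (low \<gamma>)"
    proof (elim disjE conjE bexE)
      fix j k assume "low \<gamma> \<le> 0" and jk: "j \<in> left_min \<gamma>" "k \<in> right_min \<gamma>" and p: "p = pt j k"
      then have "pt j k \<in> P"
        using pt_in[of j k] min_pair_less[OF jk] left_min_range[OF jk(1)] right_min_range[OF jk(2)] assms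
        by simp
      then show ?thesis unfolding p using low_eq[OF jk] \<open>low \<gamma> \<le> 0\<close> height_pt[where j = j and k = k and \<gamma> = \<gamma>] by simp
    qed (auto simp: newton_points_def)
  qed
  finally show ?thesis .
qed

lemma support_points_nonpos:
  assumes "\<gamma> \<le> 0"
  shows "support_points P \<gamma> \<subseteq> {(0, 0)}"
proof
  fix p assume p: "p \<in> support_points P \<gamma>"
  then have le: "height \<gamma> p \<le> 0" and "p \<in> P" by (auto simp: support_points_def newton_points_def)
  then consider "p = (0, 0)" | j k where "1 \<le> j" "j < k" "k \<le> N" "p = pt j k"
    by (auto simp: newton_points_def)
  then show "p \<in> {(0, 0)}"
  proof cases
    case 2
    then have "\<gamma> * (2 * (x k - x j)) \<le> 0" "\<beta> j > 0" "\<beta> k > 0"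
      using assms x_less[of j k] beta_pos by (auto simp: mult_nonpos_nonneg)
    then show ?thesis using le 2 by simp
  qed simp
qed

lemma newton_slopes_support:
  "newton_slopes N x \<beta> = {\<gamma>. \<exists>p\<in>support_points P \<gamma>. \<exists>q\<in>support_points P \<gamma>. p \<noteq> q}"
proof -
  have "newton_polygon N x \<beta> = epi_hull P" by (simp add: newton_polygon_def epi_hull_def)
  moreover have "P \<noteq> {}" by (auto simp: newton_points_def)
  ultimately show ?thesis
    unfolding newton_slopes_def using epi_hull_slopes[OF finite_newton_points] by simp
qed

text \<open>
If \<open>low \<gamma> = 0\<close>, the edge joins the origin to the point of a minimizing pair. If \<open>low \<gamma> < 0\<close>, it joins
two such points, and as the minimizing pairs form a product, two of them differ in one entry only.
\<close>

lemma newton_slopes_iff: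
  "\<gamma> \<in> newton_slopes N x \<beta> \<longleftrightarrow>
     \<gamma> > 0 \<and> (low \<gamma> = 0 \<or> low \<gamma> < 0 \<and>
       ((\<exists>i\<in>left_min \<gamma>. \<exists>j\<in>left_min \<gamma>. i < j) \<or> (\<exists>i\<in>right_min \<gamma>. \<exists>j\<in>right_min \<gamma>. i < j)))"
proof (cases "\<gamma> > 0")
  case True
  obtain J K where JK: "J \<in> left_min \<gamma>" "K \<in> right_min \<gamma>"
    using left_min_nonempty right_min_nonempty by blast
  have JKr: "J \<in> {1..N}" "K \<in> {1..N}" using JK left_min_range right_min_range by auto
  consider "low \<gamma> > 0" | "low \<gamma> = 0" | "low \<gamma> < 0" by linarith
  then show ?thesis
  proof cases
    case 1
    then show ?thesis unfolding newton_slopes_support by (auto simp: support_points_iff[OF True])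
  next
    case 2
    have "x J \<noteq> x K" using min_pair_less[OF JK] x_less[of J K] JKr 2 True by auto
    then have "pt J K \<noteq> (0, 0)" by simp
    moreover have "pt J K \<in> support_points P \<gamma>" "(0, 0) \<in> support_points P \<gamma>"
      unfolding support_points_iff[OF True] using 2 JK by auto
    ultimately have "\<gamma> \<in> newton_slopes N x \<beta>" unfolding newton_slopes_support by blast
    then show ?thesis using 2 True by simp
  next
    case 3
    have "\<gamma> \<in> newton_slopes N x \<beta> \<longleftrightarrow>
      (\<exists>i\<in>left_min \<gamma>. \<exists>j\<in>left_min \<gamma>. i \<noteq> j) \<or> (\<exists>i\<in>right_min \<gamma>. \<exists>j\<in>right_min \<gamma>. i \<noteq> j)" (is "_ \<longleftrightarrow> ?R")
    proof
      assume "\<gamma> \<in> newton_slopes N x \<beta>"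
      then obtain p q where pq: "p \<in> support_points P \<gamma>" "q \<in> support_points P \<gamma>" "p \<noteq> q"
        unfolding newton_slopes_support by blast
      then obtain j k j' k' where "j \<in> left_min \<gamma>" "k \<in> right_min \<gamma>" "p = pt j k"
        "j' \<in> left_min \<gamma>" "k' \<in> right_min \<gamma>" "q = pt j' k'"
        using 3 unfolding support_points_iff[OF True] by auto
      moreover then have "j \<noteq> j' \<or> k \<noteq> k'" using pq(3) by auto
      ultimately show ?R by blast
    next
      have sup: "pt j k \<in> support_points P \<gamma>" if "j \<in> left_min \<gamma>" "k \<in> right_min \<gamma>" for j k
        using that 3 unfolding support_points_iff[OF True] by auto
      assume ?R
      then show "\<gamma> \<in> newton_slopes N x \<beta>"
      proof (elim disjE bexE)
        fix i j assume ij: "i \<in> left_min \<gamma>" "j \<in> left_min \<gamma>" "i \<noteq> j"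
        then have "pt i K \<noteq> pt j K" using x_eq_iff[of i j] left_min_range by auto
        then show ?thesis using sup[OF ij(1) JK(2)] sup[OF ij(2) JK(2)]
          unfolding newton_slopes_support by blast
      next
        fix i j assume ij: "i \<in> right_min \<gamma>" "j \<in> right_min \<gamma>" "i \<noteq> j"
        then have "pt J i \<noteq> pt J j" using x_eq_iff[of i j] right_min_range by auto
        then show ?thesis using sup[OF JK(1) ij(1)] sup[OF JK(1) ij(2)]
          unfolding newton_slopes_support by blast
      qed
    qed
    moreover have "(\<exists>i\<in>S. \<exists>j\<in>S. i \<noteq> j) \<longleftrightarrow> (\<exists>i\<in>S. \<exists>j\<in>S. i < j)" for S :: "nat set"
      using nat_neq_iff by blast
    ultimately show ?thesis using 3 True by simp
  qed
next
  case False
  then show ?thesis using support_points_nonpos[of \<gamma>] unfolding newton_slopes_support by auto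
qed

lemma level_slope:
  assumes "j \<in> {1..N}" "k \<in> {1..N}" "j < k"
  shows "level \<gamma> j k = 2 * (x k - x j) * (pair_slope x \<beta> j k - \<gamma>)" and "x k - x j > 0"
  using x_less[OF assms] by (simp_all add: level_def pair_slope_def field_simps)

text \<open>
If three collinear points of \<open>P\<close> are all outside the interior, the middle one puts them on a common
supporting line. This line is not vertical, because the points of \<open>P\<close> with smallest and largest
first coordinate are alone on their verticals.
\<close>

lemma slopes_uniqueI:
  assumes at_most_two: "\<And>\<gamma> p q r. \<gamma> > 0 \<Longrightarrow> p \<in> support_points P \<gamma> \<Longrightarrow> q \<in> support_points P \<gamma> \<Longrightarrow>
    r \<in> support_points P \<gamma> \<Longrightarrow> p = q \<or> p = r \<or> q = r"
  shows "slopes_unique N x \<beta>"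
proof -
  have hull: "newton_polygon N x \<beta> = epi_hull P" by (simp add: newton_polygon_def epi_hull_def)
  have ends: "(0, 0) \<in> P" "pt 1 N \<in> P"
    using pt_in[of 1 N] N_ge by (auto simp: newton_points_def)
  have left_end: "p = (0, 0) \<or> 0 < fst p" and right_end: "p = pt 1 N \<or> fst p < fst (pt 1 N)"
    if "p \<in> P" for p
  proof -
    have "fst (pt 1 N) > 0" using x_less[of 1 N] N_ge by simp
    from \<open>p \<in> P\<close> consider "p = (0, 0)" | j k where "1 \<le> j" "j < k" "k \<le> N" "p = pt j k"
      by (auto simp: newton_points_def)
    then have "(p = (0, 0) \<or> 0 < fst p) \<and> (p = pt 1 N \<or> fst p < fst (pt 1 N))"
    proof cases
      case 2
      then have r: "j \<in> {1..N}" "k \<in> {1..N}" "1 \<in> {1..N}" "N \<in> {1..N}" by auto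
      have "x 1 \<le> x j" "x 1 = x j \<longleftrightarrow> 1 = j" "x k \<le> x N" "x k = x N \<longleftrightarrow> k = N"
        using x_less[OF r(3,1)] x_less[OF r(2,4)] x_eq_iff[OF r(3,1)] x_eq_iff[OF r(2,4)] 2
        by (cases "j = 1"; cases "k = N"; simp)+
      then show ?thesis using x_less[OF r(1,2)] 2 by (cases "j = 1"; cases "k = N") auto
    qed (use \<open>fst (pt 1 N) > 0\<close> in simp)
    then show "p = (0, 0) \<or> 0 < fst p" "p = pt 1 N \<or> fst p < fst (pt 1 N)" by auto
  qed
  have no_between: False
    if P: "a \<in> P" "b \<in> P" "c \<in> P" and ne: "a \<noteq> b" "a \<noteq> c" "b \<noteq> c" and bt: "between (a, c) b"
      and int: "b \<notin> interior (epi_hull P)" for a b c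
  proof -
    have "\<exists>s. {a, b, c} \<subseteq> support_points P s"
    proof (rule between_not_interior_support[OF P(2,1,3) bt _ _ int])
      assume eq: "fst a = fst c"
      have "0 < fst a" using left_end[OF P(1)] left_end[OF P(3)] eq ne(2) by auto
      moreover have "fst a < fst (pt 1 N)" using right_end[OF P(1)] right_end[OF P(3)] eq ne(2) by auto
      ultimately show "\<exists>l\<in>P. \<exists>r\<in>P. fst l < fst a \<and> fst a < fst r"
        using ends by (intro bexI[of _ "(0, 0)"] bexI[of _ "pt 1 N"]) auto
    qed (use ne in auto)
    then obtain s where s: "{a, b, c} \<subseteq> support_points P s" by blast
    show False
    proof (cases "s > 0")
      case True
      then show ?thesis using at_most_two[OF True, of a b c] s ne by simp
    next
      case False
      then have "{a, b, c} \<subseteq> {(0, 0)}" using s support_points_nonpos[of s] by fastforce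
      then show ?thesis using ne by auto
    qed
  qed
  show ?thesis
    unfolding slopes_unique_def hull
  proof (intro ballI impI, elim conjE)
    fix a b c assume P: "a \<in> P" "b \<in> P" "c \<in> P" and ne: "a \<noteq> b" "a \<noteq> c" "b \<noteq> c"
      and col: "collinear {a, b, c}"
    show "{a, b, c} \<inter> interior (epi_hull P) \<noteq> {}"
    proof
      assume "{a, b, c} \<inter> interior (epi_hull P) = {}"
      then have int: "a \<notin> interior (epi_hull P)" "b \<notin> interior (epi_hull P)" "c \<notin> interior (epi_hull P)"
        by auto
      from col[unfolded collinear_between_cases] show False
      proof (elim disjE)
        assume "between (b, c) a"
        then show False using no_between[of b a c] P ne int by simp
      next
        assume "between (c, a) b"
        then show False using no_between[of c b a] P ne int by simp
      next
        assume "between (a, b) c"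
        then show False using no_between[of a c b] P ne int by simp
      qed
    qed
  qed
qed

end

locale unique_slopes = delta_chain +
  assumes unique: "slopes_unique N x \<beta>"
begin

text \<open>
Points on a supporting line are collinear and outside the interior. This is the form in which the
uniqueness assumption enters.
\<close>

lemma no_three_support_points:
  assumes "p \<in> support_points P \<gamma>" "q \<in> support_points P \<gamma>" "r \<in> support_points P \<gamma>"
  shows "p = q \<or> p = r \<or> q = r"
proof (rule ccontr)
  assume ne: "\<not> ?thesis"
  have "newton_polygon N x \<beta> = epi_hull P" by (simp add: newton_polygon_def epi_hull_def)
  moreover have "collinear {p, q, r}"
    by (rule collinear_subset[OF support_points_collinear]) (use assms in auto)
  moreover have "p \<in> P" "q \<in> P" "r \<in> P" using assms by (auto simp: support_points_def)
  ultimately have "{p, q, r} \<inter> interior (epi_hull P) \<noteq> {}"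
    using unique[unfolded slopes_unique_def, rule_format, of p q r] ne by simp
  moreover have "p \<notin> interior (epi_hull P)" "q \<notin> interior (epi_hull P)" "r \<notin> interior (epi_hull P)"
    using assms support_points_not_interior by simp_all
  ultimately show False by simp
qed

lemma min_pairs_unique:
  assumes "\<gamma> > 0" "low \<gamma> = 0"
    and "i \<in> left_min \<gamma>" "j \<in> left_min \<gamma>" "k \<in> right_min \<gamma>" "l \<in> right_min \<gamma>"
  shows "i = j \<and> k = l"
proof -
  have sup: "pt j k \<in> support_points P \<gamma>" if "j \<in> left_min \<gamma>" "k \<in> right_min \<gamma>" for j k
    using that assms unfolding support_points_iff[OF assms(1)] by auto
  have z: "(0, 0) \<in> support_points P \<gamma>" unfolding support_points_iff[OF assms(1)] using assms by auto
  have nz: "pt j k \<noteq> (0, 0)" if "j \<in> left_min \<gamma>" "k \<in> right_min \<gamma>" for j k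
    using min_pair_less[OF that] assms
      x_eq_iff[OF left_min_range[OF that(1)] right_min_range[OF that(2)]] by auto
  have "pt i k = pt j k"
    using no_three_support_points[OF z sup[OF assms(3,5)] sup[OF assms(4,5)]]
      nz[OF assms(3,5)] nz[OF assms(4,5)] by metis
  moreover have "pt j k = pt j l"
    using no_three_support_points[OF z sup[OF assms(4,5)] sup[OF assms(4,6)]]
      nz[OF assms(4,5)] nz[OF assms(4,6)] by metis
  ultimately show ?thesis
    using x_eq_iff[OF left_min_range[OF assms(3)] left_min_range[OF assms(4)]]
      x_eq_iff[OF right_min_range[OF assms(5)] right_min_range[OF assms(6)]] by auto
qed

text \<open>
The minimizing pairs form a product of two sets. Three points on one line would arise from three
elements in one factor, and also from two elements in both.
\<close>

lemma min_pairs_at_most_two: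
  assumes g: "\<gamma> > 0" and neg: "low \<gamma> < 0"
  shows "i \<in> left_min \<gamma> \<Longrightarrow> j \<in> left_min \<gamma> \<Longrightarrow> k \<in> left_min \<gamma> \<Longrightarrow> i = j \<or> i = k \<or> j = k"
    and "i \<in> right_min \<gamma> \<Longrightarrow> j \<in> right_min \<gamma> \<Longrightarrow> k \<in> right_min \<gamma> \<Longrightarrow> i = j \<or> i = k \<or> j = k"
    and "i \<in> left_min \<gamma> \<Longrightarrow> j \<in> left_min \<gamma> \<Longrightarrow> i < j \<Longrightarrow> k \<in> right_min \<gamma> \<Longrightarrow> l \<in> right_min \<gamma> \<Longrightarrow> k = l"
proof -
  obtain J K where JK: "J \<in> left_min \<gamma>" "K \<in> right_min \<gamma>"
    using left_min_nonempty right_min_nonempty by blast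
  have sup: "pt j k \<in> support_points P \<gamma>" if "j \<in> left_min \<gamma>" "k \<in> right_min \<gamma>" for j k
    using that neg unfolding support_points_iff[OF g] by auto
  show "i = j \<or> i = k \<or> j = k" if "i \<in> left_min \<gamma>" "j \<in> left_min \<gamma>" "k \<in> left_min \<gamma>"
    using no_three_support_points[OF sup[OF that(1) JK(2)] sup[OF that(2) JK(2)] sup[OF that(3) JK(2)]]
      x_eq_iff[OF left_min_range[OF that(1)] left_min_range[OF that(2)]]
      x_eq_iff[OF left_min_range[OF that(1)] left_min_range[OF that(3)]]
      x_eq_iff[OF left_min_range[OF that(2)] left_min_range[OF that(3)]] by auto
  show "i = j \<or> i = k \<or> j = k" if "i \<in> right_min \<gamma>" "j \<in> right_min \<gamma>" "k \<in> right_min \<gamma>"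
    using no_three_support_points[OF sup[OF JK(1) that(1)] sup[OF JK(1) that(2)] sup[OF JK(1) that(3)]]
      x_eq_iff[OF right_min_range[OF that(1)] right_min_range[OF that(2)]]
      x_eq_iff[OF right_min_range[OF that(1)] right_min_range[OF that(3)]]
      x_eq_iff[OF right_min_range[OF that(2)] right_min_range[OF that(3)]] by auto
  have less: "k = l" if "i \<in> left_min \<gamma>" "j \<in> left_min \<gamma>" "i < j" "k \<in> right_min \<gamma>" "l \<in> right_min \<gamma>" "k \<le> l"
    for i j k l
  proof (rule ccontr)
    assume "k \<noteq> l"
    then have "x i < x j" "x k < x l"
      using x_less[OF left_min_range[OF that(1)] left_min_range[OF that(2)]]
        x_less[OF right_min_range[OF that(4)] right_min_range[OF that(5)]] that by auto
    then show False
      using no_three_support_points[OF sup[OF that(2,4)] sup[OF that(1,4)] sup[OF that(1,5)]] by auto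
  qed
  show "k = l" if "i \<in> left_min \<gamma>" "j \<in> left_min \<gamma>" "i < j" "k \<in> right_min \<gamma>" "l \<in> right_min \<gamma>"
    using less[OF that(1-5)] less[OF that(1-3,5,4)] by linarith
qed

end

section \<open>The chain of visible points\<close>

definition successive :: "nat set \<Rightarrow> nat \<Rightarrow> nat \<Rightarrow> bool" where
  "successive S u v \<longleftrightarrow> u \<in> S \<and> v \<in> S \<and> u < v \<and> (\<forall>w\<in>S. \<not> (u < w \<and> w < v))"

lemma successive_nth_iff:
  assumes "sorted_wrt (<) js"
  shows "successive (set js) u v \<longleftrightarrow> (\<exists>i. Suc i < length js \<and> u = js ! i \<and> v = js ! Suc i)"
proof
  have mono: "js ! i < js ! m \<longleftrightarrow> i < m" if "i < length js" "m < length js" for i m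
    using sorted_wrt_nth_less[OF assms] that by (cases i m rule: linorder_cases) fastforce+
  {
    assume suc: "successive (set js) u v"
    then obtain i m where im: "i < length js" "u = js ! i" "m < length js" "v = js ! m"
      unfolding successive_def in_set_conv_nth by metis
    then have "i < m" using suc mono unfolding successive_def by auto
    have "\<not> Suc i < m"
    proof
      assume "Suc i < m"
      then have "u < js ! Suc i" "js ! Suc i < v" using im mono by auto
      moreover have "js ! Suc i \<in> set js" using \<open>Suc i < m\<close> im by simp
      ultimately show False using suc unfolding successive_def by blast
    qed
    then have "m = Suc i" using \<open>i < m\<close> by simp
    then show "\<exists>i. Suc i < length js \<and> u = js ! i \<and> v = js ! Suc i" using im by blast
  next
    assume "\<exists>i. Suc i < length js \<and> u = js ! i \<and> v = js ! Suc i"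
    then obtain i where i: "Suc i < length js" "u = js ! i" "v = js ! Suc i" by blast
    have "\<not> (u < w \<and> w < v)" if w: "w \<in> set js" for w
    proof -
      obtain m where m: "m < length js" "w = js ! m" using w unfolding in_set_conv_nth by blast
      then show ?thesis using i mono[of i m] mono[of m "Suc i"] by auto
    qed
    then show "successive (set js) u v"
      using i mono[of i "Suc i"] unfolding successive_def by auto
  }
qed

locale dominated_chain = unique_slopes +
  fixes J K :: nat
  assumes dominant: "dominant_pair N x \<beta> J K"
begin

definition "dominant_slope = pair_slope x \<beta> J K"
text \<open>
The indices that minimize for some parameter from the dominant slope upwards. For smaller positive
parameters the origin is the only supporting point.
\<close>

definition "left_visible = {j. \<exists>\<gamma>\<ge>dominant_slope. j \<in> left_min \<gamma>}"
definition "right_visible = {k. \<exists>\<gamma>\<ge>dominant_slope. k \<in> right_min \<gamma>}"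
definition "visible = left_visible \<union> right_visible"
definition "step_slope u v = (if u = J then dominant_slope else pair_slope_tilde x \<beta> u v)"

lemma JK: "J \<in> {1..N}" "K \<in> {1..N}" "J < K"
  using dominant by (auto simp: dominant_pair_def)

lemma dominant_slope_pos: "dominant_slope > 0"
  using level_slope(2)[OF JK] beta_pos JK by (simp add: dominant_slope_def pair_slope_def add_pos_pos)

text \<open>
Every pair has level at least \<open>0\<close> at the dominant slope: if \<open>j < k\<close> by minimality of that slope, and
otherwise by \<open>level_pos\<close>. So \<open>(J, K)\<close>, of level \<open>0\<close>, solves the unconstrained problem, which makes
\<open>J\<close> and \<open>K\<close> minimizers separately.
\<close>

lemma low_at_dominant: "low dominant_slope = 0" and J_min: "J \<in> left_min dominant_slope" and K_min: "K \<in> right_min dominant_slope"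
proof -
  have "0 \<le> level dominant_slope j k" if "j \<in> {1..N}" "k \<in> {1..N}" for j k
  proof (cases "j < k")
    case True
    then have "dominant_slope \<le> pair_slope x \<beta> j k" using dominant that unfolding dominant_slope_def dominant_pair_def by auto
    then show ?thesis using level_slope[OF that True] by simp
  next
    case False
    then show ?thesis using level_pos[of j k dominant_slope] that dominant_slope_pos by simp
  qed
  then have ge: "0 \<le> low dominant_slope" unfolding low_def using N_ge by (intro cINF_greatest) auto
  have lev: "level dominant_slope J K = 0" using level_slope[OF JK] by (simp add: dominant_slope_def)
  with ge low_le[OF JK(1,2), of dominant_slope] show *: "low dominant_slope = 0" by simp
  show "J \<in> left_min dominant_slope" "K \<in> right_min dominant_slope" using low_eq_iff[OF JK(1,2), of dominant_slope] lev * by auto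
qed

lemma low_neg: "\<gamma> > dominant_slope \<Longrightarrow> low \<gamma> < 0"
proof -
  assume "\<gamma> > dominant_slope"
  then have "level \<gamma> J K < 0" unfolding level_slope(1)[OF JK, of \<gamma>] using level_slope(2)[OF JK]
    by (intro mult_pos_neg) (auto simp: dominant_slope_def)
  then show ?thesis using low_le[OF JK(1,2), of \<gamma>] by simp
qed

lemma low_pos:
  assumes "\<gamma> > 0" "\<gamma> < dominant_slope"
  shows "low \<gamma> > 0"
proof -
  obtain j k where jk: "j \<in> left_min \<gamma>" "k \<in> right_min \<gamma>"
    using left_min_nonempty right_min_nonempty by blast
  have r: "j \<in> {1..N}" "k \<in> {1..N}" using jk left_min_range right_min_range by auto
  have "level \<gamma> j k > 0"
  proof (cases "j < k")
    case True
    then have "dominant_slope \<le> pair_slope x \<beta> j k" using dominant r unfolding dominant_slope_def dominant_pair_def by auto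
    then show ?thesis unfolding level_slope(1)[OF r True, of \<gamma>] using level_slope(2)[OF r True] assms
      by (intro mult_pos_pos) auto
  next
    case False
    then show ?thesis using level_pos[of j k \<gamma>] r assms by simp
  qed
  then show ?thesis using low_eq[OF jk] by simp
qed

lemma left_min_dominant: "left_min dominant_slope = {J}" and right_min_dominant: "right_min dominant_slope = {K}"
  using min_pairs_unique[OF dominant_slope_pos low_at_dominant] J_min K_min by blast+

text \<open>
\<open>J\<close> is the only left minimizer at the dominant slope, and for larger parameters the left
minimizer can only move to the left.
\<close>

lemma left_visible_range: "left_visible \<subseteq> {1..J}"
proof
  fix j assume "j \<in> left_visible"
  then obtain \<gamma> where \<gamma>: "\<gamma> \<ge> dominant_slope" "j \<in> left_min \<gamma>" by (auto simp: left_visible_def)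
  have j: "j \<in> {1..N}" using \<gamma> left_min_range by auto
  show "j \<in> {1..J}"
  proof (cases "\<gamma> = dominant_slope")
    case True
    then show ?thesis using \<gamma> left_min_dominant j by auto
  next
    case False
    then have "2 * x j \<le> 2 * x J"
      using envelope_antimono[of J _ \<beta> "\<lambda>j. 2 * x j" dominant_slope j \<gamma>] \<gamma> J_min by (auto simp: left_min_def)
    then show ?thesis using x_less_iff[OF JK(1) j] j by auto
  qed
qed

lemma right_visible_range: "right_visible \<subseteq> {K..N}"
proof
  fix j assume "j \<in> right_visible"
  then obtain \<gamma> where \<gamma>: "\<gamma> \<ge> dominant_slope" "j \<in> right_min \<gamma>" by (auto simp: right_visible_def)
  have j: "j \<in> {1..N}" using \<gamma> right_min_range by auto
  show "j \<in> {K..N}"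
  proof (cases "\<gamma> = dominant_slope")
    case True
    then show ?thesis using \<gamma> right_min_dominant j by auto
  next
    case False
    then have "- 2 * x j \<le> - 2 * x K"
      using envelope_antimono[of K _ \<beta> "\<lambda>j. - 2 * x j" dominant_slope j \<gamma>] \<gamma> K_min by (auto simp: right_min_def)
    then show ?thesis using x_less_iff[OF j JK(2)] j by auto
  qed
qed

lemma visible_ends: "J \<in> left_visible" "K \<in> right_visible" "1 \<in> left_visible" "N \<in> right_visible"
proof -
  show "J \<in> left_visible" "K \<in> right_visible"
    using J_min K_min by (auto simp: left_visible_def right_visible_def)
  have "\<exists>\<gamma>\<ge>dominant_slope. 1 \<in> envelope {1..N} \<beta> (\<lambda>j. 2 * x j) \<gamma>"
    using N_ge x_less[of 1] by (intro envelope_eventually) auto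
  then show "1 \<in> left_visible" by (auto simp: left_visible_def left_min_def)
  have "\<exists>\<gamma>\<ge>dominant_slope. N \<in> envelope {1..N} \<beta> (\<lambda>j. - 2 * x j) \<gamma>"
    using N_ge x_less[of _ N] by (intro envelope_eventually) auto
  then show "N \<in> right_visible" by (auto simp: right_visible_def right_min_def)
qed

lemma finite_visible: "finite left_visible" "finite right_visible" "finite visible"
  using finite_subset[OF left_visible_range] finite_subset[OF right_visible_range]
  by (auto simp: visible_def)

lemma visible_left_iff: "u \<in> visible \<and> u \<le> J \<longleftrightarrow> u \<in> left_visible"
  and visible_right_iff: "u \<in> visible \<and> K \<le> u \<longleftrightarrow> u \<in> right_visible"
  and visible_cases: "u \<in> visible \<Longrightarrow> u \<le> J \<or> K \<le> u"
  using left_visible_range right_visible_range JK(3) unfolding visible_def by auto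

lemma card_visible: "card visible = card left_visible + card right_visible"
proof -
  have "left_visible \<inter> right_visible = {}"
    using left_visible_range right_visible_range JK(3) by fastforce
  then show ?thesis unfolding visible_def using finite_visible by (intro card_Un_disjoint) auto
qed

lemma tilde_left:
  assumes "i \<in> left_min \<gamma>" "j \<in> left_min \<gamma>" "i < j" "\<gamma> > 0"
  shows "pair_slope_tilde x \<beta> i j = \<gamma>"
proof -
  have "\<beta> i + \<gamma> * (2 * x i) = \<beta> j + \<gamma> * (2 * x j)"
    using assms(1,2) unfolding left_min_def envelope_def by (auto intro: antisym)
  then have eq: "\<beta> j - \<beta> i = - (\<gamma> * (2 * (x j - x i)))" by (simp add: algebra_simps)
  have pos: "x j - x i > 0" using x_less[OF left_min_range[OF assms(1)] left_min_range[OF assms(2)] assms(3)] by simp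
  show ?thesis unfolding pair_slope_tilde_def eq using pos assms(4) by (simp add: abs_mult)
qed

lemma tilde_right:
  assumes "i \<in> right_min \<gamma>" "j \<in> right_min \<gamma>" "i < j" "\<gamma> > 0"
  shows "pair_slope_tilde x \<beta> i j = \<gamma>"
proof -
  have "\<beta> i + \<gamma> * (- 2 * x i) = \<beta> j + \<gamma> * (- 2 * x j)"
    using assms(1,2) unfolding right_min_def envelope_def by (auto intro: antisym)
  then have eq: "\<beta> j - \<beta> i = \<gamma> * (2 * (x j - x i))" by (simp add: algebra_simps)
  have pos: "x j - x i > 0" using x_less[OF right_min_range[OF assms(1)] right_min_range[OF assms(2)] assms(3)] by simp
  show ?thesis unfolding pair_slope_tilde_def eq using pos assms(4) by (simp add: abs_mult)
qed

text \<open>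
Neighbouring visible indices on the same side minimize together at the parameter where their lines
cross. This parameter exceeds the dominant slope because the minimizers there are unique.
\<close>

lemma successive_min:
  assumes "successive visible u v" "u \<noteq> J"
  shows "step_slope u v > dominant_slope \<and> (v \<le> J \<and> {u, v} \<subseteq> left_min (step_slope u v) \<or>
    K \<le> u \<and> {u, v} \<subseteq> right_min (step_slope u v))"
proof -
  have u: "u \<in> visible" and v: "v \<in> visible" and uv: "u < v"
    and none: "\<And>w. w \<in> visible \<Longrightarrow> \<not> (u < w \<and> w < v)"
    using assms by (auto simp: successive_def)
  consider "u < J" | "K \<le> u" using visible_cases[OF u] assms(2) by linarith
  then show ?thesis
  proof cases
    case 1
    have "J \<in> visible" using visible_ends by (simp add: visible_def)
    then have "v \<le> J" using none[of J] 1 by linarith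
    then have uL: "u \<in> left_visible" and vL: "v \<in> left_visible"
      using 1 u v visible_left_iff[of u] visible_left_iff[of v] by simp_all
    then obtain \<gamma>1 \<gamma>0 where *: "u \<in> left_min \<gamma>1" "dominant_slope \<le> \<gamma>1" "v \<in> left_min \<gamma>0" "dominant_slope \<le> \<gamma>0"
      unfolding left_visible_def by blast
    have ur: "u \<in> {1..N}" and vr: "v \<in> {1..N}"
      using left_min_range[OF *(1)] left_min_range[OF *(3)] by simp_all
    have "\<exists>\<gamma>\<ge>dominant_slope. u \<in> envelope {1..N} \<beta> (\<lambda>j. 2 * x j) \<gamma> \<and> v \<in> envelope {1..N} \<beta> (\<lambda>j. 2 * x j) \<gamma>"
    proof (rule envelope_consecutive)
      show "inj_on (\<lambda>j. 2 * x j) {1..N}" using x_eq_iff by (auto simp: inj_on_def)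
      show "u \<in> envelope {1..N} \<beta> (\<lambda>j. 2 * x j) \<gamma>1" "v \<in> envelope {1..N} \<beta> (\<lambda>j. 2 * x j) \<gamma>0"
        using * by (simp_all add: left_min_def)
      show "2 * x u < 2 * x v" using x_less[OF ur vr uv] by simp
      fix l \<gamma> assume l: "l \<in> envelope {1..N} \<beta> (\<lambda>j. 2 * x j) \<gamma>" "dominant_slope \<le> \<gamma>"
      then have lv: "l \<in> visible" "l \<in> {1..N}"
        by (auto simp: visible_def left_visible_def left_min_def envelope_def)
      show "\<not> (2 * x u < 2 * x l \<and> 2 * x l < 2 * x v)"
        using none[OF lv(1)] x_less_iff[OF ur lv(2)] x_less_iff[OF lv(2) vr] by auto
    qed (use * in simp_all)
    then obtain \<gamma> where \<gamma>: "dominant_slope \<le> \<gamma>" "u \<in> left_min \<gamma>" "v \<in> left_min \<gamma>"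
      unfolding left_min_def by blast
    have "\<gamma> \<noteq> dominant_slope"
    proof
      assume "\<gamma> = dominant_slope"
      then show False using \<gamma>(2,3) left_min_dominant uv by simp
    qed
    moreover have "step_slope u v = \<gamma>"
      using tilde_left[OF \<gamma>(2,3) uv] \<gamma>(1) dominant_slope_pos assms(2) by (simp add: step_slope_def)
    ultimately show ?thesis using \<gamma> \<open>v \<le> J\<close> by simp
  next
    case 2
    then have uL: "u \<in> right_visible" and vL: "v \<in> right_visible"
      using u v uv visible_right_iff[of u] visible_right_iff[of v] by simp_all
    then obtain \<gamma>1 \<gamma>0 where *: "u \<in> right_min \<gamma>1" "dominant_slope \<le> \<gamma>1" "v \<in> right_min \<gamma>0" "dominant_slope \<le> \<gamma>0"
      unfolding right_visible_def by blast
    have ur: "u \<in> {1..N}" and vr: "v \<in> {1..N}"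
      using right_min_range[OF *(1)] right_min_range[OF *(3)] by simp_all
    have "\<exists>\<gamma>\<ge>dominant_slope. v \<in> envelope {1..N} \<beta> (\<lambda>j. - 2 * x j) \<gamma> \<and> u \<in> envelope {1..N} \<beta> (\<lambda>j. - 2 * x j) \<gamma>"
    proof (rule envelope_consecutive)
      show "inj_on (\<lambda>j. - 2 * x j) {1..N}" using x_eq_iff by (auto simp: inj_on_def)
      show "u \<in> envelope {1..N} \<beta> (\<lambda>j. - 2 * x j) \<gamma>1" "v \<in> envelope {1..N} \<beta> (\<lambda>j. - 2 * x j) \<gamma>0"
        using * by (simp_all add: right_min_def)
      show "- 2 * x v < - 2 * x u" using x_less[OF ur vr uv] by simp
      fix l \<gamma> assume l: "l \<in> envelope {1..N} \<beta> (\<lambda>j. - 2 * x j) \<gamma>" "dominant_slope \<le> \<gamma>"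
      then have lv: "l \<in> visible" "l \<in> {1..N}"
        by (auto simp: visible_def right_visible_def right_min_def envelope_def)
      show "\<not> (- 2 * x v < - 2 * x l \<and> - 2 * x l < - 2 * x u)"
        using none[OF lv(1)] x_less_iff[OF ur lv(2)] x_less_iff[OF lv(2) vr] by auto
    qed (use * in simp_all)
    then obtain \<gamma> where \<gamma>: "dominant_slope \<le> \<gamma>" "u \<in> right_min \<gamma>" "v \<in> right_min \<gamma>"
      unfolding right_min_def by blast
    have "\<gamma> \<noteq> dominant_slope"
    proof
      assume "\<gamma> = dominant_slope"
      then show False using \<gamma>(2,3) right_min_dominant uv by simp
    qed
    moreover have "step_slope u v = \<gamma>"
      using tilde_right[OF \<gamma>(2,3) uv] \<gamma>(1) dominant_slope_pos assms(2) by (simp add: step_slope_def)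
    ultimately show ?thesis using \<gamma> 2 by simp
  qed
qed

lemma successive_JK: "successive visible J v \<longleftrightarrow> v = K"
proof -
  have "J \<in> visible" "K \<in> visible" using visible_ends by (auto simp: visible_def)
  moreover have "\<not> (J < w \<and> w < K)" if "w \<in> visible" for w using visible_cases[OF that] by auto
  moreover have "v = K" if "successive visible J v"
  proof -
    have "v \<in> visible" "J < v" "\<not> K < v"
      using that \<open>K \<in> visible\<close> JK(3) by (auto simp: successive_def)
    then show ?thesis using visible_cases[of v] by simp
  qed
  ultimately show ?thesis using JK(3) by (auto simp: successive_def)
qed

text \<open>
A slope above the dominant one comes from two simultaneous minimizers on one side. Any visible index
between them would minimize as well, contradicting uniqueness, so they are neighbours.
\<close>

lemma slope_successive:
  assumes "\<gamma> \<in> newton_slopes N x \<beta>"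
  shows "\<exists>u v. successive visible u v \<and> step_slope u v = \<gamma>"
proof -
  have \<gamma>: "\<gamma> > 0" "low \<gamma> \<le> 0" using assms unfolding newton_slopes_iff by auto
  then have "\<gamma> \<ge> dominant_slope" using low_pos by force
  show ?thesis
  proof (cases "\<gamma> = dominant_slope")
    case True
    then show ?thesis using successive_JK by (auto simp: step_slope_def)
  next
    case False
    then have neg: "low \<gamma> < 0" using low_neg \<open>\<gamma> \<ge> dominant_slope\<close> by simp
    then consider i j where "i \<in> left_min \<gamma>" "j \<in> left_min \<gamma>" "i < j"
      | i j where "i \<in> right_min \<gamma>" "j \<in> right_min \<gamma>" "i < j"
      using assms unfolding newton_slopes_iff by auto
    then show ?thesis
    proof cases
      case 1
      then have L: "i \<in> left_visible" "j \<in> left_visible"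
        using \<open>\<gamma> \<ge> dominant_slope\<close> by (auto simp: left_visible_def)
      have "\<not> (i < w \<and> w < j)" if w: "w \<in> visible" for w
      proof
        assume iwj: "i < w \<and> w < j"
        then have "w \<in> left_visible" using w L left_visible_range visible_left_iff[of w] by auto
        then obtain \<gamma>' where \<gamma>': "w \<in> left_min \<gamma>'" by (auto simp: left_visible_def)
        have "x i < x w" "x w < x j"
          using iwj x_less left_min_range[OF 1(1)] left_min_range[OF 1(2)] left_min_range[OF \<gamma>'] by auto
        then have "w \<in> left_min \<gamma>"
          using envelope_between[of i _ \<beta> "\<lambda>j. 2 * x j" \<gamma> j w \<gamma>'] 1 \<gamma>' unfolding left_min_def by auto
        then show False using min_pairs_at_most_two(1)[OF \<gamma>(1) neg 1(1,2)] iwj by auto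
      qed
      then have "successive visible i j" using L 1 by (auto simp: successive_def visible_def)
      moreover have "i \<noteq> J" using L 1(3) left_visible_range by auto
      ultimately show ?thesis using tilde_left[OF 1 \<gamma>(1)] unfolding step_slope_def by metis
    next
      case 2
      then have L: "i \<in> right_visible" "j \<in> right_visible"
        using \<open>\<gamma> \<ge> dominant_slope\<close> by (auto simp: right_visible_def)
      have "\<not> (i < w \<and> w < j)" if w: "w \<in> visible" for w
      proof
        assume iwj: "i < w \<and> w < j"
        then have "w \<in> right_visible" using w L right_visible_range visible_right_iff[of w] by auto
        then obtain \<gamma>' where \<gamma>': "w \<in> right_min \<gamma>'" by (auto simp: right_visible_def)
        have "x i < x w" "x w < x j"
          using iwj x_less right_min_range[OF 2(1)] right_min_range[OF 2(2)] right_min_range[OF \<gamma>'] by auto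
        then have "w \<in> right_min \<gamma>"
          using envelope_between[of j _ \<beta> "\<lambda>j. - 2 * x j" \<gamma> i w \<gamma>'] 2 \<gamma>' unfolding right_min_def by auto
        then show False using min_pairs_at_most_two(2)[OF \<gamma>(1) neg 2(1,2)] iwj by auto
      qed
      then have "successive visible i j" using L 2 by (auto simp: successive_def visible_def)
      moreover have "i \<noteq> J" using L right_visible_range JK(3) by auto
      ultimately show ?thesis using tilde_right[OF 2 \<gamma>(1)] unfolding step_slope_def by metis
    qed
  qed
qed

lemma successive_slope:
  assumes "successive visible u v"
  shows "step_slope u v \<in> newton_slopes N x \<beta>"
proof (cases "u = J")
  case True
  then show ?thesis unfolding newton_slopes_iff using dominant_slope_pos low_at_dominant by (simp add: step_slope_def)
next
  case False
  have "u < v" using assms by (simp add: successive_def)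
  then show ?thesis
    using successive_min[OF assms False] dominant_slope_pos low_neg[of "step_slope u v"] unfolding newton_slopes_iff by auto
qed

text \<open>
Two steps with the same slope would produce either three minimizers on one side or two on both.
\<close>

lemma step_slope_inj:
  assumes "successive visible u v" "successive visible u' v'" "u < u'"
  shows "step_slope u v \<noteq> step_slope u' v'"
proof
  assume eq: "step_slope u v = step_slope u' v'"
  have uv: "u < v" "u' < v'" "v \<le> u'" using assms unfolding successive_def by force+
  have "u \<noteq> J"
  proof
    assume "u = J"
    then have "step_slope u v = dominant_slope" "u' \<noteq> J" using assms(3) by (auto simp: step_slope_def)
    then show False using successive_min[OF assms(2)] eq by simp
  qed
  moreover have "u' \<noteq> J"
  proof
    assume "u' = J"
    then have "step_slope u' v' = dominant_slope" by (simp add: step_slope_def)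
    then show False using successive_min[OF assms(1) \<open>u \<noteq> J\<close>] eq by simp
  qed
  moreover define \<gamma> where "\<gamma> = step_slope u v"
  ultimately have *: "\<gamma> > dominant_slope" "v \<le> J \<and> {u, v} \<subseteq> left_min \<gamma> \<or> K \<le> u \<and> {u, v} \<subseteq> right_min \<gamma>"
    "v' \<le> J \<and> {u', v'} \<subseteq> left_min \<gamma> \<or> K \<le> u' \<and> {u', v'} \<subseteq> right_min \<gamma>"
    using successive_min[OF assms(1)] successive_min[OF assms(2)] eq by auto
  have pos: "\<gamma> > 0" and neg: "low \<gamma> < 0" using *(1) dominant_slope_pos low_neg by auto
  note two = min_pairs_at_most_two[OF pos neg]
  from *(2,3) consider "{u, v} \<subseteq> left_min \<gamma>" "{u', v'} \<subseteq> left_min \<gamma>"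
    | "{u, v} \<subseteq> left_min \<gamma>" "{u', v'} \<subseteq> right_min \<gamma>"
    | "{u, v} \<subseteq> right_min \<gamma>" "{u', v'} \<subseteq> left_min \<gamma>"
    | "{u, v} \<subseteq> right_min \<gamma>" "{u', v'} \<subseteq> right_min \<gamma>"
    by blast
  then show False
  proof cases
    case 1
    then show False using two(1)[of u v v'] uv by simp
  next
    case 2
    then show False using two(3)[of u v u' v'] uv by simp
  next
    case 3
    then show False using two(3)[of u' v' u v] uv by simp
  next
    case 4
    then show False using two(2)[of u v v'] uv by simp
  qed
qed

definition "chain = sorted_list_of_set visible"

lemma chain: "sorted_wrt (<) chain" "set chain = visible" "length chain = card visible"
  using finite_visible by (auto simp: chain_def)

lemma newton_slopes_chain:
  "newton_slopes N x \<beta> = (\<lambda>i. step_slope (chain ! i) (chain ! Suc i)) ` {i. Suc i < length chain}"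
proof -
  have "newton_slopes N x \<beta> = {step_slope u v | u v. successive visible u v}"
    using slope_successive successive_slope by blast
  also have "\<dots> = (\<lambda>i. step_slope (chain ! i) (chain ! Suc i)) ` {i. Suc i < length chain}"
    using successive_nth_iff[OF chain(1)] unfolding chain(2) by auto
  finally show ?thesis .
qed

lemma card_newton_slopes: "card (newton_slopes N x \<beta>) = card left_visible + card right_visible - 1"
proof -
  let ?f = "\<lambda>i. step_slope (chain ! i) (chain ! Suc i)"
  have ne: "?f i \<noteq> ?f m" if "i < m" "Suc m < length chain" for i m
  proof (rule step_slope_inj)
    show "successive visible (chain ! i) (chain ! Suc i)" "successive visible (chain ! m) (chain ! Suc m)"
      unfolding chain(2)[symmetric] successive_nth_iff[OF chain(1)]
      using that by (intro exI[of _ i] exI[of _ m], simp)+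
    show "chain ! i < chain ! m" using sorted_wrt_nth_less[OF chain(1)] that by simp
  qed
  have "inj_on ?f {i. Suc i < length chain}"
    by (rule linorder_inj_onI) (use ne in auto)
  then have "card (newton_slopes N x \<beta>) = card {i. Suc i < length chain}"
    unfolding newton_slopes_chain by (rule card_image)
  also have "{i. Suc i < length chain} = {..<length chain - 1}" by auto
  also have "card \<dots> = card visible - 1" by (simp add: chain(3))
  finally show ?thesis by (simp add: card_visible)
qed

lemma finite_newton_slopes: "finite (newton_slopes N x \<beta>)"
proof -
  have "{i. Suc i < length chain} \<subseteq> {..<length chain}" by auto
  then show ?thesis unfolding newton_slopes_chain using finite_subset by blast
qed

lemma card_visible_le: "card left_visible \<le> J" "card right_visible \<le> N - K + 1"
  using card_mono[OF _ left_visible_range] card_mono[OF _ right_visible_range] JK by auto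

lemma card_newton_slopes_le: "card (newton_slopes N x \<beta>) \<le> N - K + J"
  using card_newton_slopes card_visible_le by linarith

lemma card_newton_slopes_eq:
  assumes "left_visible = {1..J}" "right_visible = {K..N}"
  shows "card (newton_slopes N x \<beta>) = N - K + J"
  using card_newton_slopes JK unfolding assms by auto

text \<open>
Here there is no index strictly between \<open>1\<close> and \<open>J\<close>, or between \<open>K\<close> and \<open>N\<close>, that could be skipped.
\<close>

lemma card_newton_slopes_short:
  assumes "J \<le> 2" "N \<le> Suc K"
  shows "card (newton_slopes N x \<beta>) = N - K + J"
proof (rule card_newton_slopes_eq)
  have "{1..J} \<subseteq> {1, J}" "{K..N} \<subseteq> {K, N}" using assms by auto
  then show "left_visible = {1..J}" "right_visible = {K..N}"
    using left_visible_range right_visible_range visible_ends by blast+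
qed

lemma slope_chain_exists: "slope_chain N x \<beta> J K chain"
proof -
  have ends: "1 \<in> set chain" "N \<in> set chain" using visible_ends by (auto simp: chain visible_def)
  have range: "set chain \<subseteq> {1..N}"
    using left_visible_range right_visible_range JK by (auto simp: chain visible_def)
  have ne: "chain \<noteq> []" using ends by auto
  have sorted: "sorted chain" using chain(1) strict_sorted_imp_sorted by blast
  have "hd chain \<le> 1" using ends(1) sorted ne by (cases chain) auto
  moreover have "hd chain \<in> set chain" "last chain \<in> set chain" using ne by auto
  moreover have "N \<le> last chain"
  proof -
    have "sorted (butlast chain @ [last chain])" "N \<in> set (butlast chain @ [last chain])"
      using sorted ends(2) ne by simp_all
    then show ?thesis unfolding sorted_append by auto
  qed
  ultimately have hl: "hd chain = 1" "last chain = N" using range by (auto intro: antisym)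
  obtain I where I: "Suc I < length chain" "J = chain ! I" "K = chain ! Suc I"
    using successive_JK[of K] successive_nth_iff[OF chain(1)] unfolding chain(2) by auto
  have nJ: "chain ! i \<noteq> J" if "Suc i < length chain" "i \<noteq> I" for i
    using that I sorted_wrt_nth_less[OF chain(1), of i I] sorted_wrt_nth_less[OF chain(1), of I i]
    by (cases i I rule: linorder_cases) auto
  have "newton_slopes N x \<beta> = {pair_slope x \<beta> J K} \<union>
    {pair_slope_tilde x \<beta> (chain ! i) (chain ! Suc i) | i. Suc i < length chain \<and> i \<noteq> I}" (is "_ = ?R")
  proof (intro equalityI subsetI)
    fix \<gamma> assume "\<gamma> \<in> newton_slopes N x \<beta>"
    then obtain i where i: "Suc i < length chain" "\<gamma> = step_slope (chain ! i) (chain ! Suc i)"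
      unfolding newton_slopes_chain by blast
    then show "\<gamma> \<in> ?R" using nJ[of i] I by (cases "i = I") (auto simp: step_slope_def dominant_slope_def)
  next
    fix \<gamma> assume "\<gamma> \<in> ?R"
    then consider "\<gamma> = dominant_slope" | i where "Suc i < length chain" "i \<noteq> I"
      "\<gamma> = pair_slope_tilde x \<beta> (chain ! i) (chain ! Suc i)" by (auto simp: dominant_slope_def)
    then show "\<gamma> \<in> newton_slopes N x \<beta>"
    proof cases
      case 1
      then show ?thesis using I unfolding newton_slopes_chain by (auto simp: step_slope_def intro!: image_eqI[of _ _ I])
    next
      case 2
      then show ?thesis using nJ[of i] unfolding newton_slopes_chain
        by (auto simp: step_slope_def intro!: image_eqI[of _ _ i])
    qed
  qed
  then show ?thesis unfolding slope_chain_def using ne chain(1) hl I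
    by (intro conjI exI[of _ I]) simp_all
qed

end

section \<open>Parameters attaining the bound\<close>

text \<open>
The truncated subtractions make this equal to \<open>1\<close> between \<open>J\<close> and \<open>K\<close>. For unit spacing the left
minimizer then changes exactly at the even numbers \<open>2, 4, \<dots>\<close> and the right one at the odd numbers
\<open>3, 5, \<dots>\<close>. All of these exceed the dominant slope \<open>1 / (K - J)\<close>, and no change on the left coincides
with one on the right.
\<close>

definition sharp_beta :: "nat \<Rightarrow> nat \<Rightarrow> nat \<Rightarrow> real" where
  "sharp_beta J K j = 1 + 2 * real (J - j) * (real (J - j) + 1) + 2 * real (j - K) * (real (j - K) + 2)"

text \<open>
No integer lies strictly between \<open>-1\<close> and \<open>0\<close>.
\<close>

lemma consecutive_product_nonneg: "0 \<le> (real w - real u) * (real w - real u + 1)"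
proof (cases "u \<le> w")
  case False
  then have "real w - real u \<le> 0" "real w - real u + 1 \<le> 0" by auto
  then show ?thesis by (rule mult_nonpos_nonpos)
qed simp

lemma sharp_beta_ge: "1 \<le> sharp_beta J K j"
  by (simp add: sharp_beta_def)

lemma at_most_two_of_adjacent:
  fixes S :: "nat set"
  assumes adj: "\<And>i j. i \<in> S \<Longrightarrow> j \<in> S \<Longrightarrow> i < j \<Longrightarrow> j = Suc i"
    and "a \<in> S" "b \<in> S" "c \<in> S"
  shows "a = b \<or> a = c \<or> b = c"
proof -
  define m where "m = min a (min b c)"
  have "m \<in> S" using assms by (simp add: m_def min_def)
  have "y = m \<or> y = Suc m" if "y \<in> S" "m \<le> y" for y
    using adj[OF \<open>m \<in> S\<close> that(1)] that(2) by (cases "m = y") auto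
  moreover have "m \<le> a" "m \<le> b" "m \<le> c" by (auto simp: m_def)
  ultimately have "a = m \<or> a = Suc m" "b = m \<or> b = Suc m" "c = m \<or> c = Suc m"
    using assms(2-4) by blast+
  then show ?thesis by auto
qed

locale sharp_example =
  fixes N J K :: nat
  assumes range: "1 \<le> J" "J < K" "K \<le> N"
begin

abbreviation "\<beta> \<equiv> sharp_beta J K"

lemma params: "delta_params N real (\<lambda>_. 1) \<beta>"
proof -
  have "0 < \<beta> j" for j using sharp_beta_ge[of J K j] by linarith
  then show ?thesis using range by (auto simp: delta_params_def strict_mono_on_def)
qed

sublocale delta_chain N real "\<lambda>_. 1" \<beta>
  by unfold_locales (rule params)

lemma beta_left: "i + w = J \<Longrightarrow> \<beta> i = 1 + 2 * real w * (real w + 1)"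
  and beta_right: "i = K + w \<Longrightarrow> \<beta> i = 1 + 2 * real w * (real w + 2)"
  using range by (auto simp: sharp_beta_def)

lemma left_minD: "i \<in> {1..N} \<Longrightarrow> j \<in> left_min \<gamma> \<Longrightarrow> \<beta> j + \<gamma> * (2 * real j) \<le> \<beta> i + \<gamma> * (2 * real i)"
  and right_minD: "i \<in> {1..N} \<Longrightarrow> j \<in> right_min \<gamma> \<Longrightarrow> \<beta> j + \<gamma> * (- 2 * real j) \<le> \<beta> i + \<gamma> * (- 2 * real i)"
  by (auto simp: left_min_def right_min_def envelope_def)

text \<open>
Equality of the two lines determines \<open>\<gamma>\<close> as \<open>u + v + 1\<close>, where \<open>u\<close> and \<open>v\<close> are the distances to \<open>J\<close>.
Comparison with the index next to \<open>j\<close> gives \<open>\<gamma> \<le> 2 v + 2\<close> and forces \<open>u = v + 1\<close>.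
\<close>

lemma left_tie:
  assumes "\<gamma> > 0" and i: "i \<in> left_min \<gamma>" and j: "j \<in> left_min \<gamma>" and "i < j"
  shows "j = Suc i \<and> j \<le> J \<and> \<gamma> = 2 * real (J - i)"
proof -
  have ir: "i \<in> {1..N}" and jr: "j \<in> {1..N}" using i j left_min_range by blast+
  have "j \<le> J"
  proof (rule ccontr)
    assume "\<not> j \<le> J"
    moreover have "\<beta> j + \<gamma> * (2 * real j) \<le> \<beta> J + \<gamma> * (2 * real J)" using left_minD[OF _ j, of J] range by simp
    moreover have "\<beta> J = 1" using beta_left[of J 0] by simp
    ultimately have "\<gamma> * (2 * real j) \<le> \<gamma> * (2 * real J)" using sharp_beta_ge[of J K j] by simp
    then show False using \<open>\<not> j \<le> J\<close> \<open>\<gamma> > 0\<close> by simp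
  qed
  define u where "u = J - i"
  define v where "v = J - j"
  have iu: "i + u = J" and jv: "j + v = J" and vu: "v < u" using \<open>j \<le> J\<close> \<open>i < j\<close> by (auto simp: u_def v_def)
  have ri: "real i = real J - real u" and rj: "real j = real J - real v" using iu jv by linarith+
  have "\<beta> i + \<gamma> * (2 * real i) = \<beta> j + \<gamma> * (2 * real j)"
    using left_minD[OF ir j] left_minD[OF jr i] by simp
  then have "(real u - real v) * (real u + real v + 1) = (real u - real v) * \<gamma>"
    unfolding beta_left[OF iu] beta_left[OF jv] ri rj by (simp add: algebra_simps)
  then have \<gamma>: "\<gamma> = real u + real v + 1" using vu by simp
  have "\<beta> j + \<gamma> * (2 * real j) \<le> \<beta> (j - 1) + \<gamma> * (2 * real (j - 1))"
  proof -
    have "j - 1 \<in> {1..N}" using jr ir \<open>i < j\<close> by auto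
    then show ?thesis using left_minD[OF _ j] by blast
  qed
  moreover have j': "(j - 1) + (v + 1) = J" "real (j - 1) = real J - real v - 1"
    using jv \<open>i < j\<close> by auto
  ultimately have "\<gamma> \<le> 2 * real v + 2"
    unfolding beta_left[OF jv] beta_left[OF j'(1)] rj j'(2) by (simp add: algebra_simps)
  then have "u = Suc v" using \<gamma> vu by linarith
  then show ?thesis using iu jv \<gamma> \<open>j \<le> J\<close> by (auto simp: u_def[symmetric])
qed

text \<open>
As on the left, with \<open>\<gamma> = u + v + 2\<close> and \<open>\<gamma> \<le> 2 v + 3\<close>.
\<close>

lemma right_tie:
  assumes "\<gamma> > 0" and i: "i \<in> right_min \<gamma>" and j: "j \<in> right_min \<gamma>" and "i < j"
  shows "j = Suc i \<and> K \<le> i \<and> \<gamma> = 2 * real (i - K) + 3"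
proof -
  have ir: "i \<in> {1..N}" and jr: "j \<in> {1..N}" using i j right_min_range by blast+
  have "K \<le> i"
  proof (rule ccontr)
    assume "\<not> K \<le> i"
    moreover have "\<beta> i + \<gamma> * (- 2 * real i) \<le> \<beta> K + \<gamma> * (- 2 * real K)" using right_minD[OF _ i, of K] range by simp
    moreover have "\<beta> K = 1" using beta_right[of K 0] by simp
    ultimately have "\<gamma> * (2 * real K) \<le> \<gamma> * (2 * real i)" using sharp_beta_ge[of J K i] by simp
    then show False using \<open>\<not> K \<le> i\<close> \<open>\<gamma> > 0\<close> by simp
  qed
  define u where "u = j - K"
  define v where "v = i - K"
  have ju: "j = K + u" and iv: "i = K + v" and vu: "v < u" using \<open>K \<le> i\<close> \<open>i < j\<close> by (auto simp: u_def v_def)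
  have ri: "real i = real K + real v" and rj: "real j = real K + real u" using iv ju by linarith+
  have "\<beta> i + \<gamma> * (- 2 * real i) = \<beta> j + \<gamma> * (- 2 * real j)"
    using right_minD[OF ir j] right_minD[OF jr i] by simp
  then have "(real u - real v) * (real u + real v + 2) = (real u - real v) * \<gamma>"
    unfolding beta_right[OF iv] beta_right[OF ju] ri rj by (simp add: algebra_simps)
  then have \<gamma>: "\<gamma> = real u + real v + 2" using vu by simp
  have "\<beta> i + \<gamma> * (- 2 * real i) \<le> \<beta> (i + 1) + \<gamma> * (- 2 * real (i + 1))"
  proof -
    have "i + 1 \<in> {1..N}" using jr ir \<open>i < j\<close> by auto
    then show ?thesis using right_minD[OF _ i] by blast
  qed
  moreover have "i + 1 = K + (v + 1)" using iv by simp
  ultimately have "\<gamma> \<le> 2 * real v + 3"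
    unfolding beta_right[OF iv] ri by (simp add: beta_right[of _ "v + 1"] algebra_simps)
  then have "u = Suc v" using \<gamma> vu by linarith
  then show ?thesis using iv ju \<gamma> \<open>K \<le> i\<close> by (auto simp: v_def[symmetric])
qed

lemma left_min_witness:
  assumes "1 \<le> j" "j + u = J" "u \<le> 0 \<longrightarrow> 0 < \<gamma> \<and> \<gamma> \<le> 2" "0 < u \<longrightarrow> \<gamma> = 2 * real u"
  shows "j \<in> left_min \<gamma>"
proof -
  have \<gamma>: "\<gamma> > 0" using assms(3,4) by (cases "u = 0") auto
  have rj: "real j = real J - real u" using assms(2) by linarith
  have "\<beta> j + \<gamma> * (2 * real j) \<le> \<beta> i + \<gamma> * (2 * real i)" if i: "i \<in> {1..N}" for i
  proof (cases "i \<le> J")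
    case True
    then obtain w where w: "i + w = J" using le_Suc_ex by (metis add.commute)
    then have ri: "real i = real J - real w" by linarith
    have "0 \<le> real w * (real w + 1) - \<gamma> * real w - real u * (real u + 1) + \<gamma> * real u"
    proof (cases "u = 0")
      case True
      have "0 \<le> real w * (real w + 1 - \<gamma>)" using assms(3) True by (cases "w = 0") auto
      then show ?thesis using True by (simp add: algebra_simps)
    next
      case False
      then have "\<gamma> = 2 * real u" using assms(4) by simp
      then show ?thesis using consecutive_product_nonneg[of w u] by (simp add: algebra_simps)
    qed
    then show ?thesis unfolding beta_left[OF w] beta_left[OF assms(2)] ri rj by (simp add: algebra_simps)
  next
    case False
    have "\<gamma> * (2 * real J) \<le> \<gamma> * (2 * real i)" using False \<gamma> by simp
    moreover have "real u * (real u + 1) \<le> \<gamma> * real u" using assms(4) by (cases "u = 0") (auto simp: algebra_simps)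
    ultimately show ?thesis using sharp_beta_ge[of J K i]
      unfolding beta_left[OF assms(2)] rj by (simp add: algebra_simps)
  qed
  moreover have "j \<in> {1..N}" using assms(1,2) range by auto
  ultimately show ?thesis unfolding left_min_def envelope_def mem_Collect_eq by blast
qed

lemma right_min_witness:
  assumes "j \<le> N" "j = K + u" "u \<le> 0 \<longrightarrow> 0 < \<gamma> \<and> \<gamma> \<le> 3" "0 < u \<longrightarrow> \<gamma> = 2 * real u + 1"
  shows "j \<in> right_min \<gamma>"
proof -
  have \<gamma>: "\<gamma> > 0" using assms(3,4) by (cases "u = 0") auto
  have rj: "real j = real K + real u" using assms(2) by linarith
  have "\<beta> j + \<gamma> * (- 2 * real j) \<le> \<beta> i + \<gamma> * (- 2 * real i)" if i: "i \<in> {1..N}" for i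
  proof (cases "K \<le> i")
    case True
    then obtain w where w: "i = K + w" using le_Suc_ex by blast
    then have ri: "real i = real K + real w" by linarith
    have "0 \<le> real w * (real w + 2) - \<gamma> * real w - real u * (real u + 2) + \<gamma> * real u"
    proof (cases "u = 0")
      case True
      have "0 \<le> real w * (real w + 2 - \<gamma>)" using assms(3) True by (cases "w = 0") auto
      then show ?thesis using True by (simp add: algebra_simps)
    next
      case False
      then have "\<gamma> = 2 * real u + 1" using assms(4) by simp
      then show ?thesis using consecutive_product_nonneg[of w u] by (simp add: algebra_simps)
    qed
    then show ?thesis unfolding beta_right[OF w] beta_right[OF assms(2)] ri rj by (simp add: algebra_simps)
  next
    case False
    have "\<gamma> * (2 * real i) \<le> \<gamma> * (2 * real K)" using False \<gamma> by simp
    moreover have "real u * (real u + 2) \<le> \<gamma> * real u"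
    proof (cases "u = 0")
      case False
      then have "real u * (real u + 2) \<le> real u * (2 * real u + 1)" by (intro mult_left_mono) auto
      then show ?thesis using assms(4) False by (simp add: mult.commute)
    qed simp
    ultimately show ?thesis using sharp_beta_ge[of J K i]
      unfolding beta_right[OF assms(2)] rj by (simp add: algebra_simps)
  qed
  moreover have "j \<in> {1..N}" using assms(1,2) range by auto
  ultimately show ?thesis unfolding right_min_def envelope_def mem_Collect_eq by blast
qed

lemma small_slope: "pair_slope real \<beta> J K = 1 / (real K - real J)" "pair_slope real \<beta> J K \<le> 1"
  "0 < pair_slope real \<beta> J K"
  using range beta_left[of J 0] beta_right[of K 0] by (auto simp: pair_slope_def field_simps)

lemma dominant: "dominant_pair N real \<beta> J K"
proof -
  define dominant_slope where "dominant_slope = pair_slope real \<beta> J K"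
  have JK: "J \<in> {1..N}" "K \<in> {1..N}" using range by auto
  have "J \<in> left_min dominant_slope" "K \<in> right_min dominant_slope"
    using left_min_witness[of J 0 dominant_slope] right_min_witness[of K 0 dominant_slope] range small_slope by (auto simp: dominant_slope_def)
  then have "level dominant_slope J K = low dominant_slope" by (rule low_eq)
  moreover have "level dominant_slope J K = 0" using level_slope(1)[OF JK range(2)] by (simp add: dominant_slope_def)
  ultimately have low: "low dominant_slope = 0" by simp
  have "dominant_slope \<le> pair_slope real \<beta> j k" if "1 \<le> j" "j < k" "k \<le> N" for j k
  proof -
    have "j \<in> {1..N}" "k \<in> {1..N}" using that by auto
    then show ?thesis using low_le[of j k dominant_slope] level_slope[of j k] low that
      by (simp add: zero_le_mult_iff)
  qed
  then show ?thesis using range by (auto simp: dominant_pair_def dominant_slope_def)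
qed

lemma unique: "slopes_unique N real \<beta>"
proof (rule slopes_uniqueI)
  fix \<gamma> :: real and p q r
  assume \<gamma>: "\<gamma> > 0" and sup: "p \<in> support_points P \<gamma>" "q \<in> support_points P \<gamma>" "r \<in> support_points P \<gamma>"
  note sup = sup[unfolded support_points_iff[OF \<gamma>]]
  note lt = left_tie[OF \<gamma>] and rt = right_tie[OF \<gamma>]
  have single: "(\<forall>i\<in>left_min \<gamma>. \<forall>j\<in>left_min \<gamma>. i = j) \<or> (\<forall>i\<in>right_min \<gamma>. \<forall>j\<in>right_min \<gamma>. i = j)"
  proof (rule ccontr)
    assume "\<not> ?thesis"
    then obtain i j k l where "i \<in> left_min \<gamma>" "j \<in> left_min \<gamma>" "i < j"
      "k \<in> right_min \<gamma>" "l \<in> right_min \<gamma>" "k < l" by (metis linorder_neqE_nat)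
    then have "2 * real (J - i) = 2 * real (k - K) + 3" using lt[of i j] rt[of k l] by simp
    then have "real (2 * (J - i)) = real (2 * (k - K) + 3)" by simp
    then have "2 * (J - i) = 2 * (k - K) + 3" unfolding of_nat_eq_iff .
    then show False by presburger
  qed
  have two_left: "a = b \<or> a = c \<or> b = c" if "a \<in> left_min \<gamma>" "b \<in> left_min \<gamma>" "c \<in> left_min \<gamma>" for a b c
    by (rule at_most_two_of_adjacent[of "left_min \<gamma>"]) (use lt that in auto)
  have two_right: "a = b \<or> a = c \<or> b = c" if "a \<in> right_min \<gamma>" "b \<in> right_min \<gamma>" "c \<in> right_min \<gamma>" for a b c
    by (rule at_most_two_of_adjacent[of "right_min \<gamma>"]) (use rt that in auto)
  consider "low \<gamma> > 0" | "low \<gamma> = 0" | "low \<gamma> < 0" by linarith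
  then show "p = q \<or> p = r \<or> q = r"
  proof cases
    case 1
    then show ?thesis using sup by auto
  next
    case 2
    have "J \<in> {1..N}" "K \<in> {1..N}" using range by auto
    then have "\<gamma> \<le> pair_slope real \<beta> J K"
      using low_le[of J K \<gamma>] level_slope[of J K] 2 range by (simp add: zero_le_mult_iff)
    then have "\<gamma> \<le> 1" using small_slope(2) by linarith
    have "i = j" if ij: "i \<in> left_min \<gamma>" "j \<in> left_min \<gamma>" for i j
    proof (rule ccontr)
      assume "i \<noteq> j"
      then have "\<exists>i. i < J \<and> \<gamma> = 2 * real (J - i)" using lt[of i j] lt[of j i] ij
        by (metis linorder_neqE_nat Suc_le_lessD)
      then show False using \<open>\<gamma> \<le> 1\<close> by auto
    qed
    moreover have "i = j" if ij: "i \<in> right_min \<gamma>" "j \<in> right_min \<gamma>" for i j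
    proof (rule ccontr)
      assume "i \<noteq> j"
      then have "\<exists>i. \<gamma> = 2 * real (i - K) + 3" using rt[of i j] rt[of j i] ij
        by (metis linorder_neqE_nat)
      then show False using \<open>\<gamma> \<le> 1\<close> by auto
    qed
    ultimately show ?thesis using sup by blast
  next
    case 3
    then obtain j1 k1 j2 k2 j3 k3 where *: "j1 \<in> left_min \<gamma>" "j2 \<in> left_min \<gamma>" "j3 \<in> left_min \<gamma>"
      "k1 \<in> right_min \<gamma>" "k2 \<in> right_min \<gamma>" "k3 \<in> right_min \<gamma>"
      "p = pt j1 k1" "q = pt j2 k2" "r = pt j3 k3"
      using sup by auto
    from single show ?thesis
    proof
      assume s: "\<forall>i\<in>left_min \<gamma>. \<forall>j\<in>left_min \<gamma>. i = j"
      then have "j1 = j2" "j2 = j3" using * by blast+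
      then show ?thesis using two_right[of k1 k2 k3] * by auto
    next
      assume s: "\<forall>i\<in>right_min \<gamma>. \<forall>j\<in>right_min \<gamma>. i = j"
      then have "k1 = k2" "k2 = k3" using * by blast+
      then show ?thesis using two_left[of j1 j2 j3] * by auto
    qed
  qed
qed

sublocale dominated_chain N real "\<lambda>_. 1" \<beta> J K
  by unfold_locales (rule unique dominant)+

lemma card_slopes: "card (newton_slopes N real \<beta>) = N - K + J"
proof (rule card_newton_slopes_eq)
  have dominant_slope: "0 < dominant_slope" "dominant_slope \<le> 1" using small_slope by (auto simp: dominant_slope_def)
  have "j \<in> left_visible" if "j \<in> {1..J}" for j
  proof -
    define u where "u = J - j"
    define \<gamma> where "\<gamma> = (if u = 0 then dominant_slope else 2 * real u)"
    have "j \<in> left_min \<gamma>" using that dominant_slope by (intro left_min_witness[of _ u]) (auto simp: u_def \<gamma>_def)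
    moreover have "dominant_slope \<le> \<gamma>" using dominant_slope by (simp add: \<gamma>_def)
    ultimately show ?thesis by (auto simp: left_visible_def)
  qed
  then show "left_visible = {1..J}" using left_visible_range by blast
  have "k \<in> right_visible" if "k \<in> {K..N}" for k
  proof -
    define u where "u = k - K"
    define \<gamma> where "\<gamma> = (if u = 0 then dominant_slope else 2 * real u + 1)"
    have "k \<in> right_min \<gamma>" using that dominant_slope by (intro right_min_witness[of _ u]) (auto simp: u_def \<gamma>_def)
    moreover have "dominant_slope \<le> \<gamma>" using dominant_slope by (simp add: \<gamma>_def)
    ultimately show ?thesis by (auto simp: right_visible_def)
  qed
  then show "right_visible = {K..N}" using right_visible_range by blast
qed

end

section \<open>The secular equation\<close>

text \<open>
Up to a phase, the change of each coefficient at the \<open>j\<close>-th point relative to the value of the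
solution there.
\<close>

definition strength :: "(nat \<Rightarrow> real) \<Rightarrow> (nat \<Rightarrow> real) \<Rightarrow> real \<Rightarrow> complex \<Rightarrow> nat \<Rightarrow> complex" where
  "strength C \<beta> h z j = of_real (C j * h powr \<beta> j) / (2 * \<i> * z)"

text \<open>
The factor gained by a wave that travels from the \<open>j\<close>-th to the \<open>k\<close>-th point and back.
\<close>

definition phase :: "(nat \<Rightarrow> real) \<Rightarrow> real \<Rightarrow> complex \<Rightarrow> nat \<Rightarrow> nat \<Rightarrow> complex" where
  "phase x h z j k = exp (2 * \<i> * z * of_real (x k - x j) / of_real h)"

text \<open>
For the solution that equals a unit left-going wave in front of the first point, this is the amount
by which the coefficient of the left-going wave decreases across the \<open>k\<close>-th point. The summand \<open>1\<close>
is the contribution of the unit wave itself, the other summands come from the points passed before.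
\<close>

function amplitude :: "(nat \<Rightarrow> real) \<Rightarrow> (nat \<Rightarrow> real) \<Rightarrow> (nat \<Rightarrow> real) \<Rightarrow> real \<Rightarrow> complex \<Rightarrow> nat \<Rightarrow> complex" where
  "amplitude x C \<beta> h z k =
     strength C \<beta> h z k * (1 + (\<Sum>j\<in>{1..<k}. amplitude x C \<beta> h z j * (phase x h z j k - 1)))"
  by auto
termination by (relation "Wellfounded.measure (\<lambda>(x, C, \<beta>, h, z, k). k)") auto

text \<open>
The sum over all chains from \<open>j\<close> to \<open>k\<close> of the products of the strengths of the intermediate points and
of \<open>phase - 1\<close> over consecutive ones.
\<close>

function path_sum :: "(nat \<Rightarrow> real) \<Rightarrow> (nat \<Rightarrow> real) \<Rightarrow> (nat \<Rightarrow> real) \<Rightarrow> real \<Rightarrow> complex \<Rightarrow> nat \<Rightarrow> nat \<Rightarrow> complex" where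
  "path_sum x C \<beta> h z j k =
     (phase x h z j k - 1) +
     (\<Sum>l\<in>{j<..<k}. strength C \<beta> h z l * path_sum x C \<beta> h z j l * (phase x h z l k - 1))"
  by auto
termination by (relation "Wellfounded.measure (\<lambda>(x, C, \<beta>, h, z, j, k). k)") auto

declare amplitude.simps [simp del] path_sum.simps [simp del]

text \<open>
The coefficient of the left-going wave behind the last point, again for the solution that equals a
unit left-going wave in front of the first one. It has to vanish for an outgoing solution.
\<close>

definition secular :: "nat \<Rightarrow> (nat \<Rightarrow> real) \<Rightarrow> (nat \<Rightarrow> real) \<Rightarrow> (nat \<Rightarrow> real) \<Rightarrow> real \<Rightarrow> complex \<Rightarrow> complex" where
  "secular N x C \<beta> h z = 1 - (\<Sum>k\<in>{1..N}. amplitude x C \<beta> h z k)"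

lemma wave_vector_derivative:
  assumes "h \<noteq> 0"
  shows "vector_derivative (wave h z a b) (at y) =
     \<i> * z / of_real h * (a * exp (\<i> * z * of_real y / of_real h) - b * exp (- (\<i> * z * of_real y / of_real h)))"
proof -
  have "((\<lambda>y. a * exp (\<i> * z * of_real y / of_real h) + b * exp (- (\<i> * z * of_real y / of_real h)))
      has_vector_derivative
      \<i> * z / of_real h * (a * exp (\<i> * z * of_real y / of_real h) - b * exp (- (\<i> * z * of_real y / of_real h)))) (at y)"
  proof -
    have "((\<lambda>w. a * exp (\<i> * z * w / of_real h) + b * exp (- (\<i> * z * w / of_real h)))
      has_field_derivative
      \<i> * z / of_real h * (a * exp (\<i> * z * of_real y / of_real h) - b * exp (- (\<i> * z * of_real y / of_real h))))
      (at (of_real y))"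
      using assms by (auto intro!: derivative_eq_intros simp: field_simps)
    from has_vector_derivative_real_field[OF this] show ?thesis by (simp add: o_def)
  qed
  then show ?thesis unfolding wave_def[abs_def] by (rule vector_derivative_at)
qed

lemma matching_algebra:
  fixes H e :: complex
  assumes "H \<noteq> 0" "e \<noteq> 0"
  shows "H * H * (c / H * (p * e - m * inverse e) - c / H * ((p + P) * e - (m + - (P * (e * e))) * inverse e))
    + s * (2 * c) * H * (p * e + m * inverse e) = (2 * c * H * e) * (s * (p + m / (e * e)) - P)"
  using assms by (simp add: field_simps)

text \<open>
The two matching conditions say that crossing a point changes the pair of coefficients by a rank one
matrix: both changes are multiples of the value of the solution at the point.
\<close>

lemma matching_iff:
  fixes x C \<beta> :: "nat \<Rightarrow> real" and j :: nat and h :: real and z p m p' m' :: complex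
  assumes "h > 0" "z \<noteq> 0"
  defines "w \<equiv> exp (2 * \<i> * z * of_real (x j) / of_real h)"
  shows "(wave h z p m (x j) = wave h z p' m' (x j) \<and>
      of_real (h\<^sup>2) * (vector_derivative (wave h z p m) (at (x j)) - vector_derivative (wave h z p' m') (at (x j)))
        + of_real (C j * h powr (1 + \<beta> j)) * wave h z p m (x j) = 0) \<longleftrightarrow>
    (p' = p + strength C \<beta> h z j * (p + m / w) \<and> m' = m - strength C \<beta> h z j * (w * p + m))"
proof -
  define e where "e = exp (\<i> * z * of_real (x j) / of_real h)"
  have e: "e \<noteq> 0" "exp (- (\<i> * z * of_real (x j) / of_real h)) = inverse e"
    by (auto simp: e_def exp_minus)
  have "2 * \<i> * z * of_real (x j) / of_real h =
      \<i> * z * of_real (x j) / of_real h + \<i> * z * of_real (x j) / of_real h" by simp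
  then have w: "w = e * e" unfolding w_def e_def exp_add[symmetric] by (rule arg_cong)
  define s where "s = strength C \<beta> h z j"
  define H where "H = complex_of_real h"
  have H: "H \<noteq> 0" using assms by (simp add: H_def)
  define c where "c = \<i> * z"
  have s: "of_real (C j * h powr (1 + \<beta> j)) = s * (2 * c) * H"
    using assms(1,2) by (simp add: s_def strength_def powr_add H_def c_def)
  have h2: "of_real (h\<^sup>2) = H * H" by (simp add: H_def power2_eq_square)
  have wv: "wave h z p m (x j) = p * e + m * inverse e" for p m
    by (simp add: wave_def e_def exp_minus)
  have dv: "vector_derivative (wave h z p m) (at (x j)) = c / H * (p * e - m * inverse e)" for p m
    unfolding wave_vector_derivative[OF less_imp_neq[OF assms(1), symmetric]] e_def H_def c_def by (simp add: exp_minus)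
  define P where "P = p' - p"
  define M where "M = m' - m"
  have p': "p' = p + P" "m' = m + M" by (auto simp: P_def M_def)
  have A: "wave h z p m (x j) = wave h z p' m' (x j) \<longleftrightarrow> M = - (P * w)"
  proof -
    have "(p * e + m * inverse e) - (p' * e + m' * inverse e) = - inverse e * (M + P * w)"
    proof -
      have "inverse e * (P * w) = P * e" using e(1) by (simp add: w)
      then show ?thesis unfolding p' by (simp add: algebra_simps)
    qed
    then have "p * e + m * inverse e - (p' * e + m' * inverse e) = 0 \<longleftrightarrow> M + P * w = 0"
      using e(1) by simp
    then show ?thesis unfolding wv right_minus_eq eq_neg_iff_add_eq_0 .
  qed
  have B: "of_real (h\<^sup>2) * (vector_derivative (wave h z p m) (at (x j)) - vector_derivative (wave h z p' m') (at (x j)))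
        + of_real (C j * h powr (1 + \<beta> j)) * wave h z p m (x j) = 0 \<longleftrightarrow> P = s * (p + m / w)"
    if "M = - (P * w)"
  proof -
    have fac: "of_real (h\<^sup>2) * (vector_derivative (wave h z p m) (at (x j)) - vector_derivative (wave h z p' m') (at (x j)))
        + of_real (C j * h powr (1 + \<beta> j)) * wave h z p m (x j) = (2 * c * H * e) * (s * (p + m / w) - P)"
      unfolding s wv dv h2 p' that w
      by (rule matching_algebra[OF H e(1)])
    have nz: "2 * c * H * e \<noteq> 0" using H e(1) assms(2) by (simp add: c_def)
    have "K * (a - P) = 0 \<longleftrightarrow> P = a" if "K \<noteq> 0" for K a using that by auto
    from this[OF nz] show ?thesis unfolding fac .
  qed
  have "w \<noteq> 0" using e(1) by (simp add: w)
  then have *: "s * (p + m / w) * w = s * (w * p + m)" by (simp add: algebra_simps)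
  have "(p' = p + s * (p + m / w) \<and> m' = m - s * (w * p + m)) \<longleftrightarrow>
      (P = s * (p + m / w) \<and> M = - (s * (w * p + m)))"
  proof -
    have "m + M = m - X \<longleftrightarrow> M = - X" for X
      by (simp add: diff_conv_add_uminus del: add_uminus_conv_diff)
    then show ?thesis unfolding p' add_left_cancel by blast
  qed
  also have "\<dots> \<longleftrightarrow> (M = - (P * w) \<and> P = s * (p + m / w))" 
    using * by (metis mult_minus_left)
  finally show ?thesis unfolding s_def[symmetric] A using B by blast
qed

text \<open>
Crossing the points one after the other determines all coefficients from the left-going one in
front of the first point, and this one cannot vanish for a nonzero solution. The only remaining
condition is the one behind the last point.
\<close>

lemma resonance_iff:
  assumes h: "h > 0"
  shows "resonance N x C \<beta> h z \<longleftrightarrow> z \<noteq> 0 \<and> secular N x C \<beta> h z = 0"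
proof (cases "z = 0")
  case True
  then show ?thesis by (simp add: resonance_def)
next
  case z: False
  define w where "w j = exp (2 * \<i> * z * of_real (x j) / of_real h)" for j
  define s where "s = strength C \<beta> h z"
  define b where "b = amplitude x C \<beta> h z"
  have w: "w j \<noteq> 0" for j by (simp add: w_def)
  have ph: "phase x h z j k = w k / w j" for j k
    unfolding phase_def w_def of_real_diff right_diff_distrib diff_divide_distrib exp_diff ..
  have step_iff: "(let ul = wave h z (vp (j - 1)) (vm (j - 1)); ur = wave h z (vp j) (vm j) in
             ul (x j) = ur (x j) \<and>
             of_real (h\<^sup>2) * (vector_derivative ul (at (x j)) - vector_derivative ur (at (x j)))
               + of_real (C j * h powr (1 + \<beta> j)) * ul (x j) = 0) \<longleftrightarrow>
      (vp j = vp (j - 1) + s j * (vp (j - 1) + vm (j - 1) / w j) \<and>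
       vm j = vm (j - 1) - s j * (w j * vp (j - 1) + vm (j - 1)))" for vp vm j
    unfolding Let_def s_def w_def by (rule matching_iff[OF h z])
  \<comment> \<open>the solution that is a unit left-going wave to the left of the first point\<close>
  define sp where "sp k = (\<Sum>j\<in>{1..k}. b j / w j)" for k
  define sm where "sm k = 1 - (\<Sum>j\<in>{1..k}. b j)" for k
  have b_rec: "b (Suc k) = s (Suc k) * (w (Suc k) * sp k + sm k)" for k
  proof -
    have "b (Suc k) = s (Suc k) * (1 + (\<Sum>j\<in>{1..<Suc k}. b j * (w (Suc k) / w j - 1)))"
      unfolding b_def s_def by (subst amplitude.simps) (simp add: ph)
    also have "(\<Sum>j\<in>{1..<Suc k}. b j * (w (Suc k) / w j - 1)) =
        w (Suc k) * sp k - (\<Sum>j\<in>{1..k}. b j)"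
      unfolding sp_def sum_distrib_left sum_subtractf[symmetric]
      by (rule sum.cong) (auto simp: algebra_simps)
    finally show ?thesis by (simp add: sm_def)
  qed
  have sp0: "sp 0 = 0" "sm 0 = 1" by (simp_all add: sp_def sm_def)
  have sp_Suc: "sp (Suc k) = sp k + s (Suc k) * (sp k + sm k / w (Suc k))"
    and sm_Suc: "sm (Suc k) = sm k - s (Suc k) * (w (Suc k) * sp k + sm k)" for k
  proof -
    have "b (Suc k) / w (Suc k) = s (Suc k) * (sp k + sm k / w (Suc k))"
      unfolding b_rec using w[of "Suc k"] by (simp add: field_simps)
    then show "sp (Suc k) = sp k + s (Suc k) * (sp k + sm k / w (Suc k))" by (simp add: sp_def)
    show "sm (Suc k) = sm k - s (Suc k) * (w (Suc k) * sp k + sm k)"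
      unfolding b_rec[symmetric] by (simp add: sm_def)
  qed
  have sec: "secular N x C \<beta> h z = sm N" by (simp add: secular_def sm_def b_def)
  show ?thesis
  proof
    assume "resonance N x C \<beta> h z"
    then obtain vp vm :: "nat \<Rightarrow> complex" where
      nz: "\<exists>j\<le>N. vp j \<noteq> 0 \<or> vm j \<noteq> 0" and bd: "vp 0 = 0" "vm N = 0"
      and step: "\<And>j. j \<in> {1..N} \<Longrightarrow> vp j = vp (j - 1) + s j * (vp (j - 1) + vm (j - 1) / w j) \<and>
       vm j = vm (j - 1) - s j * (w j * vp (j - 1) + vm (j - 1))"
      unfolding resonance_def step_iff by blast
    have lin: "k \<le> N \<Longrightarrow> vp k = vm 0 * sp k \<and> vm k = vm 0 * sm k" for k
    proof (induction k)
      case (Suc k)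
      then have "Suc k \<in> {1..N}" by simp
      from step[OF this] show ?case using Suc by (simp add: sp_Suc sm_Suc algebra_simps)
    qed (simp add: sp0 bd)
    have "vm 0 \<noteq> 0"
    proof
      assume "vm 0 = 0"
      with nz show False by (metis lin mult_zero_left)
    qed
    then show "z \<noteq> 0 \<and> secular N x C \<beta> h z = 0" using lin[of N] bd z sec by simp
  next
    assume "z \<noteq> 0 \<and> secular N x C \<beta> h z = 0"
    then have "sm N = 0" using sec by simp
    moreover have "sp j = sp (j - 1) + s j * (sp (j - 1) + sm (j - 1) / w j) \<and>
       sm j = sm (j - 1) - s j * (w j * sp (j - 1) + sm (j - 1))" if "j \<in> {1..N}" for j
      using that sp_Suc[of "j - 1"] sm_Suc[of "j - 1"] by simp
    moreover have "\<exists>j\<le>N. sp j \<noteq> 0 \<or> sm j \<noteq> 0" using sp0 by (intro exI[of _ 0]) simp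
    ultimately show "resonance N x C \<beta> h z"
      unfolding resonance_def step_iff using z sp0(1) by blast
  qed
qed

lemma amplitude_path_sum:
  assumes "1 \<le> k"
  shows "amplitude x C \<beta> h z k =
    strength C \<beta> h z k * (1 + (\<Sum>j\<in>{1..<k}. strength C \<beta> h z j * path_sum x C \<beta> h z j k))"
  using assms
proof (induction k rule: less_induct)
  case (less k)
  let ?s = "strength C \<beta> h z" and ?G = "path_sum x C \<beta> h z" and ?W = "phase x h z"
  have "(\<Sum>l\<in>{1..<k}. amplitude x C \<beta> h z l * (?W l k - 1)) =
      (\<Sum>l\<in>{1..<k}. ?s l * (?W l k - 1) + (\<Sum>j\<in>{1..<l}. ?s j * (?s l * ?G j l * (?W l k - 1))))"
  proof (rule sum.cong)
    fix l assume "l \<in> {1..<k}"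
    then have "amplitude x C \<beta> h z l = ?s l * (1 + (\<Sum>j\<in>{1..<l}. ?s j * ?G j l))" using less by simp
    then have "amplitude x C \<beta> h z l * (?W l k - 1) =
       ?s l * (?W l k - 1) + (?s l * (?W l k - 1)) * (\<Sum>j\<in>{1..<l}. ?s j * ?G j l)"
      by (simp add: algebra_simps)
    then show "amplitude x C \<beta> h z l * (?W l k - 1) =
       ?s l * (?W l k - 1) + (\<Sum>j\<in>{1..<l}. ?s j * (?s l * ?G j l * (?W l k - 1)))"
      by (simp add: sum_distrib_left mult_ac)
  qed simp
  also have "\<dots> = (\<Sum>j\<in>{1..<k}. ?s j * (?W j k - 1)) +
      (\<Sum>l\<in>{1..<k}. \<Sum>j\<in>{1..<l}. ?s j * (?s l * ?G j l * (?W l k - 1)))"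
    by (simp add: sum.distrib)
  also have "(\<Sum>l\<in>{1..<k}. \<Sum>j\<in>{1..<l}. ?s j * (?s l * ?G j l * (?W l k - 1))) =
      (\<Sum>j\<in>{1..<k}. \<Sum>l\<in>{j<..<k}. ?s j * (?s l * ?G j l * (?W l k - 1)))"
    by (subst sum.Sigma, simp, simp, subst sum.Sigma, simp, simp)
      (rule sum.reindex_bij_witness[of _ "\<lambda>(j, l). (l, j)" "\<lambda>(l, j). (j, l)"]; auto)
  also have "(\<Sum>j\<in>{1..<k}. ?s j * (?W j k - 1)) + \<dots> = (\<Sum>j\<in>{1..<k}. ?s j * ?G j k)"
    unfolding path_sum.simps[of x C \<beta> h z _ k]
    by (simp add: sum.distrib[symmetric] sum_distrib_left distrib_left)
  finally show ?case by (subst amplitude.simps) simp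
qed

text \<open>
The chains are grouped by their end points, so that each pair of points contributes one term.
\<close>

lemma secular_expansion:
  "secular N x C \<beta> h z = 1 - (\<Sum>k\<in>{1..N}. strength C \<beta> h z k)
    - (\<Sum>(j, k)\<in>{(j, k). 1 \<le> j \<and> j < k \<and> k \<le> N}.
        strength C \<beta> h z j * strength C \<beta> h z k * path_sum x C \<beta> h z j k)"
proof -
  let ?s = "strength C \<beta> h z" and ?G = "path_sum x C \<beta> h z"
  have "(\<Sum>k\<in>{1..N}. amplitude x C \<beta> h z k) = (\<Sum>k\<in>{1..N}. ?s k + (\<Sum>j\<in>{1..<k}. ?s j * ?s k * ?G j k))"
    by (rule sum.cong) (auto simp: amplitude_path_sum distrib_left sum_distrib_left mult_ac)
  also have "\<dots> = (\<Sum>k\<in>{1..N}. ?s k) + (\<Sum>k\<in>{1..N}. \<Sum>j\<in>{1..<k}. ?s j * ?s k * ?G j k)"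
    by (rule sum.distrib)
  also have "(\<Sum>k\<in>{1..N}. \<Sum>j\<in>{1..<k}. ?s j * ?s k * ?G j k) =
      (\<Sum>(j, k)\<in>{(j, k). 1 \<le> j \<and> j < k \<and> k \<le> N}. ?s j * ?s k * ?G j k)"
    by (subst sum.Sigma, simp, simp)
      (rule sum.reindex_bij_witness[of _ "\<lambda>(j, l). (l, j)" "\<lambda>(l, j). (j, l)"]; auto)
  finally show ?thesis by (simp add: secular_def)
qed

lemma holomorphic_secular:
  assumes "0 \<notin> S"
  shows "secular N x C \<beta> h holomorphic_on S"
proof -
  have s: "(\<lambda>z. strength C \<beta> h z k) holomorphic_on S" for k
    unfolding strength_def using assms by (intro holomorphic_intros) auto
  have W: "(\<lambda>z. phase x h z j k) holomorphic_on S" for j k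
    unfolding phase_def divide_inverse by (intro holomorphic_intros)
  have "(\<lambda>z. amplitude x C \<beta> h z k) holomorphic_on S" for k
  proof (induction k rule: less_induct)
    case (less k)
    show ?case
      by (subst amplitude.simps) (intro holomorphic_intros s W less; simp)
  qed
  then show ?thesis unfolding secular_def by (intro holomorphic_intros)
qed

section \<open>Leading terms near a string\<close>

lemma null_times_bounded:
  fixes f g :: "nat \<Rightarrow> complex"
  assumes "f \<longlonglongrightarrow> 0" "\<And>n. cmod (g n) \<le> K"
  shows "(\<lambda>n. f n * g n) \<longlonglongrightarrow> 0"
proof (rule Lim_null_comparison)
  show "\<forall>\<^sub>F n in sequentially. cmod (f n * g n) \<le> cmod (f n) * K"
    by (simp add: norm_mult assms(2) mult_left_mono)
  show "(\<lambda>n. cmod (f n) * K) \<longlonglongrightarrow> 0"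
    using tendsto_mult_left_zero[OF tendsto_norm_zero[OF assms(1)]] .
qed

lemma mult_ln_inverse_tendsto_0:
  fixes h :: "nat \<Rightarrow> real"
  assumes "\<And>n. h n > 0" "h \<longlonglongrightarrow> 0"
  shows "(\<lambda>n. h n * ln (1 / h n)) \<longlonglongrightarrow> 0"
proof -
  have "h n \<noteq> 0" for n using assms(1)[of n] by simp
  then have "filterlim h (at_right 0) sequentially"
    using assms by (simp add: filterlim_at)
  then have "filterlim (\<lambda>n. inverse (h n)) at_top sequentially"
    by (rule filterlim_compose[OF filterlim_inverse_at_top_right])
  from filterlim_compose[OF ln_x_over_x_tendsto_0 this] show ?thesis
    by (simp add: divide_inverse mult.commute)
qed

text \<open>
A sequence of points \<open>z n\<close> as in the definition of a string, with \<open>z n\<close> bounded away from \<open>0\<close>. No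
equation is imposed on \<open>z n\<close>, since the same estimates serve to exclude roots and to find them.
\<close>

locale near_string = delta_chain +
  fixes \<gamma> :: real and h :: "nat \<Rightarrow> real" and z :: "nat \<Rightarrow> complex" and B \<delta> :: real
  assumes h_pos: "\<And>n. h n > 0" and h_lim: "h \<longlonglongrightarrow> 0"
    and Im_z: "\<And>n. \<bar>Im (z n) + \<gamma> * h n * ln (1 / h n)\<bar> \<le> B * h n"
    and \<delta>: "0 < \<delta>" and z_ge: "\<And>n. \<delta> \<le> cmod (z n)"
begin

text \<open>
The shift removes the logarithmic part of \<open>Im z\<close>: the imaginary part of \<open>u n\<close> stays bounded, so \<open>osc\<close>
is bounded above and below and all powers of \<open>h\<close> become explicit in \<open>phase_eq\<close>.
\<close>

definition "u n = z n / of_real (h n) + \<i> * of_real (\<gamma> * ln (1 / h n))"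
definition "osc l n = exp (\<i> * of_real l * u n)"
definition "coef n j k = of_real (C j * C k) / (4 * (z n)\<^sup>2)"

abbreviation "st n \<equiv> strength C \<beta> (h n) (z n)"
abbreviation "W n \<equiv> phase x (h n) (z n)"
abbreviation "G n \<equiv> path_sum x C \<beta> (h n) (z n)"

lemma z_nz: "z n \<noteq> 0" using z_ge[of n] \<delta> by auto

lemma Im_u: "\<bar>Im (u n)\<bar> \<le> B"
proof -
  have "Im (u n) = (Im (z n) + \<gamma> * h n * ln (1 / h n)) / h n"
    using h_pos[of n] by (simp add: u_def Im_divide_of_real add_divide_distrib)
  then have "\<bar>Im (u n)\<bar> = \<bar>Im (z n) + \<gamma> * h n * ln (1 / h n)\<bar> / h n"
    using h_pos[of n] by (simp add: abs_divide)
  then show ?thesis using Im_z[of n] h_pos[of n] by (simp add: divide_le_eq)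
qed

lemma cmod_osc: "cmod (osc l n) = exp (- (l * Im (u n)))"
  by (simp add: osc_def norm_exp_eq_Re)

lemma abs_le_osc: "\<bar>l * Im (u n)\<bar> \<le> \<bar>l\<bar> * B"
  using Im_u[of n] by (simp add: abs_mult mult_left_mono)

lemma osc_le: "cmod (osc l n) \<le> exp (\<bar>l\<bar> * B)"
  unfolding cmod_osc using abs_le_osc[of l n] by simp

lemma osc_ge: "exp (- (\<bar>l\<bar> * B)) \<le> cmod (osc l n)"
  unfolding cmod_osc using abs_le_osc[of l n] by simp

lemma coef_le: "cmod (coef n j k) \<le> \<bar>C j * C k\<bar> / (4 * \<delta>\<^sup>2)"
proof -
  have "\<delta>\<^sup>2 \<le> (cmod (z n))\<^sup>2" using z_ge[of n] \<delta> by (intro power_mono) auto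
  moreover have "cmod (coef n j k) = \<bar>C j * C k\<bar> / (4 * (cmod (z n))\<^sup>2)"
    unfolding coef_def norm_divide norm_of_real by (simp add: norm_mult norm_power)
  ultimately show ?thesis using \<delta> by (simp add: frac_le)
qed

lemma coef_osc_le: "cmod (coef n j k * osc l n) \<le> \<bar>C j * C k\<bar> / (4 * \<delta>\<^sup>2) * exp (\<bar>l\<bar> * B)"
  unfolding norm_mult by (intro mult_mono coef_le osc_le) auto

lemma powr_lim: "a > 0 \<Longrightarrow> (\<lambda>n. complex_of_real (h n powr a)) \<longlonglongrightarrow> 0"
  using tendsto_of_real[OF tendsto_zero_powrI[OF h_lim tendsto_const[of a]], where ?'a = complex] h_pos
  by (simp add: less_imp_le)

lemma phase_eq:
  "W n j k = of_real (h n powr (- (\<gamma> * (2 * (x k - x j))))) * osc (2 * (x k - x j)) n"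
proof -
  define l where "l = 2 * (x k - x j)"
  have zu: "z n / of_real (h n) = u n - \<i> * of_real (\<gamma> * ln (1 / h n))" by (simp add: u_def)
  have "2 * \<i> * z n * of_real (x k - x j) / of_real (h n) = \<i> * of_real l * (z n / of_real (h n))"
    by (simp add: l_def)
  also have "\<dots> = \<i> * of_real l * u n - (\<i> * \<i>) * of_real l * of_real (\<gamma> * ln (1 / h n))"
    unfolding zu right_diff_distrib by (simp only: mult_ac)
  also have "\<dots> = of_real (l * (\<gamma> * ln (1 / h n))) + \<i> * of_real l * u n" by simp
  finally have "W n j k = exp (of_real (l * (\<gamma> * ln (1 / h n)))) * osc l n"
    unfolding phase_def osc_def by (simp only: exp_add)
  also have "exp (complex_of_real (l * (\<gamma> * ln (1 / h n)))) = of_real (exp (l * (\<gamma> * ln (1 / h n))))"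
    by (rule exp_of_real)
  also have "exp (l * (\<gamma> * ln (1 / h n))) = h n powr (- (\<gamma> * l))"
    using h_pos[of n] by (simp add: powr_def ln_div algebra_simps)
  finally show ?thesis by (simp add: l_def)
qed

lemma phase_nz: "W n j k \<noteq> 0"
  by (simp add: phase_def)

lemma strength_lim:
  assumes "k \<in> {1..N}"
  shows "(\<lambda>n. st n k) \<longlonglongrightarrow> 0"
proof -
  have eq: "(\<lambda>n. st n k) = (\<lambda>n. of_real (h n powr \<beta> k) * (of_real (C k) / (2 * \<i> * z n)))"
    by (simp add: strength_def mult.commute fun_eq_iff)
  have "cmod (of_real (C k) / (2 * \<i> * z n)) \<le> \<bar>C k\<bar> / (2 * \<delta>)" for n
    using z_ge[of n] \<delta> by (simp add: norm_divide norm_mult frac_le)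
  then show ?thesis unfolding eq using powr_lim[OF beta_pos[OF assms]] by (rule null_times_bounded[rotated])
qed

lemma term_eq:
  "st n j * st n k * W n j k = - (of_real (h n powr level \<gamma> j k) * (coef n j k * osc (2 * (x k - x j)) n))"
proof -
  have "st n j * st n k = of_real (C j * C k * (h n powr \<beta> j * h n powr \<beta> k)) / ((2 * \<i> * z n) * (2 * \<i> * z n))"
    by (simp add: strength_def mult_ac)
  also have "(2 * \<i> * z n) * (2 * \<i> * z n) = - (4 * (z n)\<^sup>2)"
    by (simp add: power2_eq_square)
  finally have st: "st n j * st n k = - (of_real (h n powr (\<beta> j + \<beta> k)) * coef n j k)"
    by (simp add: coef_def powr_add mult_ac)
  have lev: "level \<gamma> j k = (\<beta> j + \<beta> k) + - (\<gamma> * (2 * (x k - x j)))"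
    by (simp add: level_def algebra_simps)
  show ?thesis unfolding st phase_eq lev powr_add[of _ "\<beta> j + \<beta> k"] of_real_mult by (simp add: mult_ac)
qed

text \<open>
For positive \<open>\<gamma>\<close> the phases tend to infinity, and the phases along a chain multiply to that of its
end points. Hence every intermediate point costs a factor \<open>strength\<close>, and the direct path dominates.
\<close>

lemma path_sum_ratio_lim:
  assumes "\<gamma> > 0" "1 \<le> j"
  shows "j < k \<Longrightarrow> k \<le> N \<Longrightarrow> (\<lambda>n. G n j k / W n j k) \<longlonglongrightarrow> 1"
proof (induction k rule: less_induct)
  case (less k)
  have inv: "(\<lambda>n. inverse (W n i k)) \<longlonglongrightarrow> 0" if "1 \<le> i" "i < k" for i
  proof -
    have "x i < x k" using x_less[of i k] that less by auto
    then have pos: "\<gamma> * (2 * (x k - x i)) > 0" using assms by simp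
    have "(\<lambda>n. of_real (h n powr (\<gamma> * (2 * (x k - x i)))) * inverse (osc (2 * (x k - x i)) n)) \<longlonglongrightarrow> 0"
    proof (rule null_times_bounded[OF powr_lim[OF pos]])
      fix n
      have "inverse (cmod (osc (2 * (x k - x i)) n)) \<le> inverse (exp (- (\<bar>2 * (x k - x i)\<bar> * B)))"
        by (rule le_imp_inverse_le[OF osc_ge]) simp
      then show "cmod (inverse (osc (2 * (x k - x i)) n)) \<le> inverse (exp (- (\<bar>2 * (x k - x i)\<bar> * B)))"
        by (simp only: norm_inverse)
    qed
    moreover have "inverse (W n i k) = of_real (h n powr (\<gamma> * (2 * (x k - x i)))) * inverse (osc (2 * (x k - x i)) n)" for n
      unfolding phase_eq by (simp add: powr_minus)
    ultimately show ?thesis by simp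
  qed
  have eq: "G n j k / W n j k = (1 - inverse (W n j k)) +
      (\<Sum>l\<in>{j<..<k}. st n l * (G n j l / W n j l) * (1 - inverse (W n l k)))" for n
  proof -
    have fac: "W n j k = W n j l * W n l k" for l
      unfolding phase_def exp_add[symmetric]
      by (simp add: add_divide_distrib[symmetric] distrib_left[symmetric])
    have "G n j k / W n j k = (W n j k - 1) / W n j k +
      (\<Sum>l\<in>{j<..<k}. st n l * G n j l * (W n l k - 1) / W n j k)"
      by (subst path_sum.simps) (simp add: add_divide_distrib sum_divide_distrib)
    also have "(W n j k - 1) / W n j k = 1 - inverse (W n j k)"
      using phase_nz[of n j k] by (simp add: diff_divide_distrib inverse_eq_divide)
    also have "(\<Sum>l\<in>{j<..<k}. st n l * G n j l * (W n l k - 1) / W n j k) =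
       (\<Sum>l\<in>{j<..<k}. st n l * (G n j l / W n j l) * (1 - inverse (W n l k)))"
    proof (rule sum.cong)
      fix l
      have "st n l * G n j l * (W n l k - 1) / (W n j l * W n l k) =
         st n l * (G n j l / W n j l) * ((W n l k - 1) / W n l k)"
        by (simp add: divide_inverse mult_ac)
      also have "(W n l k - 1) / W n l k = 1 - inverse (W n l k)"
        using phase_nz[of n l k] by (simp add: diff_divide_distrib inverse_eq_divide)
      finally show "st n l * G n j l * (W n l k - 1) / W n j k =
         st n l * (G n j l / W n j l) * (1 - inverse (W n l k))" unfolding fac[of l] .
    qed simp
    finally show ?thesis .
  qed
  have scattered: "(\<lambda>n. st n l * (G n j l / W n j l) * (1 - inverse (W n l k))) \<longlonglongrightarrow> 0 * 1 * (1 - 0)"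
    if "l \<in> {j<..<k}" for l
    using that less assms by (intro tendsto_intros strength_lim inv less.IH) auto
  then have "(\<lambda>n. (1 - inverse (W n j k)) +
      (\<Sum>l\<in>{j<..<k}. st n l * (G n j l / W n j l) * (1 - inverse (W n l k)))) \<longlonglongrightarrow>
    (1 - 0) + (\<Sum>l\<in>{j<..<k}. 0 * 1 * (1 - 0))"
    using less assms by (intro tendsto_add tendsto_diff tendsto_const tendsto_sum inv scattered) auto
  then show ?case unfolding eq by simp
qed

text \<open>
The term of a pair has size \<open>h\<close> to the power \<open>level \<gamma> j k\<close>. The single scatterings are of positive order
and therefore negligible against \<open>h\<close> to the power \<open>m \<le> 0\<close>.
\<close>

lemma secular_leading:
  assumes \<gamma>: "\<gamma> > 0" and m: "m \<le> 0" and m_le: "\<And>j k. 1 \<le> j \<Longrightarrow> j < k \<Longrightarrow> k \<le> N \<Longrightarrow> m \<le> level \<gamma> j k"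
  shows "(\<lambda>n. of_real (h n powr (- m)) * secular N x C \<beta> (h n) (z n) - (if m = 0 then 1 else 0)
    - (\<Sum>(j, k)\<in>{(j, k). 1 \<le> j \<and> j < k \<and> k \<le> N \<and> level \<gamma> j k = m}. coef n j k * osc (2 * (x k - x j)) n))
    \<longlonglongrightarrow> 0"
proof -
  define I where "I = {(j, k). 1 \<le> j \<and> j < k \<and> k \<le> N}"
  have "I \<subseteq> {1..N} \<times> {1..N}" by (auto simp: I_def)
  then have finI: "finite I" by (rule finite_subset) simp
  define q where "q n j k = coef n j k * osc (2 * (x k - x j)) n" for n j k
  define t where "t n p = of_real (h n powr (- m)) * (st n (fst p) * st n (snd p) * G n (fst p) (snd p))" for n p
  define a where "a n p = (if level \<gamma> (fst p) (snd p) = m then q n (fst p) (snd p) else 0)" for n p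
  have const: "(\<lambda>n. of_real (h n powr (- m)) - (if m = 0 then 1 else (0::complex))) \<longlonglongrightarrow> 0"
  proof (cases "m = 0")
    case True
    have "h n \<noteq> 0" for n using h_pos[of n] by simp
    then show ?thesis using True by simp
  next
    case False
    then show ?thesis using powr_lim[of "- m"] m by simp
  qed
  have single: "(\<lambda>n. of_real (h n powr (- m)) * st n k) \<longlonglongrightarrow> 0" if "k \<in> {1..N}" for k
  proof -
    have "(\<lambda>n. (of_real (h n powr (- m)) - (if m = 0 then 1 else (0::complex))) * st n k
        + (if m = 0 then 1 else 0) * st n k) \<longlonglongrightarrow> 0 * 0 + (if m = 0 then 1 else 0) * 0"
      by (intro tendsto_intros const strength_lim that)
    then show ?thesis by (simp add: left_diff_distrib)
  qed
  have pair: "(\<lambda>n. t n p + a n p) \<longlonglongrightarrow> 0" if "p \<in> I" for p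
  proof -
    obtain j k where p: "p = (j, k)" by (cases p)
    have jk: "1 \<le> j" "j < k" "k \<le> N" using that by (auto simp: I_def p)
    define r where "r n = G n j k / W n j k" for n
    have r: "r \<longlonglongrightarrow> 1" unfolding r_def using path_sum_ratio_lim[OF \<gamma> jk(1)] jk by simp
    have bq: "cmod (q n j k) \<le> \<bar>C j * C k\<bar> / (4 * \<delta>\<^sup>2) * exp (\<bar>2 * (x k - x j)\<bar> * B)" for n
      unfolding q_def by (rule coef_osc_le)
    have t: "t n p = - (of_real (h n powr (level \<gamma> j k - m)) * r n) * q n j k" for n
    proof -
      have "t n p = of_real (h n powr (- m)) * (st n j * st n k * W n j k) * r n"
        using phase_nz[of n j k] by (simp add: t_def p r_def)
      also have "\<dots> = - (of_real (h n powr (- m) * h n powr (level \<gamma> j k)) * r n) * q n j k"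
        unfolding term_eq q_def[symmetric] by (simp add: mult_ac)
      finally show ?thesis by (simp add: powr_add[symmetric])
    qed
    show ?thesis
    proof (cases "level \<gamma> j k = m")
      case True
      have "(\<lambda>n. (1 - r n) * q n j k) \<longlonglongrightarrow> 0"
        using tendsto_diff[OF tendsto_const r, of 1] by (intro null_times_bounded[OF _ bq]) simp
      moreover have "t n p + a n p = (1 - r n) * q n j k" for n
        using True h_pos[of n] unfolding t by (simp add: a_def p left_diff_distrib)
      ultimately show ?thesis by simp
    next
      case False
      then have "level \<gamma> j k - m > 0" using m_le[OF jk] by simp
      from tendsto_minus[OF tendsto_mult[OF powr_lim[OF this] r]]
      have "(\<lambda>n. - (of_real (h n powr (level \<gamma> j k - m)) * r n) * q n j k) \<longlonglongrightarrow> 0"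
        by (intro null_times_bounded[OF _ bq]) simp
      moreover have "t n p + a n p = - (of_real (h n powr (level \<gamma> j k - m)) * r n) * q n j k" for n
        using False unfolding t by (simp add: a_def p)
      ultimately show ?thesis by simp
    qed
  qed
  have eq: "of_real (h n powr (- m)) * secular N x C \<beta> (h n) (z n) - (if m = 0 then 1 else 0)
    - (\<Sum>(j, k)\<in>{(j, k). 1 \<le> j \<and> j < k \<and> k \<le> N \<and> level \<gamma> j k = m}. coef n j k * osc (2 * (x k - x j)) n)
    = (of_real (h n powr (- m)) - (if m = 0 then 1 else 0)) - (\<Sum>k\<in>{1..N}. of_real (h n powr (- m)) * st n k)
       - (\<Sum>p\<in>I. t n p + a n p)" for n
  proof -
    have "{(j, k). 1 \<le> j \<and> j < k \<and> k \<le> N \<and> level \<gamma> j k = m} = {p \<in> I. level \<gamma> (fst p) (snd p) = m}"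
      by (auto simp: I_def)
    then have "(\<Sum>(j, k)\<in>{(j, k). 1 \<le> j \<and> j < k \<and> k \<le> N \<and> level \<gamma> j k = m}. q n j k) =
        (\<Sum>p\<in>{p \<in> I. level \<gamma> (fst p) (snd p) = m}. q n (fst p) (snd p))"
      by (simp only: case_prod_unfold)
    also have "\<dots> = (\<Sum>p\<in>I. a n p)" unfolding a_def by (rule sum.inter_filter[OF finI])
    finally have "(\<Sum>(j, k)\<in>{(j, k). 1 \<le> j \<and> j < k \<and> k \<le> N \<and> level \<gamma> j k = m}. q n j k) =
        (\<Sum>p\<in>I. a n p)" .
    moreover have "(\<Sum>p\<in>I. t n p) = of_real (h n powr (- m)) *
        (\<Sum>(j, k)\<in>I. st n j * st n k * G n j k)"
      by (simp add: t_def sum_distrib_left case_prod_unfold)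
    moreover have "secular N x C \<beta> (h n) (z n) = 1 - (\<Sum>k\<in>{1..N}. st n k) - (\<Sum>(j, k)\<in>I. st n j * st n k * G n j k)"
      unfolding I_def by (rule secular_expansion)
    ultimately show ?thesis unfolding q_def[symmetric]
      by (simp add: sum.distrib right_diff_distrib sum_distrib_left)
  qed
  have "(\<lambda>n. (of_real (h n powr (- m)) - (if m = 0 then 1 else 0)) - (\<Sum>k\<in>{1..N}. of_real (h n powr (- m)) * st n k)
       - (\<Sum>p\<in>I. t n p + a n p)) \<longlonglongrightarrow> 0 - (\<Sum>k\<in>{1..N}. 0) - (\<Sum>p\<in>I. 0)"
    by (intro tendsto_diff tendsto_sum const single pair)
  then show ?thesis unfolding eq by simp
qed

text \<open>
For \<open>\<gamma> \<le> 0\<close> the phases stay bounded, so all scattering disappears in the limit.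
\<close>

lemma secular_lim_nonpos:
  assumes "\<gamma> \<le> 0"
  shows "(\<lambda>n. secular N x C \<beta> (h n) (z n)) \<longlonglongrightarrow> 1"
proof -
  have amplitude: "k \<in> {1..N} \<Longrightarrow> (\<lambda>n. amplitude x C \<beta> (h n) (z n) k) \<longlonglongrightarrow> 0" for k
  proof (induction k rule: less_induct)
    case (less k)
    have small: "(\<lambda>n. amplitude x C \<beta> (h n) (z n) j * (W n j k - 1)) \<longlonglongrightarrow> 0" if j: "j \<in> {1..<k}" for j
    proof -
      have "x j < x k" using x_less[of j k] j less by auto
      define l where "l = 2 * (x k - x j)"
      have l: "l > 0" using \<open>x j < x k\<close> by (simp add: l_def)
      have amplitude_j: "(\<lambda>n. amplitude x C \<beta> (h n) (z n) j) \<longlonglongrightarrow> 0" using less j by simp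
      have "(\<lambda>n. amplitude x C \<beta> (h n) (z n) j * of_real (h n powr (- (\<gamma> * l)))) \<longlonglongrightarrow> 0"
      proof (cases "\<gamma> = 0")
        case True
        have "h n \<noteq> 0" for n using h_pos[of n] by simp
        then show ?thesis using True amplitude_j by simp
      next
        case False
        then have "- (\<gamma> * l) > 0" using assms l by (simp add: mult_neg_pos)
        from tendsto_mult[OF amplitude_j powr_lim[OF this]] show ?thesis by simp
      qed
      then have "(\<lambda>n. amplitude x C \<beta> (h n) (z n) j * of_real (h n powr (- (\<gamma> * l))) * osc l n) \<longlonglongrightarrow> 0"
        using osc_le by (rule null_times_bounded)
      then have "(\<lambda>n. amplitude x C \<beta> (h n) (z n) j * W n j k) \<longlonglongrightarrow> 0"
        unfolding phase_eq l_def[symmetric] by (simp add: mult.assoc)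
      from tendsto_diff[OF this amplitude_j] show ?thesis by (simp add: right_diff_distrib)
    qed
    have "(\<lambda>n. st n k * (1 + (\<Sum>j\<in>{1..<k}. amplitude x C \<beta> (h n) (z n) j * (W n j k - 1)))) \<longlonglongrightarrow>
       0 * (1 + (\<Sum>j\<in>{1..<k}. 0))"
      by (intro tendsto_intros strength_lim less.prems small)
    then show ?case by (subst amplitude.simps) simp
  qed
  have "(\<lambda>n. 1 - (\<Sum>k\<in>{1..N}. amplitude x C \<beta> (h n) (z n) k)) \<longlonglongrightarrow> 1 - (\<Sum>k\<in>{1..N}. 0)"
    by (intro tendsto_intros amplitude)
  then show ?thesis by (simp add: secular_def)
qed

end

section \<open>Strings are the Newton slopes\<close>

text \<open>
Uniform convergence can be tested on arbitrary sequences of points. In this way the pointwise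
asymptotics of the secular function along sequences yield the hypothesis of Hurwitz' theorem.
\<close>

lemma uniform_limit_sequentiallyI:
  fixes F :: "nat \<Rightarrow> 'a \<Rightarrow> 'b::real_normed_vector"
  assumes "\<And>\<zeta>. (\<And>n. \<zeta> n \<in> S) \<Longrightarrow> (\<lambda>n. F n (\<zeta> n) - f (\<zeta> n)) \<longlonglongrightarrow> 0"
  shows "uniform_limit S F f sequentially"
proof (cases "S = {}")
  case False
  then obtain s0 where s0: "s0 \<in> S" by blast
  show ?thesis
  proof (rule uniform_limitI)
    fix e :: real assume "e > 0"
    define \<zeta> where "\<zeta> n = (if \<exists>s\<in>S. \<not> dist (F n s) (f s) < e
      then SOME s. s \<in> S \<and> \<not> dist (F n s) (f s) < e else s0)" for n
    have bad: "\<zeta> n \<in> S \<and> \<not> dist (F n (\<zeta> n)) (f (\<zeta> n)) < e"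
      if "\<exists>s\<in>S. \<not> dist (F n s) (f s) < e" for n
    proof -
      have "\<exists>s. s \<in> S \<and> \<not> dist (F n s) (f s) < e" using that by blast
      from someI_ex[OF this] show ?thesis using that by (simp add: \<zeta>_def)
    qed
    have "\<zeta> n \<in> S" for n
      using bad[of n] s0 by (cases "\<exists>s\<in>S. \<not> dist (F n s) (f s) < e") (auto simp: \<zeta>_def)
    then have "(\<lambda>n. F n (\<zeta> n) - f (\<zeta> n)) \<longlonglongrightarrow> 0" by (rule assms)
    then have "\<forall>\<^sub>F n in sequentially. dist (F n (\<zeta> n) - f (\<zeta> n)) 0 < e"
      using \<open>e > 0\<close> by (rule tendstoD)
    then show "\<forall>\<^sub>F n in sequentially. \<forall>s\<in>S. dist (F n s) (f s) < e"
    proof eventually_elim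
      case (elim n)
      then have "dist (F n (\<zeta> n)) (f (\<zeta> n)) < e" by (simp add: dist_norm)
      then show ?case using bad[of n] by blast
    qed
  qed
qed (simp add: uniform_limit_iff)

context near_string
begin

lemma active_pairs:
  assumes "\<gamma> > 0" "low \<gamma> \<le> 0"
  shows "{(j, k). 1 \<le> j \<and> j < k \<and> k \<le> N \<and> level \<gamma> j k = low \<gamma>} = left_min \<gamma> \<times> right_min \<gamma>"
proof -
  have "(1 \<le> j \<and> j < k \<and> k \<le> N \<and> level \<gamma> j k = low \<gamma>) \<longleftrightarrow> j \<in> left_min \<gamma> \<and> k \<in> right_min \<gamma>" for j k
  proof
    assume "1 \<le> j \<and> j < k \<and> k \<le> N \<and> level \<gamma> j k = low \<gamma>"
    then show "j \<in> left_min \<gamma> \<and> k \<in> right_min \<gamma>" using low_eq_iff[of j k \<gamma>] by auto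
  next
    assume *: "j \<in> left_min \<gamma> \<and> k \<in> right_min \<gamma>"
    then have "j < k" "level \<gamma> j k = low \<gamma>" using min_pair_less[of j \<gamma> k] low_eq[of j \<gamma> k] assms by auto
    moreover have "j \<in> {1..N}" "k \<in> {1..N}" using * left_min_range right_min_range by blast+
    ultimately show "1 \<le> j \<and> j < k \<and> k \<le> N \<and> level \<gamma> j k = low \<gamma>" by simp
  qed
  then show ?thesis by auto
qed

lemma secular_leading_low:
  assumes \<gamma>: "\<gamma> > 0" and low: "low \<gamma> \<le> 0"
  shows "(\<lambda>n. of_real (h n powr (- low \<gamma>)) * secular N x C \<beta> (h n) (z n) - (if low \<gamma> = 0 then 1 else 0)
    - (\<Sum>(j, k)\<in>left_min \<gamma> \<times> right_min \<gamma>. coef n j k * osc (2 * (x k - x j)) n)) \<longlonglongrightarrow> 0"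
  using secular_leading[OF \<gamma> low] low_le[of _ _ \<gamma>] unfolding active_pairs[OF assms] by simp

lemma secular_lim_above:
  assumes \<gamma>: "\<gamma> > 0" and low: "low \<gamma> > 0"
  shows "(\<lambda>n. secular N x C \<beta> (h n) (z n)) \<longlonglongrightarrow> 1"
proof -
  have less: "0 < level \<gamma> j k" if "1 \<le> j" "j < k" "k \<le> N" for j k
    using low_le[of j k \<gamma>] low that by simp
  then have none: "{(j, k). 1 \<le> j \<and> j < k \<and> k \<le> N \<and> level \<gamma> j k = 0} = {}" by force
  have "h n \<noteq> 0" for n using h_pos[of n] by simp
  then have "(\<lambda>n. secular N x C \<beta> (h n) (z n) - 1) \<longlonglongrightarrow> 0"
    using secular_leading[OF \<gamma> order_refl less_imp_le[OF less]] unfolding none by simp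
  from tendsto_add[OF this tendsto_const[of 1]] show ?thesis by simp
qed

text \<open>
If \<open>\<gamma>\<close> is not a slope, either the constant \<open>1\<close> or a single pair dominates, and its term cannot be
cancelled.
\<close>

lemma roots_only_at_slopes:
  assumes zero: "\<And>n. secular N x C \<beta> (h n) (z n) = 0" and M: "\<And>n. cmod (z n) \<le> M"
  shows "\<gamma> \<in> newton_slopes N x \<beta>"
proof (rule ccontr)
  assume no: "\<gamma> \<notin> newton_slopes N x \<beta>"
  have not_one: "\<not> (\<lambda>n. secular N x C \<beta> (h n) (z n)) \<longlonglongrightarrow> 1"
    unfolding zero using LIMSEQ_unique[OF tendsto_const[of "0::complex"], of 1] by auto
  have \<gamma>: "\<gamma> > 0" using secular_lim_nonpos not_one by (meson not_less)
  have "\<not> low \<gamma> > 0" using secular_lim_above[OF \<gamma>] not_one by blast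
  then have neg: "low \<gamma> < 0"
    and "\<not> (\<exists>i\<in>left_min \<gamma>. \<exists>j\<in>left_min \<gamma>. i < j)" "\<not> (\<exists>i\<in>right_min \<gamma>. \<exists>j\<in>right_min \<gamma>. i < j)"
    using no \<gamma> unfolding newton_slopes_iff by auto
  moreover obtain j k where jk: "j \<in> left_min \<gamma>" "k \<in> right_min \<gamma>"
    using left_min_nonempty right_min_nonempty by blast
  ultimately have single: "left_min \<gamma> = {j}" "right_min \<gamma> = {k}" by (auto simp: set_eq_iff) (metis linorder_neqE_nat)+
  define q where "q n = coef n j k * osc (2 * (x k - x j)) n" for n
  have "(\<lambda>n. - q n) \<longlonglongrightarrow> 0"
    using secular_leading_low[OF \<gamma> less_imp_le[OF neg]] neg unfolding single zero q_def by simp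
  then have "(\<lambda>n. cmod (q n)) \<longlonglongrightarrow> 0" using tendsto_norm_zero by fastforce
  moreover define c where "c = \<bar>C j * C k\<bar> / (4 * M\<^sup>2) * exp (- (\<bar>2 * (x k - x j)\<bar> * B))"
  have "M > 0" using M[of 0] z_ge[of 0] \<delta> by simp
  have "c > 0" using \<open>M > 0\<close> C_nz left_min_range[OF jk(1)] right_min_range[OF jk(2)] by (simp add: c_def)
  have "c \<le> cmod (q n)" for n
  proof -
    have "cmod (coef n j k) = \<bar>C j * C k\<bar> / (4 * (cmod (z n))\<^sup>2)"
      unfolding coef_def norm_divide norm_of_real by (simp add: norm_mult norm_power)
    moreover have "(cmod (z n))\<^sup>2 \<le> M\<^sup>2" using M[of n] by (intro power_mono) auto
    ultimately have "\<bar>C j * C k\<bar> / (4 * M\<^sup>2) \<le> cmod (coef n j k)"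
      using z_nz[of n] by (simp add: frac_le)
    then show ?thesis unfolding c_def q_def norm_mult by (intro mult_mono osc_ge) auto
  qed
  then have "c \<le> 0" using LIMSEQ_le_const[OF calculation] by blast
  then show False using \<open>c > 0\<close> by simp
qed

end

context delta_chain
begin

text \<open>
The definition of a string bounds \<open>Im z + \<gamma> h ln (1/h)\<close> only from some index on, which is why the
sequences are shifted by \<open>n0\<close>.
\<close>

lemma string_exponents_subset: "string_exponents N x C \<beta> \<subseteq> newton_slopes N x \<beta>"
proof
  fix \<gamma> assume "\<gamma> \<in> string_exponents N x C \<beta>"
  then obtain h :: "nat \<Rightarrow> real" and z :: "nat \<Rightarrow> complex" and U :: "real set"
    where h: "\<And>n. h n > 0" "h \<longlonglongrightarrow> 0" and res: "\<And>n. resonance N x C \<beta> (h n) (z n)"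
      and U: "compact (closure U)" "closure U \<subseteq> {0<..}" and Re: "\<And>n. Re (z n) \<in> U"
      and Im: "(\<lambda>n. Im (z n) - (- \<gamma> * h n * ln (1 / h n))) \<in> O(h)"
    unfolding string_exponents_def by blast
  have ne: "closure U \<noteq> {}" using Re closure_subset by blast
  obtain \<delta> where \<delta>: "\<delta> \<in> closure U" "\<And>y. y \<in> closure U \<Longrightarrow> \<delta> \<le> y"
    using compact_attains_inf[OF U(1) ne] by blast
  obtain M where M: "\<And>y. y \<in> closure U \<Longrightarrow> y \<le> M"
    using compact_attains_sup[OF U(1) ne] by blast
  have "\<delta> > 0" using \<delta>(1) U(2) by auto
  have ReU: "\<delta> \<le> Re (z n)" "Re (z n) \<le> M" for n using Re[of n] closure_subset[of U] \<delta>(2) M by blast+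
  obtain c where c: "\<forall>\<^sub>F n in sequentially. \<bar>Im (z n) + \<gamma> * h n * ln (1 / h n)\<bar> \<le> c * h n"
    using landau_o.bigE[OF Im] h(1) by (auto simp: less_imp_le)
  have "\<forall>\<^sub>F n in sequentially. h n < 1" using order_tendstoD(2)[OF h(2)] by simp
  then have "\<forall>\<^sub>F n in sequentially. h n < 1 \<and> \<bar>Im (z n) + \<gamma> * h n * ln (1 / h n)\<bar> \<le> c * h n"
    using c by eventually_elim simp
  then obtain n0 where n0: "\<And>n. n0 \<le> n \<Longrightarrow> h n < 1 \<and> \<bar>Im (z n) + \<gamma> * h n * ln (1 / h n)\<bar> \<le> c * h n"
    unfolding eventually_sequentially by blast
  have sec: "secular N x C \<beta> (h n) (z n) = 0" for n using res[of n] resonance_iff[OF h(1)] by blast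
  interpret near_string N x C \<beta> \<gamma> "\<lambda>n. h (n + n0)" "\<lambda>n. z (n + n0)" c \<delta>
  proof
    show "(\<lambda>n. h (n + n0)) \<longlonglongrightarrow> 0" using h(2) by (rule LIMSEQ_ignore_initial_segment)
    show "\<delta> \<le> cmod (z (n + n0))" for n using ReU(1)[of "n + n0"] complex_Re_le_cmod order_trans by blast
  qed (use h n0 \<open>\<delta> > 0\<close> in auto)
  have "cmod (z (n + n0)) \<le> M + (\<bar>c\<bar> + \<bar>\<gamma>\<bar>)" for n
  proof -
    \<comment> \<open>the crude bound \<open>t ln (1/t) \<le> 1\<close> is enough to bound \<open>Im z\<close>\<close>
    define t where "t = h (n + n0)"
    have t: "0 < t" "t < 1" using h n0[of "n + n0"] by (auto simp: t_def)
    have "ln (1 / t) \<le> 1 / t - 1" using t by (intro ln_le_minus_one) simp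
    then have "t * ln (1 / t) \<le> 1" using t by (simp add: field_simps)
    moreover have "0 \<le> t * ln (1 / t)" using t by simp
    ultimately have "\<bar>\<gamma>\<bar> * \<bar>t * ln (1 / t)\<bar> \<le> \<bar>\<gamma>\<bar> * 1"
      by (intro mult_left_mono) auto
    then have "\<bar>\<gamma> * t * ln (1 / t)\<bar> \<le> \<bar>\<gamma>\<bar>" by (simp only: abs_mult[symmetric] mult.assoc mult_1_right)
    moreover have "\<bar>Im (z (n + n0)) + \<gamma> * t * ln (1 / t)\<bar> \<le> c * t" using n0[of "n + n0"] by (simp add: t_def)
    moreover have "c * t \<le> \<bar>c\<bar>"
    proof -
      have "c * t \<le> \<bar>c\<bar> * t" using t by (intro mult_right_mono) auto
      also have "\<dots> \<le> \<bar>c\<bar>" using t by (simp add: mult_left_le)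
      finally show ?thesis .
    qed
    ultimately have "\<bar>Im (z (n + n0))\<bar> \<le> \<bar>c\<bar> + \<bar>\<gamma>\<bar>" by linarith
    then show ?thesis using cmod_le[of "z (n + n0)"] ReU[of "n + n0"] \<open>\<delta> > 0\<close> by linarith
  qed
  with sec show "\<gamma> \<in> newton_slopes N x \<beta>" by (rule roots_only_at_slopes)
qed

text \<open>
Take \<open>h\<close> such that \<open>(l1 - l0) / h\<close> is a multiple of \<open>2 \<pi>\<close> and put
\<open>z = 1 - \<i> \<gamma> h ln (1/h) + h \<zeta>\<close>. Up to a common factor, the rescaled secular function then converges
to \<open>c0 exp (\<i> l0 \<zeta>) + c1 exp (\<i> l1 \<zeta>)\<close> locally uniformly in \<open>\<zeta>\<close>. This limit has a root, and by Hurwitz'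
theorem the secular function has roots nearby for infinitely many \<open>h\<close>.
\<close>

lemma string_of_two_terms:
  assumes l: "l0 < l1" and c: "c0 \<noteq> 0" "c1 \<noteq> 0"
    and lim: "\<And>h z B. near_string N x C \<beta> \<gamma> h z B (1/2) \<Longrightarrow> z \<longlonglongrightarrow> 1 \<Longrightarrow>
      (\<lambda>n. of_real (h n powr (- m)) * secular N x C \<beta> (h n) (z n)
        - c0 * near_string.osc \<gamma> h z l0 n - c1 * near_string.osc \<gamma> h z l1 n) \<longlonglongrightarrow> 0"
  shows "\<gamma> \<in> string_exponents N x C \<beta>"
proof -
  define D where "D = l1 - l0"
  have D: "D > 0" using l by (simp add: D_def)
  define \<zeta>0 where "\<zeta>0 = Ln (- c0 / c1) / (\<i> * of_real D)"
  have root: "exp (\<i> * of_real D * \<zeta>0) = - c0 / c1"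
  proof -
    have nz: "\<i> * complex_of_real D \<noteq> 0" using D by simp
    have "\<i> * of_real D * \<zeta>0 = Ln (- c0 / c1)"
      unfolding \<zeta>0_def times_divide_eq_right by (rule nonzero_mult_div_cancel_left[OF nz])
    moreover have "- c0 / c1 \<noteq> 0" using c by simp
    ultimately show ?thesis using exp_Ln by metis
  qed
  define S where "S = ball \<zeta>0 1"
  define R where "R = cmod \<zeta>0 + 1"
  have R: "R > 0" by (simp add: R_def add_nonneg_pos)
  have S_le: "cmod \<zeta> \<le> R" if "\<zeta> \<in> S" for \<zeta>
  proof -
    have "cmod (\<zeta> - \<zeta>0) < 1" using that by (simp add: S_def dist_norm norm_minus_commute)
    then show ?thesis using norm_triangle_ineq2[of \<zeta> \<zeta>0] unfolding R_def by linarith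
  qed
  define t where "t n = D / (2 * pi * real (Suc n))" for n
  have t_pos: "t n > 0" for n using D by (simp add: t_def)
  have t_lim: "t \<longlonglongrightarrow> 0"
  proof -
    have "(\<lambda>n. D / (2 * pi) * inverse (real (Suc n))) \<longlonglongrightarrow> D / (2 * pi) * 0"
      by (intro tendsto_intros LIMSEQ_inverse_real_of_nat)
    then show ?thesis unfolding t_def[abs_def] by (simp only: divide_inverse inverse_mult_distrib mult.assoc mult_zero_right)
  qed
  have log_lim: "(\<lambda>n. t n * ln (1 / t n)) \<longlonglongrightarrow> 0" by (rule mult_ln_inverse_tendsto_0[OF t_pos t_lim])
  have "(\<lambda>n. \<bar>\<gamma>\<bar> * \<bar>t n * ln (1 / t n)\<bar> + t n * R) \<longlonglongrightarrow> \<bar>\<gamma>\<bar> * \<bar>0\<bar> + 0 * R"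
    by (intro tendsto_intros log_lim t_lim)
  then have "(\<lambda>n. \<bar>\<gamma>\<bar> * \<bar>t n * ln (1 / t n)\<bar> + t n * R) \<longlonglongrightarrow> 0"
    by (simp only: abs_zero mult_zero_left mult_zero_right add_0)
  from order_tendstoD(2)[OF this, of "1/2"]
  have "\<forall>\<^sub>F n in sequentially. \<bar>\<gamma>\<bar> * \<bar>t n * ln (1 / t n)\<bar> + t n * R < 1/2"
    by (simp only: zero_less_divide_1_iff zero_less_numeral)
  then obtain n0 where n0: "\<And>n. n0 \<le> n \<Longrightarrow> \<bar>\<gamma>\<bar> * \<bar>t n * ln (1 / t n)\<bar> + t n * R < 1/2"
    unfolding eventually_sequentially by blast
  define h where "h n = t (n + n0)" for n
  have h_pos: "h n > 0" for n by (simp add: h_def t_pos)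
  have h_lim: "h \<longlonglongrightarrow> 0" unfolding h_def using t_lim by (rule LIMSEQ_ignore_initial_segment)
  have h_log_lim: "(\<lambda>n. h n * ln (1 / h n)) \<longlonglongrightarrow> 0" by (rule mult_ln_inverse_tendsto_0[OF h_pos h_lim])
  have h_small: "\<bar>\<gamma>\<bar> * \<bar>h n * ln (1 / h n)\<bar> + h n * R < 1/2" for n using n0[of "n + n0"] by (simp add: h_def)
  have h_phase: "exp (\<i> * of_real D * of_real (1 / h n)) = 1" for n
  proof -
    have "D * (1 / h n) = 2 * pi * real (Suc (n + n0))" using D by (simp add: h_def t_def)
    then have "exp (\<i> * of_real D * of_real (1 / h n)) = exp (\<i> * of_real (2 * pi * real (Suc (n + n0))))"
      by (simp only: mult.assoc of_real_mult[symmetric])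
    also have "\<dots> = cis (2 * pi * real (Suc (n + n0)))" by (simp only: cis_conv_exp)
    also have "\<dots> = 1" by (rule cis_multiple_2pi) simp
    finally show ?thesis .
  qed
  define Z where "Z n \<zeta> = 1 - \<i> * of_real (\<gamma> * (h n * ln (1 / h n))) + of_real (h n) * \<zeta>" for n \<zeta>
  have Z_near: "cmod (Z n \<zeta> - 1) < 1/2" if "\<zeta> \<in> S" for n \<zeta>
  proof -
    have "cmod (Z n \<zeta> - 1) \<le> cmod (\<i> * of_real (\<gamma> * (h n * ln (1 / h n)))) + cmod (of_real (h n) * \<zeta>)"
      using norm_triangle_ineq4[of "of_real (h n) * \<zeta>" "\<i> * of_real (\<gamma> * (h n * ln (1 / h n)))"]
      by (simp add: Z_def add.commute)
    also have "\<dots> = \<bar>\<gamma>\<bar> * \<bar>h n * ln (1 / h n)\<bar> + h n * cmod \<zeta>"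
      unfolding norm_mult norm_of_real using h_pos[of n] by (simp add: abs_mult)
    also have "\<dots> \<le> \<bar>\<gamma>\<bar> * \<bar>h n * ln (1 / h n)\<bar> + h n * R"
      using S_le[OF that] h_pos[of n] by (simp add: mult_left_mono)
    finally show ?thesis using h_small[of n] by linarith
  qed
  have Z_Re: "1/2 \<le> Re (Z n \<zeta>)" "Re (Z n \<zeta>) \<le> 3/2" if "\<zeta> \<in> S" for n \<zeta>
    using Z_near[OF that, of n] abs_Re_le_cmod[of "Z n \<zeta> - 1"] by auto
  have Z_Im: "Im (Z n \<zeta>) + \<gamma> * h n * ln (1 / h n) = h n * Im \<zeta>" for n \<zeta>
    by (simp add: Z_def)
  have Im_le: "\<bar>h n * Im \<zeta>\<bar> \<le> R * h n" if "\<zeta> \<in> S" for n \<zeta>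
    using S_le[OF that] abs_Im_le_cmod[of \<zeta>] h_pos[of n] by (simp add: abs_mult)
  \<comment> \<open>removes the common phase of the two terms\<close>
  define e where "e n = exp (- (\<i> * of_real l0 * of_real (1 / h n)))" for n
  have e_norm: "cmod (e n) = 1" for n by (simp add: e_def)
  define F where "F n \<zeta> = of_real (h n powr (- m)) * secular N x C \<beta> (h n) (Z n \<zeta>) * e n" for n \<zeta>
  define f where "f \<zeta> = c0 * exp (\<i> * of_real l0 * \<zeta>) + c1 * exp (\<i> * of_real l1 * \<zeta>)" for \<zeta>
  have F_lim: "(\<lambda>n. F n (\<zeta> n) - f (\<zeta> n)) \<longlonglongrightarrow> 0" if \<zeta>: "\<And>n. \<zeta> n \<in> S" for \<zeta>
  proof -
    define z where "z n = Z n (\<zeta> n)" for n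
    interpret s: near_string N x C \<beta> \<gamma> h z R "1/2"
    proof
      show "1/2 \<le> cmod (z n)" for n
        using Z_Re(1)[OF \<zeta>, of n n] complex_Re_le_cmod[of "z n"] by (simp add: z_def)
      show "\<bar>Im (z n) + \<gamma> * h n * ln (1 / h n)\<bar> \<le> R * h n" for n
        unfolding z_def Z_Im by (rule Im_le[OF \<zeta>])
    qed (use h_pos h_lim in auto)
    have a: "(\<lambda>n. of_real (h n) * \<zeta> n) \<longlonglongrightarrow> 0"
      using tendsto_of_real[OF h_lim, where ?'a = complex] by (intro null_times_bounded[of _ _ R] S_le \<zeta>) simp
    have b: "(\<lambda>n. complex_of_real (\<gamma> * (h n * ln (1 / h n)))) \<longlonglongrightarrow> of_real (\<gamma> * 0)"
      by (intro tendsto_intros h_log_lim)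
    from tendsto_add[OF tendsto_diff[OF tendsto_const[of 1] tendsto_mult[OF tendsto_const[of \<i>] b]] a]
    have "z \<longlonglongrightarrow> 1 - \<i> * of_real (\<gamma> * 0) + 0"
      unfolding z_def[abs_def] Z_def .
    then have "z \<longlonglongrightarrow> 1" by simp
    have u: "s.u n = of_real (1 / h n) + \<zeta> n" for n
    proof -
      have "complex_of_real (h n) \<noteq> 0" using h_pos[of n] by simp
      then show ?thesis by (simp add: s.u_def z_def Z_def add_divide_distrib diff_divide_distrib)
    qed
    have osc: "s.osc l n = exp (\<i> * of_real l * of_real (1 / h n)) * exp (\<i> * of_real l * \<zeta> n)" for l n
      unfolding s.osc_def u distrib_left exp_add ..
    have osc0: "s.osc l0 n * e n = exp (\<i> * of_real l0 * \<zeta> n)" for n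
    proof -
      have "exp (\<i> * of_real l0 * of_real (1 / h n)) * e n = 1"
        unfolding e_def exp_minus by (rule right_inverse) simp
      then show ?thesis unfolding osc by (metis mult.assoc mult.commute mult_1)
    qed
    have factor: "a * b * c + - (a * d * c) = a * (b - d) * c" for a b c d :: complex
      by (simp add: algebra_simps)
    have osc1: "s.osc l1 n * e n = exp (\<i> * of_real l1 * \<zeta> n)" for n
    proof -
      have "exp (\<i> * of_real l1 * of_real (1 / h n)) * e n = exp (\<i> * of_real l1 * of_real (1 / h n) + - (\<i> * of_real l0 * of_real (1 / h n)))"
        unfolding e_def exp_add ..
      also have "\<i> * of_real l1 * of_real (1 / h n) + - (\<i> * of_real l0 * of_real (1 / h n)) =
         \<i> * of_real D * of_real (1 / h n)"
        unfolding D_def of_real_diff by (rule factor)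
      finally have "exp (\<i> * of_real l1 * of_real (1 / h n)) * e n = 1" unfolding h_phase .
      then show ?thesis unfolding osc by (metis mult.assoc mult.commute mult_1)
    qed
    have "(\<lambda>n. (of_real (h n powr (- m)) * secular N x C \<beta> (h n) (z n)
        - c0 * s.osc l0 n - c1 * s.osc l1 n) * e n) \<longlonglongrightarrow> 0"
      using lim[OF s.near_string_axioms \<open>z \<longlonglongrightarrow> 1\<close>] e_norm by (intro null_times_bounded[of _ _ 1]) auto
    moreover have "(of_real (h n powr (- m)) * secular N x C \<beta> (h n) (z n)
        - c0 * s.osc l0 n - c1 * s.osc l1 n) * e n = F n (\<zeta> n) - f (\<zeta> n)" for n
      unfolding F_def f_def z_def[symmetric] osc0[symmetric] osc1[symmetric] by (simp add: left_diff_distrib mult.assoc)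
    ultimately show ?thesis by simp
  qed
  have F_zero: "\<exists>n\<ge>k. \<exists>\<zeta>\<in>S. F n \<zeta> = 0" for k
  proof (rule ccontr)
    assume no: "\<not> ?thesis"
    have "f \<zeta>0 \<noteq> 0"
    proof (rule Hurwitz_no_zeros[of S "\<lambda>n. F (n + k)" f])
      show "open S" "connected S" "\<zeta>0 \<in> S" by (auto simp: S_def)
      show "F (n + k) holomorphic_on S" for n
      proof -
        have hol: "Z (n + k) holomorphic_on S" unfolding Z_def by (intro holomorphic_intros)
        have "0 \<notin> Z (n + k) ` S"
        proof
          assume "0 \<in> Z (n + k) ` S"
          then obtain \<zeta> where "\<zeta> \<in> S" "Z (n + k) \<zeta> = 0" by (metis imageE)
          then show False using Z_Re(1)[of \<zeta> "n + k"] by simp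
        qed
        from holomorphic_on_compose_gen[OF hol holomorphic_secular[OF this], of N x C \<beta> "h (n + k)"]
        have "(\<lambda>\<zeta>. secular N x C \<beta> (h (n + k)) (Z (n + k) \<zeta>)) holomorphic_on S" by (simp add: o_def)
        then show ?thesis unfolding F_def by (intro holomorphic_intros)
      qed
      show "f holomorphic_on S" unfolding f_def by (intro holomorphic_intros)
      show "uniform_limit K (\<lambda>n. F (n + k)) f sequentially" if "compact K" "K \<subseteq> S" for K
      proof (rule uniform_limit_sequentiallyI)
        fix \<zeta> :: "nat \<Rightarrow> complex" assume K: "\<And>n. \<zeta> n \<in> K"
        have "(\<lambda>n. F n (\<zeta> (n - k)) - f (\<zeta> (n - k))) \<longlonglongrightarrow> 0"
          by (rule F_lim) (use K that in auto)
        from LIMSEQ_ignore_initial_segment[OF this, of k]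
        show "(\<lambda>n. F (n + k) (\<zeta> n) - f (\<zeta> n)) \<longlonglongrightarrow> 0" by simp
      qed
      show "F (n + k) \<zeta> \<noteq> 0" if "\<zeta> \<in> S" for n \<zeta> using no that le_add2 by blast
      have f_eq: "f \<zeta> = exp (\<i> * of_real l0 * \<zeta>) * (c0 + c1 * exp (\<i> * of_real D * \<zeta>))" for \<zeta>
      proof -
        have "\<i> * of_real l1 * \<zeta> = \<i> * of_real l0 * \<zeta> + \<i> * of_real D * \<zeta>"
          by (simp add: D_def left_diff_distrib right_diff_distrib)
        then show ?thesis unfolding f_def by (simp add: exp_add distrib_left mult_ac)
      qed
      show "\<not> f constant_on S"
      proof
        assume "f constant_on S"
        \<comment> \<open>moving in the imaginary direction changes the modulus of \<open>exp (\<i> D \<zeta>)\<close>\<close>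
        moreover define \<zeta>1 where "\<zeta>1 = \<zeta>0 + \<i> / 2"
        have "\<zeta>0 \<in> S" "\<zeta>1 \<in> S" by (auto simp: S_def \<zeta>1_def dist_norm norm_divide)
        ultimately have "f \<zeta>1 = f \<zeta>0" unfolding constant_on_def by metis
        also have "f \<zeta>0 = 0" unfolding f_eq root using c by simp
        finally have "c0 + c1 * exp (\<i> * of_real D * \<zeta>1) = 0" unfolding f_eq by simp
        moreover have "exp (\<i> * of_real D * \<zeta>1) = (- c0 / c1) * exp (- of_real (D / 2))"
        proof -
          have "\<i> * of_real D * \<zeta>1 = \<i> * of_real D * \<zeta>0 + - of_real (D / 2)"
          proof -
            have "\<i> * of_real D * \<i> = - complex_of_real D" by (rule complex_eqI) auto
            then show ?thesis by (simp add: \<zeta>1_def distrib_left)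
          qed
          then show ?thesis unfolding root[symmetric] by (simp only: exp_add)
        qed
        ultimately have "exp (- complex_of_real (D / 2)) = 1" using c by (simp add: field_simps)
        then have "cmod (exp (- complex_of_real (D / 2))) = 1" by simp
        then show False using D by (simp add: norm_exp_eq_Re)
      qed
    qed
    moreover have "f \<zeta>0 = 0"
    proof -
      have "\<i> * of_real l1 * \<zeta>0 = \<i> * of_real l0 * \<zeta>0 + \<i> * of_real D * \<zeta>0"
        by (simp add: D_def left_diff_distrib right_diff_distrib)
      then have "exp (\<i> * of_real l1 * \<zeta>0) = exp (\<i> * of_real l0 * \<zeta>0) * (- c0 / c1)"
        by (simp only: exp_add root)
      then show ?thesis using c by (simp add: f_def)
    qed
    ultimately show False by simp
  qed
  then obtain \<phi> \<zeta> where \<phi>: "\<And>k. \<phi> k \<ge> k" and \<zeta>: "\<And>k. \<zeta> k \<in> S" and F0: "\<And>k. F (\<phi> k) (\<zeta> k) = 0"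
    by metis
  have sec0: "secular N x C \<beta> (h (\<phi> k)) (Z (\<phi> k) (\<zeta> k)) = 0" for k
  proof -
    have "e (\<phi> k) \<noteq> 0" "h (\<phi> k) powr (- m) \<noteq> 0" using e_norm[of "\<phi> k"] h_pos[of "\<phi> k"] by auto
    then show ?thesis using F0[of k] by (simp add: F_def)
  qed
  show ?thesis
    unfolding string_exponents_def mem_Collect_eq
  proof (intro exI conjI allI)
    show "h (\<phi> k) > 0" for k by (rule h_pos)
    have "filterlim \<phi> at_top sequentially"
      by (rule filterlim_at_top_mono[OF filterlim_ident]) (use \<phi> in auto)
    then show "(\<lambda>k. h (\<phi> k)) \<longlonglongrightarrow> 0" by (rule filterlim_compose[OF h_lim])
    show "resonance N x C \<beta> (h (\<phi> k)) (Z (\<phi> k) (\<zeta> k))" for k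
      unfolding resonance_iff[OF h_pos] using sec0 Z_Re(1)[OF \<zeta>, of "\<phi> k" k] by auto
    show "compact (closure {1/2..3/2::real})" "closure {1/2..3/2::real} \<subseteq> {0<..}" by auto
    show "Re (Z (\<phi> k) (\<zeta> k)) \<in> {1/2..3/2}" for k using Z_Re[OF \<zeta>] by simp
    show "(\<lambda>k. Im (Z (\<phi> k) (\<zeta> k)) - - \<gamma> * h (\<phi> k) * ln (1 / h (\<phi> k))) \<in> O(\<lambda>k. h (\<phi> k))"
    proof (rule bigoI[where c = R], rule always_eventually, rule allI)
      fix k
      have "Im (Z (\<phi> k) (\<zeta> k)) - - \<gamma> * h (\<phi> k) * ln (1 / h (\<phi> k)) = h (\<phi> k) * Im (\<zeta> k)"
        using Z_Im[of "\<phi> k" "\<zeta> k"] by simp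
      then show "norm (Im (Z (\<phi> k) (\<zeta> k)) - - \<gamma> * h (\<phi> k) * ln (1 / h (\<phi> k))) \<le> R * norm (h (\<phi> k))"
        using Im_le[OF \<zeta>, of "\<phi> k" k] h_pos[of "\<phi> k"] by simp
    qed
  qed
qed

end

context unique_slopes
begin

text \<open>
By uniqueness exactly two terms are leading at a slope: the constant and the dominant pair, or two
pairs sharing one entry. In both cases their frequencies differ.
\<close>

lemma string_exponents_eq: "string_exponents N x C \<beta> = newton_slopes N x \<beta>"
proof (rule antisym[OF string_exponents_subset], rule subsetI)
  fix \<gamma> assume slope: "\<gamma> \<in> newton_slopes N x \<beta>"
  then have \<gamma>: "\<gamma> > 0" and low: "low \<gamma> \<le> 0" unfolding newton_slopes_iff by auto
  \<comment> \<open>the limit of \<open>coef\<close> as \<open>z\<close> tends to \<open>1\<close>\<close>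
  define c where "c j k = complex_of_real (C j * C k) / 4" for j k
  have c_nz: "c j k \<noteq> 0" if "j \<in> left_min \<gamma>" "k \<in> right_min \<gamma>" for j k
    using C_nz left_min_range[OF that(1)] right_min_range[OF that(2)] by (simp add: c_def)
  have lim: "(\<lambda>n. of_real (h n powr (- low \<gamma>)) * secular N x C \<beta> (h n) (z n) - (if low \<gamma> = 0 then 1 else 0)
      - (\<Sum>(j, k)\<in>left_min \<gamma> \<times> right_min \<gamma>. c j k * near_string.osc \<gamma> h z (2 * (x k - x j)) n)) \<longlonglongrightarrow> 0"
    if ns: "near_string N x C \<beta> \<gamma> h z B (1/2)" and z1: "z \<longlonglongrightarrow> 1" for h z B
  proof -
    interpret s: near_string N x C \<beta> \<gamma> h z B "1/2" by (rule ns)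
    have coef: "(\<lambda>n. s.coef n j k - c j k) \<longlonglongrightarrow> 0" for j k
    proof -
      have "(\<lambda>n. s.coef n j k) \<longlonglongrightarrow> of_real (C j * C k) / (4 * 1\<^sup>2)"
        unfolding s.coef_def by (intro tendsto_intros z1) auto
      from tendsto_diff[OF this tendsto_const[of "c j k"]] show ?thesis by (simp add: c_def)
    qed
    have "(\<lambda>n. (s.coef n j k - c j k) * s.osc (2 * (x k - x j)) n) \<longlonglongrightarrow> 0" for j k
      by (rule null_times_bounded[OF coef s.osc_le])
    then have diff: "(\<lambda>n. \<Sum>(j, k)\<in>left_min \<gamma> \<times> right_min \<gamma>. (s.coef n j k - c j k) * s.osc (2 * (x k - x j)) n) \<longlonglongrightarrow>
      (\<Sum>(j, k)\<in>left_min \<gamma> \<times> right_min \<gamma>. 0)"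
      unfolding case_prod_unfold by (intro tendsto_sum)
    have split: "(\<Sum>(j, k)\<in>left_min \<gamma> \<times> right_min \<gamma>. (s.coef n j k - c j k) * s.osc (2 * (x k - x j)) n) =
       (\<Sum>(j, k)\<in>left_min \<gamma> \<times> right_min \<gamma>. s.coef n j k * s.osc (2 * (x k - x j)) n) -
       (\<Sum>(j, k)\<in>left_min \<gamma> \<times> right_min \<gamma>. c j k * s.osc (2 * (x k - x j)) n)" for n
      unfolding case_prod_unfold left_diff_distrib sum_subtractf ..
    have cancel: "(a - b - c) + (c - d) = a - b - d" for a b c d :: complex by simp
    from tendsto_add[OF s.secular_leading_low[OF \<gamma> low] diff] show ?thesis
      unfolding split cancel by simp
  qed
  obtain j k where jk: "j \<in> left_min \<gamma>" "k \<in> right_min \<gamma>"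
    using left_min_nonempty right_min_nonempty by blast
  have xjk: "x j < x k"
    using x_less[OF left_min_range[OF jk(1)] right_min_range[OF jk(2)]] min_pair_less[OF jk] \<gamma> low by simp
  consider "low \<gamma> = 0" | i i' where "low \<gamma> < 0" "i \<in> left_min \<gamma>" "i' \<in> left_min \<gamma>" "i < i'"
    | i i' where "low \<gamma> < 0" "i \<in> right_min \<gamma>" "i' \<in> right_min \<gamma>" "i < i'"
    using slope unfolding newton_slopes_iff by auto
  then show "\<gamma> \<in> string_exponents N x C \<beta>"
  proof cases
    case 1
    have single: "left_min \<gamma> = {j}" "right_min \<gamma> = {k}"
    proof -
      have "a = j" if "a \<in> left_min \<gamma>" for a using min_pairs_unique[OF \<gamma> 1 that jk(1) jk(2) jk(2)] by simp
      then show "left_min \<gamma> = {j}" using jk(1) by blast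
      have "a = k" if "a \<in> right_min \<gamma>" for a using min_pairs_unique[OF \<gamma> 1 jk(1) jk(1) that jk(2)] by simp
      then show "right_min \<gamma> = {k}" using jk(2) by blast
    qed
    show ?thesis
    proof (rule string_of_two_terms[of 0 "2 * (x k - x j)" 1 "c j k" \<gamma> "low \<gamma>"])
      fix h z B assume ns: "near_string N x C \<beta> \<gamma> h z B (1/2)" and z: "z \<longlonglongrightarrow> 1"
      interpret s: near_string N x C \<beta> \<gamma> h z B "1/2" by (rule ns)
      have "s.osc 0 n = 1" for n by (simp add: s.osc_def)
      then show "(\<lambda>n. of_real (h n powr (- low \<gamma>)) * secular N x C \<beta> (h n) (z n)
        - 1 * s.osc 0 n - c j k * s.osc (2 * (x k - x j)) n) \<longlonglongrightarrow> 0"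
        using lim[OF ns z] 1 unfolding single by simp
    qed (use xjk c_nz[OF jk] in auto)
  next
    case 2
    have "a = i \<or> a = i'" if "a \<in> left_min \<gamma>" for a
      using min_pairs_at_most_two(1)[OF \<gamma> 2(1,2,3) that] 2(4) by auto
    then have L: "left_min \<gamma> = {i, i'}" using 2(2,3) by blast
    have "a = k" if "a \<in> right_min \<gamma>" for a
      using min_pairs_at_most_two(3)[OF \<gamma> 2(1) 2(2-4) that jk(2)] .
    then have K: "right_min \<gamma> = {k}" using jk(2) by blast
    show ?thesis
    proof (rule string_of_two_terms[of "2 * (x k - x i')" "2 * (x k - x i)" "c i' k" "c i k" \<gamma> "low \<gamma>"])
      show "2 * (x k - x i') < 2 * (x k - x i)"
        using x_less[OF left_min_range[OF 2(2)] left_min_range[OF 2(3)] 2(4)] by simp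
      fix h z B assume ns: "near_string N x C \<beta> \<gamma> h z B (1/2)" and z: "z \<longlonglongrightarrow> 1"
      show "(\<lambda>n. of_real (h n powr (- low \<gamma>)) * secular N x C \<beta> (h n) (z n)
        - c i' k * near_string.osc \<gamma> h z (2 * (x k - x i')) n
        - c i k * near_string.osc \<gamma> h z (2 * (x k - x i)) n) \<longlonglongrightarrow> 0"
      proof -
        have two: "(\<Sum>(j, k)\<in>{i, i'} \<times> {k}. f j k) = f i' k + f i k" for f :: "nat \<Rightarrow> nat \<Rightarrow> complex"
          using 2(4) by (simp add: sum.cartesian_product[symmetric])
        have "(low \<gamma> = 0) = False" using 2(1) by simp
        then show ?thesis
          using lim[OF ns z] unfolding L K two by (simp only: if_False diff_zero diff_diff_eq)
      qed
    qed (use c_nz[OF 2(2) jk(2)] c_nz[OF 2(3) jk(2)] in auto)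
  next
    case 3
    have "a = i \<or> a = i'" if "a \<in> right_min \<gamma>" for a
      using min_pairs_at_most_two(2)[OF \<gamma> 3(1,2,3) that] 3(4) by auto
    then have L: "right_min \<gamma> = {i, i'}" using 3(2,3) by blast
    have J: "left_min \<gamma> = {j}"
    proof -
      have "a = j" if "a \<in> left_min \<gamma>" for a
        using min_pairs_at_most_two(3)[OF \<gamma> 3(1) that jk(1) _ 3(2,3)]
          min_pairs_at_most_two(3)[OF \<gamma> 3(1) jk(1) that _ 3(2,3)] 3(4)
        by (cases a j rule: linorder_cases) simp_all
      then show ?thesis using jk(1) by blast
    qed
    show ?thesis
    proof (rule string_of_two_terms[of "2 * (x i - x j)" "2 * (x i' - x j)" "c j i" "c j i'" \<gamma> "low \<gamma>"])
      show "2 * (x i - x j) < 2 * (x i' - x j)"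
        using x_less[OF right_min_range[OF 3(2)] right_min_range[OF 3(3)] 3(4)] by simp
      fix h z B assume ns: "near_string N x C \<beta> \<gamma> h z B (1/2)" and z: "z \<longlonglongrightarrow> 1"
      show "(\<lambda>n. of_real (h n powr (- low \<gamma>)) * secular N x C \<beta> (h n) (z n)
        - c j i * near_string.osc \<gamma> h z (2 * (x i - x j)) n
        - c j i' * near_string.osc \<gamma> h z (2 * (x i' - x j)) n) \<longlonglongrightarrow> 0"
      proof -
        have two: "(\<Sum>(j, k)\<in>{j} \<times> {i, i'}. f j k) = f j i + f j i'" for f :: "nat \<Rightarrow> nat \<Rightarrow> complex"
          using 3(4) by (simp add: sum.cartesian_product[symmetric])
        have "(low \<gamma> = 0) = False" using 3(1) by simp
        then show ?thesis
          using lim[OF ns z] unfolding L J two by (simp only: if_False diff_zero diff_diff_eq)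
      qed
    qed (use c_nz[OF jk(1) 3(2)] c_nz[OF jk(1) 3(3)] in auto)
  qed
qed

end

section \<open>Counting strings\<close>

context dominated_chain
begin

lemma num_strings_eq: "num_strings N x C \<beta> = card (newton_slopes N x \<beta>)"
  by (simp add: num_strings_def string_exponents_eq)

lemma slope_chain_avoids_gap:
  assumes "slope_chain N x \<beta> J K js" "j \<in> set js"
  shows "\<not> (J < j \<and> j < K)"
proof -
  obtain I where I: "Suc I < length js" "js ! I = J" "js ! Suc I = K" and sorted: "sorted_wrt (<) js"
    using assms(1) unfolding slope_chain_def by blast
  then have "successive (set js) J K" using successive_nth_iff[OF sorted] by blast
  then show ?thesis using assms(2) by (auto simp: successive_def)
qed

end

theorem corollary3:
  "(\<forall>N x C \<beta> J K.
      delta_params N x C \<beta> \<and> slopes_unique N x \<beta> \<and> dominant_pair N x \<beta> J K \<longrightarrow>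
        finite (string_exponents N x C \<beta>) \<and>
        num_strings N x C \<beta> \<le> N - K + J \<and> N - K + J \<le> N - 1 \<and>
        string_exponents N x C \<beta> \<subseteq> newton_slopes N x \<beta> \<and>
        (\<exists>js. slope_chain N x \<beta> J K js) \<and>
        (\<forall>js. slope_chain N x \<beta> J K js \<longrightarrow> \<not> (\<exists>j\<in>set js. J < j \<and> j < K)) \<and>
        (N = 2 \<or> N = 3 \<or> (N = 4 \<and> (J, K) \<notin> {(1, 2), (3, 4)}) \<longrightarrow>
          num_strings N x C \<beta> = N - K + J)) \<and>
   (\<forall>N J K. 2 \<le> N \<and> 1 \<le> J \<and> J < K \<and> K \<le> N \<longrightarrow>
      (\<exists>x C \<beta>. delta_params N x C \<beta> \<and> slopes_unique N x \<beta> \<and> dominant_pair N x \<beta> J K \<and>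
        num_strings N x C \<beta> = N - K + J))"
proof (intro conjI allI impI)
  fix N :: nat and x C \<beta> :: "nat \<Rightarrow> real" and J K :: nat
  assume "delta_params N x C \<beta> \<and> slopes_unique N x \<beta> \<and> dominant_pair N x \<beta> J K"
  then interpret dominated_chain N x C \<beta> J K by unfold_locales auto
  show "finite (string_exponents N x C \<beta>)" by (simp add: string_exponents_eq finite_newton_slopes)
  show "num_strings N x C \<beta> \<le> N - K + J" using num_strings_eq card_newton_slopes_le by simp
  show "N - K + J \<le> N - 1" using JK by auto
  show "string_exponents N x C \<beta> \<subseteq> newton_slopes N x \<beta>" by (rule string_exponents_subset)
  show "\<exists>js. slope_chain N x \<beta> J K js" using slope_chain_exists by blast
  show "\<not> (\<exists>j\<in>set js. J < j \<and> j < K)" if "slope_chain N x \<beta> J K js" for js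
    using slope_chain_avoids_gap[OF that] by blast
  show "num_strings N x C \<beta> = N - K + J" if "N = 2 \<or> N = 3 \<or> N = 4 \<and> (J, K) \<notin> {(1, 2), (3, 4)}"
  proof -
    have "J \<le> 2 \<and> N \<le> Suc K" using that JK by auto
    then show ?thesis using card_newton_slopes_short num_strings_eq by simp
  qed
next
  fix N J K :: nat
  assume "2 \<le> N \<and> 1 \<le> J \<and> J < K \<and> K \<le> N"
  then interpret sharp_example N J K by unfold_locales auto
  show "\<exists>x C \<beta>. delta_params N x C \<beta> \<and> slopes_unique N x \<beta> \<and> dominant_pair N x \<beta> J K \<and>
        num_strings N x C \<beta> = N - K + J"
    using params unique dominant num_strings_eq card_slopes by metis
qed

end
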